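(* Let $X_0$ be a Banach space and let $(T_0(t))_{t\geqslant 0}$ be a $C_0$-semigroup on $X_0$ with generator $A_0$ such that $0\in\rho(A_0)$. For $n\geqslant 1$ let $X_{-n}$ be the extrapolation space of order $n$ associated with $T_0$, with extended semigroup $T_{-n}$ and generator $A_{-n}$. Assume that the inductive limit $\operatorname{ind}_{n\in\mathbb{N}}X_{-n}$ of all extrapolation spaces is Hausdorff and let $X_{-\infty}$ be its completion. Then $X_{-\infty}$ is a complete barrelled locally convex space. The semigroups $T_{-n}$ induce a strongly continuous semigroup $T_{-\infty}=(T_{-\infty}(t))_{t\geqslant 0}$ on $X_{-\infty}$ whose generator $A_{-\infty}$ is defined on all of $X_{-\infty}$ and $A_{-\infty}\colon X_{-\infty}\to X_{-\infty}$ is an isomorphism (linear homeomorphism). For every $t\geqslant 0$ and every $n\geqslant 1$ the map $T_{-\infty}(t)$ is an extension of $T_{-n}(t)$ and the map $A_{-\infty}$ is an extension of $A_{-n}$.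
   Context: Extrapolation spaces: starting with $(X_0,\|\cdot\|_0)$, for $n\geqslant 1$ and $x\in X_{-n+1}$ put recursively $\|x\|_{-n}=\|A_{-n+1}^{-1}x\|_{-n+1}$, and let $X_{-n}$ be the completion of $(X_{-n+1},\|\cdot\|_{-n})$. For each $t\geqslant 0$, $T_{-n}(t)$ is the continuous extension of $T_{-n+1}(t)$ to $X_{-n}$; $(T_{-n}(t))_{t\geqslant 0}$ is a $C_0$-semigroup on $X_{-n}$ whose generator is denoted $A_{-n}$; it has domain $X_{-n+1}$ and is invertible, so that the recursion continues. One regards $X_{-n+1}\subseteq X_{-n}$, with continuous inclusion. The inductive limit $\operatorname{ind}_{n\in\mathbb{N}}X_{-n}$ is the union $X=\bigcup_{n\in\mathbb{N}}X_{-n}$ endowed with the finest linear topology making all inclusions $X_{-n}\to X$ continuous (as this is a countable increasing system of locally convex spaces, this is also the finest such locally convex topology). The maps $T_{-n}(t)$ define a continuous linear map $T(t)\colon X\to X$; $T_{-\infty}(t)\colon X_{-\infty}\to X_{-\infty}$ is its unique continuous linear extension to the completion, and this is the meaning of "induce". A strongly continuous semigroup on a locally convex space $Y$ is a map $T\colon[0,\infty)\to L(Y)$ (continuous linear operators) with $T(0)=I$, $T(t+s)=T(t)T(s)$, and $t\mapsto T(t)x$ continuous for every $x\in Y$; its generator is $Gx=\lim_{t\searrow 0}\frac{T(t)x-x}{t}$ on the set of those $x\in Y$ for which the limit exists. *)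

theory Defs
  imports "HOL-Analysis.Analysis"
begin

text \<open>
  All spaces are linear subspaces of one ambient vector space \<open>'e\<close> without topology, with scalar
  multiplication \<open>smul\<close>; each of them carries its own norm or topology (as an \<open>'e topology\<close> whose
  \<open>topspace\<close> is the subspace). In this way the spaces \<open>X\<^sub>0 \<subseteq> X\<^sub>-\<^sub>1 \<subseteq> \<dots> \<subseteq> X\<^sub>-\<^sub>\<infinity>\<close> are literally nested,
  and completions, which are determined only up to isomorphism, are given by predicates saying
  that one subspace is a completion of another. The scalar field is any \<open>real_normed_field\<close>, that
  is, the real or the complex numbers; real scalars act through \<open>of_real\<close>.
  Operators are functions on \<open>'e\<close> of which only the values on the relevant subspace matter.
\<close>

section \<open>Topological vector spaces\<close>

definition linear_topology ::
  "('k::real_normed_field \<Rightarrow> 'e::ab_group_add \<Rightarrow> 'e) \<Rightarrow> 'e topology \<Rightarrow> bool" where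
  "linear_topology smul \<tau> \<longleftrightarrow>
     module.subspace smul (topspace \<tau>) \<and>
     continuous_map (prod_topology \<tau> \<tau>) \<tau> (\<lambda>(x, y). x + y) \<and>
     continuous_map (prod_topology euclidean \<tau>) \<tau> (\<lambda>(c, x). smul c x)"

definition convex_set ::
  "('k::real_normed_field \<Rightarrow> 'e::ab_group_add \<Rightarrow> 'e) \<Rightarrow> 'e set \<Rightarrow> bool" where
  "convex_set smul S \<longleftrightarrow>
     (\<forall>x\<in>S. \<forall>y\<in>S. \<forall>u v::real. 0 \<le> u \<and> 0 \<le> v \<and> u + v = 1 \<longrightarrow>
        smul (of_real u) x + smul (of_real v) y \<in> S)"

definition locally_convex_space ::
  "('k::real_normed_field \<Rightarrow> 'e::ab_group_add \<Rightarrow> 'e) \<Rightarrow> 'e topology \<Rightarrow> bool" where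
  "locally_convex_space smul \<tau> \<longleftrightarrow>
     linear_topology smul \<tau> \<and>
     (\<forall>U. openin \<tau> U \<and> 0 \<in> U \<longrightarrow>
        (\<exists>C V. openin \<tau> V \<and> 0 \<in> V \<and> V \<subseteq> C \<and> C \<subseteq> U \<and> convex_set smul C))"

definition barrel ::
  "('k::real_normed_field \<Rightarrow> 'e::ab_group_add \<Rightarrow> 'e) \<Rightarrow> 'e topology \<Rightarrow> 'e set \<Rightarrow> bool" where
  "barrel smul \<tau> B \<longleftrightarrow>
     closedin \<tau> B \<and> convex_set smul B \<and>
     (\<forall>c. \<forall>x\<in>B. norm c \<le> 1 \<longrightarrow> smul c x \<in> B) \<and>
     (\<forall>x\<in>topspace \<tau>. \<exists>r>0. \<forall>c. norm c \<le> r \<longrightarrow> smul c x \<in> B)"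

definition barrelled_space ::
  "('k::real_normed_field \<Rightarrow> 'e::ab_group_add \<Rightarrow> 'e) \<Rightarrow> 'e topology \<Rightarrow> bool" where
  "barrelled_space smul \<tau> \<longleftrightarrow>
     locally_convex_space smul \<tau> \<and>
     (\<forall>B. barrel smul \<tau> B \<longrightarrow> (\<exists>V. openin \<tau> V \<and> 0 \<in> V \<and> V \<subseteq> B))"

text \<open>Completeness with respect to the translation-invariant uniformity: every Cauchy filter
  on the space converges.\<close>

definition cauchy_filter_in :: "'e::ab_group_add topology \<Rightarrow> 'e filter \<Rightarrow> bool" where
  "cauchy_filter_in \<tau> F \<longleftrightarrow>
     F \<noteq> bot \<and> eventually (\<lambda>x. x \<in> topspace \<tau>) F \<and>
     (\<forall>U. openin \<tau> U \<and> 0 \<in> U \<longrightarrow> eventually (\<lambda>(x, y). x - y \<in> U) (F \<times>\<^sub>F F))"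

definition complete_tvs :: "'e::ab_group_add topology \<Rightarrow> bool" where
  "complete_tvs \<tau> \<longleftrightarrow> (\<forall>F. cauchy_filter_in \<tau> F \<longrightarrow> (\<exists>x. limitin \<tau> (\<lambda>y. y) x F))"

text \<open>\<open>\<rho>\<close> is a Hausdorff completion of \<open>\<tau>\<close>.\<close>

definition tvs_completion ::
  "('k::real_normed_field \<Rightarrow> 'e::ab_group_add \<Rightarrow> 'e) \<Rightarrow> 'e topology \<Rightarrow> 'e topology \<Rightarrow> bool" where
  "tvs_completion smul \<tau> \<rho> \<longleftrightarrow>
     linear_topology smul \<rho> \<and> Hausdorff_space \<rho> \<and> complete_tvs \<rho> \<and>
     topspace \<tau> \<subseteq> topspace \<rho> \<and> subtopology \<rho> (topspace \<tau>) = \<tau> \<and>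
     \<rho> closure_of topspace \<tau> = topspace \<rho>"

definition linear_on ::
  "('k::real_normed_field \<Rightarrow> 'e::ab_group_add \<Rightarrow> 'e) \<Rightarrow> 'e set \<Rightarrow> ('e \<Rightarrow> 'e) \<Rightarrow> bool" where
  "linear_on smul V S \<longleftrightarrow>
     (\<forall>x\<in>V. \<forall>y\<in>V. S (x + y) = S x + S y) \<and> (\<forall>c. \<forall>x\<in>V. S (smul c x) = smul c (S x))"

definition continuous_linear_operator ::
  "('k::real_normed_field \<Rightarrow> 'e::ab_group_add \<Rightarrow> 'e) \<Rightarrow> 'e topology \<Rightarrow> ('e \<Rightarrow> 'e) \<Rightarrow> bool" where
  "continuous_linear_operator smul \<tau> S \<longleftrightarrow>
     linear_on smul (topspace \<tau>) S \<and> continuous_map \<tau> \<tau> S"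


section \<open>Strongly continuous semigroups and their generators\<close>

definition strongly_continuous_semigroup ::
  "('k::real_normed_field \<Rightarrow> 'e::ab_group_add \<Rightarrow> 'e) \<Rightarrow> 'e topology \<Rightarrow> (real \<Rightarrow> 'e \<Rightarrow> 'e) \<Rightarrow> bool" where
  "strongly_continuous_semigroup smul \<tau> T \<longleftrightarrow>
     (\<forall>t\<ge>0. continuous_linear_operator smul \<tau> (T t)) \<and>
     (\<forall>x\<in>topspace \<tau>. T 0 x = x) \<and>
     (\<forall>t\<ge>0. \<forall>s\<ge>0. \<forall>x\<in>topspace \<tau>. T (t + s) x = T t (T s x)) \<and>
     (\<forall>x\<in>topspace \<tau>. continuous_map (top_of_set {0..}) \<tau> (\<lambda>t. T t x))"

definition generator_limit ::
  "('k::real_normed_field \<Rightarrow> 'e::ab_group_add \<Rightarrow> 'e) \<Rightarrow> 'e topology \<Rightarrow> (real \<Rightarrow> 'e \<Rightarrow> 'e) \<Rightarrow>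
   'e \<Rightarrow> 'e \<Rightarrow> bool" where
  "generator_limit smul \<tau> T x y \<longleftrightarrow>
     limitin \<tau> (\<lambda>t. smul (of_real (1 / t)) (T t x - x)) y (at_right 0)"

definition generator_domain ::
  "('k::real_normed_field \<Rightarrow> 'e::ab_group_add \<Rightarrow> 'e) \<Rightarrow> 'e topology \<Rightarrow> (real \<Rightarrow> 'e \<Rightarrow> 'e) \<Rightarrow> 'e set" where
  "generator_domain smul \<tau> T = {x \<in> topspace \<tau>. \<exists>y. generator_limit smul \<tau> T x y}"

definition generator ::
  "('k::real_normed_field \<Rightarrow> 'e::ab_group_add \<Rightarrow> 'e) \<Rightarrow> 'e topology \<Rightarrow> (real \<Rightarrow> 'e \<Rightarrow> 'e) \<Rightarrow> 'e \<Rightarrow> 'e" where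
  "generator smul \<tau> T x = (THE y. generator_limit smul \<tau> T x y)"

definition resolvent_set ::
  "('k::real_normed_field \<Rightarrow> 'e::ab_group_add \<Rightarrow> 'e) \<Rightarrow> 'e topology \<Rightarrow> 'e set \<Rightarrow> ('e \<Rightarrow> 'e) \<Rightarrow> 'k set" where
  "resolvent_set smul \<tau> D A =
     {l. bij_betw (\<lambda>x. smul l x - A x) D (topspace \<tau>) \<and>
         continuous_map \<tau> \<tau> (the_inv_into D (\<lambda>x. smul l x - A x))}"


section \<open>Banach spaces and extrapolation spaces\<close>

text \<open>The distance is cut off outside the carrier because \<^locale>\<open>Metric_space\<close> requires
  nonnegativity and symmetry for all arguments, while a norm is constrained only on the carrier.\<close>

definition norm_dist :: "'e::ab_group_add set \<Rightarrow> ('e \<Rightarrow> real) \<Rightarrow> 'e \<Rightarrow> 'e \<Rightarrow> real" where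
  "norm_dist X N x y = (if x \<in> X \<and> y \<in> X then N (x - y) else 0)"

definition norm_topology :: "'e::ab_group_add set \<Rightarrow> ('e \<Rightarrow> real) \<Rightarrow> 'e topology" where
  "norm_topology X N = Metric_space.mtopology X (norm_dist X N)"

definition normed_space_on ::
  "('k::real_normed_field \<Rightarrow> 'e::ab_group_add \<Rightarrow> 'e) \<Rightarrow> 'e set \<Rightarrow> ('e \<Rightarrow> real) \<Rightarrow> bool" where
  "normed_space_on smul X N \<longleftrightarrow>
     module.subspace smul X \<and>
     (\<forall>x\<in>X. 0 \<le> N x \<and> (N x = 0 \<longleftrightarrow> x = 0)) \<and>
     (\<forall>x\<in>X. \<forall>y\<in>X. N (x + y) \<le> N x + N y) \<and>
     (\<forall>c. \<forall>x\<in>X. N (smul c x) = norm c * N x)"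

definition banach_space_on ::
  "('k::real_normed_field \<Rightarrow> 'e::ab_group_add \<Rightarrow> 'e) \<Rightarrow> 'e set \<Rightarrow> ('e \<Rightarrow> real) \<Rightarrow> bool" where
  "banach_space_on smul X N \<longleftrightarrow>
     normed_space_on smul X N \<and> Metric_space.mcomplete X (norm_dist X N)"

text \<open>\<open>(X', N', T')\<close> is the extrapolation space, with its extended semigroup, of \<open>(X, N, T)\<close>:
  \<open>X'\<close> is a completion of \<open>X\<close> under \<open>\<lambda>x. N (A\<^sup>-\<^sup>1 x)\<close>, where \<open>A\<close> is the generator of \<open>T\<close>, and
  \<open>T' t\<close> is the continuous extension of \<open>T t\<close>.\<close>

definition extrapolation_space ::
  "('k::real_normed_field \<Rightarrow> 'e::ab_group_add \<Rightarrow> 'e) \<Rightarrow>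
   'e set \<Rightarrow> ('e \<Rightarrow> real) \<Rightarrow> (real \<Rightarrow> 'e \<Rightarrow> 'e) \<Rightarrow>
   'e set \<Rightarrow> ('e \<Rightarrow> real) \<Rightarrow> (real \<Rightarrow> 'e \<Rightarrow> 'e) \<Rightarrow> bool" where
  "extrapolation_space smul X N T X' N' T' \<longleftrightarrow>
     (let \<tau> = norm_topology X N; \<tau>' = norm_topology X' N';
          D = generator_domain smul \<tau> T; A = generator smul \<tau> T
      in banach_space_on smul X' N' \<and> X \<subseteq> X' \<and> \<tau>' closure_of X = X' \<and>
         (\<forall>x\<in>X. N' x = N (the_inv_into D A x)) \<and>
         (\<forall>t\<ge>0. continuous_map \<tau>' \<tau>' (T' t) \<and> (\<forall>x\<in>X. T' t x = T t x)))"


section \<open>Inductive limits and induced operators\<close>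

text \<open>\<open>\<tau>\<close> is the finest linear topology on the union making all inclusions continuous.\<close>

definition inductive_limit_topology ::
  "('k::real_normed_field \<Rightarrow> 'e::ab_group_add \<Rightarrow> 'e) \<Rightarrow>
   (nat \<Rightarrow> 'e set) \<Rightarrow> (nat \<Rightarrow> 'e \<Rightarrow> real) \<Rightarrow> 'e topology \<Rightarrow> bool" where
  "inductive_limit_topology smul X N \<tau> \<longleftrightarrow>
     (let admissible = (\<lambda>\<sigma>. linear_topology smul \<sigma> \<and> topspace \<sigma> = (\<Union>n. X n) \<and>
                          (\<forall>n. continuous_map (norm_topology (X n) (N n)) \<sigma> (\<lambda>x. x)))
      in admissible \<tau> \<and> (\<forall>\<sigma>. admissible \<sigma> \<longrightarrow> (\<forall>U. openin \<sigma> U \<longrightarrow> openin \<tau> U)))"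

text \<open>The operators \<open>S n\<close> on \<open>X n\<close> define a continuous linear operator on the inductive limit \<open>\<tau>\<close>,
  and \<open>R\<close> is a continuous linear extension of it to the completion \<open>\<rho>\<close>.\<close>

definition induces_operator ::
  "('k::real_normed_field \<Rightarrow> 'e::ab_group_add \<Rightarrow> 'e) \<Rightarrow>
   (nat \<Rightarrow> 'e set) \<Rightarrow> 'e topology \<Rightarrow> 'e topology \<Rightarrow> (nat \<Rightarrow> 'e \<Rightarrow> 'e) \<Rightarrow> ('e \<Rightarrow> 'e) \<Rightarrow> bool" where
  "induces_operator smul X \<tau> \<rho> S R \<longleftrightarrow>
     (\<exists>Q. continuous_linear_operator smul \<tau> Q \<and> (\<forall>n. \<forall>x\<in>X n. Q x = S n x) \<and>
          continuous_linear_operator smul \<rho> R \<and> (\<forall>x\<in>topspace \<tau>. R x = Q x))"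

end

theory Submission
  imports Defs
begin

text \<open>
  The extrapolation step is a conjugation: the closure \<open>K : X\<^sub>-\<^sub>n \<rightarrow> X\<^sub>-\<^sub>n\<^sub>-\<^sub>1\<close> of \<open>A\<^sub>-\<^sub>n\<close> is an isomorphism, it
  carries \<open>T\<^sub>-\<^sub>n\<close> into \<open>T\<^sub>-\<^sub>n\<^sub>-\<^sub>1\<close>, and \<open>A\<^sub>-\<^sub>n\<^sub>-\<^sub>1 = K\<close>. Hence on the union the generator is defined everywhere and
  is an isomorphism of each step onto the next one, so of the inductive limit, and it extends to the
  completion together with its inverse. The inductive limit of Banach spaces is barrelled, therefore the
  pointwise bounded families \<open>T(t)\<close> and \<open>(T(t) - I)/t\<close>, \<open>0 < t \<le> 1\<close>, are equicontinuous; this carries strong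
  continuity and the convergence of the difference quotients from the dense inductive limit to the
  whole completion.
\<close>

text \<open>The extrapolated norm is chosen so that \<open>A\<close> is isometric from its domain,
  normed by \<open>N\<close>, onto \<open>X\<close>, normed by \<open>N'\<close>; the domain is
  dense in \<open>X\<close> and \<open>X\<close> is dense in \<open>X'\<close>, so the closure of
  \<open>A\<close> is an isomorphism of the completed spaces. A conjugate of an invertible generator
  is again invertible, which lets the step be repeated. The topology of the limit is the finest
  linear one, not by definition the finest locally convex one; that the two agree rests on the index
  set being countable, and it makes convex neighbourhoods, hence barrels, available. The obstacle is
  the completion: its points need not lie in any \<open>X n\<close>, so nothing can be checked there
  in a Banach norm. Linear identities pass to it by density, but limits in \<open>t\<close> do so
  only with equicontinuity. Barrelledness of the dense subspace already gives this from boundedness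
  of single orbits, and such orbits are bounded because they are continuous images of compact
  intervals; for the difference quotients the value \<open>A x\<close> at \<open>0\<close> closes
  the interval.\<close>

definition zero_nbhd :: "'e::ab_group_add topology \<Rightarrow> 'e set \<Rightarrow> bool" where
  "zero_nbhd \<tau> U \<longleftrightarrow> (\<exists>V. openin \<tau> V \<and> 0 \<in> V \<and> V \<subseteq> U)"

lemma zero_nbhd_mono: "zero_nbhd \<tau> U \<Longrightarrow> U \<subseteq> V \<Longrightarrow> zero_nbhd \<tau> V"
  by (meson order_trans zero_nbhd_def)

lemma zero_nbhd_Int: "zero_nbhd \<tau> U \<Longrightarrow> zero_nbhd \<tau> V \<Longrightarrow> zero_nbhd \<tau> (U \<inter> V)"
  by (smt (verit, best) IntI Int_greatest Int_lower1 Int_lower2 openin_Int order_trans zero_nbhd_def)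

lemma zero_nbhd_zero: "zero_nbhd \<tau> U \<Longrightarrow> 0 \<in> U"
  by (auto simp: zero_nbhd_def)

lemma zero_nbhd_openin: "openin \<tau> U \<Longrightarrow> 0 \<in> U \<Longrightarrow> zero_nbhd \<tau> U"
  by (auto simp: zero_nbhd_def)

lemma zero_nbhd_subtopology:
  "zero_nbhd \<rho> U \<Longrightarrow> 0 \<in> S \<Longrightarrow> zero_nbhd (subtopology \<rho> S) (U \<inter> S)"
  unfolding zero_nbhd_def by (metis IntI Int_lower1 Int_mono openin_subtopology subset_refl)

locale normed_scalar_space = vector_space smul
  for smul :: "'k::real_normed_field \<Rightarrow> 'e::ab_group_add \<Rightarrow> 'e"
begin

abbreviation "lintop \<equiv> linear_topology smul"

text \<open>The algebraic half of a barrel. Closedness and absorption are kept apart because the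
  sets of \<open>base\<close> below need not be closed, and because this half alone passes through
  preimages, sums, closures and increasing unions.\<close>

definition absconvex :: "'e set \<Rightarrow> bool" where
  "absconvex S \<longleftrightarrow> convex_set smul S \<and> (\<forall>c. \<forall>x\<in>S. norm c \<le> 1 \<longrightarrow> smul c x \<in> S)"

lemma absconvexD:
  assumes "absconvex S"
  shows "x \<in> S \<Longrightarrow> y \<in> S \<Longrightarrow> 0 \<le> u \<Longrightarrow> 0 \<le> v \<Longrightarrow> u + v = 1 \<Longrightarrow>
      smul (of_real u) x + smul (of_real v) y \<in> S"
    and "x \<in> S \<Longrightarrow> norm c \<le> 1 \<Longrightarrow> smul c x \<in> S"
  using assms by (auto simp: absconvex_def convex_set_def)

lemma barrel_absconvex:
  "barrel smul \<tau> B \<longleftrightarrow> closedin \<tau> B \<and> absconvex B \<and>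
     (\<forall>x\<in>topspace \<tau>. \<exists>r>0. \<forall>c. norm c \<le> r \<longrightarrow> smul c x \<in> B)"
  by (auto simp: barrel_def absconvex_def)

section \<open>Linear topologies\<close>

lemma lintop_subspace: "lintop \<tau> \<Longrightarrow> subspace (topspace \<tau>)"
  by (simp add: linear_topology_def)

lemma lintop_zero: "lintop \<tau> \<Longrightarrow> 0 \<in> topspace \<tau>"
  by (simp add: lintop_subspace subspace_0)

lemma continuous_map_lintop_add:
  assumes "lintop \<tau>" "continuous_map \<sigma> \<tau> f" "continuous_map \<sigma> \<tau> g"
  shows "continuous_map \<sigma> \<tau> (\<lambda>x. f x + g x)"
proof -
  have "continuous_map \<sigma> \<tau> ((\<lambda>(x, y). x + y) \<circ> (\<lambda>x. (f x, g x)))"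
    by (rule continuous_map_compose) (use assms in \<open>auto simp: linear_topology_def continuous_map_paired\<close>)
  then show ?thesis by (simp add: o_def)
qed

lemma continuous_map_lintop_smul:
  assumes "lintop \<tau>" "continuous_map \<sigma> euclidean c" "continuous_map \<sigma> \<tau> f"
  shows "continuous_map \<sigma> \<tau> (\<lambda>x. smul (c x) (f x))"
proof -
  have "continuous_map \<sigma> \<tau> ((\<lambda>(c, x). smul c x) \<circ> (\<lambda>x. (c x, f x)))"
    by (rule continuous_map_compose[where X' = "prod_topology euclidean \<tau>"])
       (use assms in \<open>auto simp: linear_topology_def continuous_map_paired\<close>)
  then show ?thesis by (simp add: o_def)
qed

lemma continuous_map_lintop_diff:
  assumes "lintop \<tau>" "continuous_map \<sigma> \<tau> f" "continuous_map \<sigma> \<tau> g"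
  shows "continuous_map \<sigma> \<tau> (\<lambda>x. f x - g x)"
proof -
  have "continuous_map \<sigma> \<tau> (\<lambda>x. f x + smul (-1) (g x))"
    by (intro continuous_map_lintop_add continuous_map_lintop_smul assms) auto
  then show ?thesis by simp
qed

lemma limitin_lintop_add:
  assumes "lintop \<tau>" "limitin \<tau> f l F" "limitin \<tau> g m F"
  shows "limitin \<tau> (\<lambda>x. f x + g x) (l + m) F"
proof -
  have "limitin (prod_topology \<tau> \<tau>) (\<lambda>x. (f x, g x)) (l, m) F"
    using assms by (simp add: limitin_pairwise o_def)
  then have "limitin \<tau> ((\<lambda>(x, y). x + y) \<circ> (\<lambda>x. (f x, g x))) ((\<lambda>(x, y). x + y) (l, m)) F"
    using assms(1) by (intro continuous_map_limit) (auto simp: linear_topology_def)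
  then show ?thesis by (simp add: o_def)
qed

lemma limitin_lintop_smul:
  assumes "lintop \<tau>" "(c \<longlongrightarrow> k) F" "limitin \<tau> f l F"
  shows "limitin \<tau> (\<lambda>x. smul (c x) (f x)) (smul k l) F"
proof -
  have "limitin (prod_topology euclidean \<tau>) (\<lambda>x. (c x, f x)) (k, l) F"
    using assms by (simp add: limitin_pairwise o_def)
  then have "limitin \<tau> ((\<lambda>(c, x). smul c x) \<circ> (\<lambda>x. (c x, f x))) ((\<lambda>(c, x). smul c x) (k, l)) F"
    using assms(1) by (intro continuous_map_limit) (auto simp: linear_topology_def)
  then show ?thesis by (simp add: o_def)
qed

lemma openin_lintop_preimage_diff:
  assumes "lintop \<tau>" "openin \<tau> U" "a \<in> topspace \<tau>"
  shows "openin \<tau> {x \<in> topspace \<tau>. x - a \<in> U}"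
  by (rule openin_continuous_map_preimage[OF _ assms(2)])
     (intro continuous_map_lintop_diff assms, auto simp: assms continuous_map_const)

text \<open>Translations are continuous, so convergence to \<open>l\<close> can be tested with
  neighbourhoods of zero; the splitting of errors in \<open>limitin_dense_barrelled\<close> uses
  this form. The clause \<open>f x \<in> topspace \<tau>\<close> is stated separately because a
  \<open>zero_nbhd\<close> may reach outside the carrier.\<close>

lemma limitin_lintop_iff:
  assumes "lintop \<tau>"
  shows "limitin \<tau> f l F \<longleftrightarrow> l \<in> topspace \<tau> \<and>
           (\<forall>U. zero_nbhd \<tau> U \<longrightarrow> eventually (\<lambda>x. f x \<in> topspace \<tau> \<and> f x - l \<in> U) F)"
    (is "?L \<longleftrightarrow> ?R")
proof
  assume L: ?L
  then have l: "l \<in> topspace \<tau>" by (rule limitin_topspace)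
  have "eventually (\<lambda>x. f x \<in> topspace \<tau> \<and> f x - l \<in> U) F" if U: "zero_nbhd \<tau> U" for U
  proof -
    obtain V where V: "openin \<tau> V" "0 \<in> V" "V \<subseteq> U" using U by (auto simp: zero_nbhd_def)
    have "eventually (\<lambda>x. f x \<in> {x \<in> topspace \<tau>. x - l \<in> V}) F"
      using L openin_lintop_preimage_diff[OF assms V(1) l] l V by (auto simp: limitin_def)
    then show ?thesis by (rule eventually_mono) (use V in auto)
  qed
  with l show ?R by blast
next
  assume R: ?R
  show ?L
    unfolding limitin_def
  proof (intro conjI allI impI)
    show l: "l \<in> topspace \<tau>" using R by blast
    fix U assume U: "openin \<tau> U \<and> l \<in> U"
    have "openin \<tau> {x \<in> topspace \<tau>. x + l \<in> U}"
      by (rule openin_continuous_map_preimage[OF _ U[THEN conjunct1]])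
         (intro continuous_map_lintop_add assms, auto simp: l continuous_map_const)
    then have "zero_nbhd \<tau> {x \<in> topspace \<tau>. x + l \<in> U}"
      using U lintop_zero[OF assms] by (auto intro!: zero_nbhd_openin)
    then have "eventually (\<lambda>x. f x \<in> topspace \<tau> \<and> f x - l \<in> {x \<in> topspace \<tau>. x + l \<in> U}) F"
      using R by blast
    then show "eventually (\<lambda>x. f x \<in> U) F" by (rule eventually_mono) auto
  qed
qed

lemma openin_lintopI:
  assumes "lintop \<tau>" "U \<subseteq> topspace \<tau>"
    and "\<And>x. x \<in> U \<Longrightarrow> \<exists>V. zero_nbhd \<tau> V \<and> (\<forall>y\<in>topspace \<tau>. y - x \<in> V \<longrightarrow> y \<in> U)"
  shows "openin \<tau> U"
proof (subst openin_subopen, intro ballI)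
  fix x assume x: "x \<in> U"
  obtain V where V: "zero_nbhd \<tau> V" "\<forall>y\<in>topspace \<tau>. y - x \<in> V \<longrightarrow> y \<in> U"
    using assms(3)[OF x] by blast
  then obtain W where W: "openin \<tau> W" "0 \<in> W" "W \<subseteq> V" by (auto simp: zero_nbhd_def)
  have "openin \<tau> {y \<in> topspace \<tau>. y - x \<in> W}"
    using openin_lintop_preimage_diff[OF assms(1) W(1)] x assms(2) by blast
  moreover have "{y \<in> topspace \<tau>. y - x \<in> W} \<subseteq> U" using V W by auto
  ultimately show "\<exists>T. openin \<tau> T \<and> x \<in> T \<and> T \<subseteq> U"
    using x W assms(2) by (intro exI[of _ "{y \<in> topspace \<tau>. y - x \<in> W}"]) auto
qed

text \<open>The replacement for halving an epsilon: sum and difference are continuous at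
  \<open>(0, 0)\<close>, and a product neighbourhood there can be shrunk to a square.\<close>

lemma zero_nbhd_half:
  assumes "lintop \<tau>" "zero_nbhd \<tau> U"
  obtains V where "zero_nbhd \<tau> V" "V \<subseteq> topspace \<tau>"
    "\<And>x y. x \<in> V \<Longrightarrow> y \<in> V \<Longrightarrow> x + y \<in> U" "\<And>x y. x \<in> V \<Longrightarrow> y \<in> V \<Longrightarrow> x - y \<in> U"
proof -
  obtain U' where U': "openin \<tau> U'" "0 \<in> U'" "U' \<subseteq> U" using assms by (auto simp: zero_nbhd_def)
  let ?P = "prod_topology \<tau> \<tau>"
  have "continuous_map ?P \<tau> (\<lambda>z. fst z + snd z)" "continuous_map ?P \<tau> (\<lambda>z. fst z - snd z)"
    by (intro continuous_map_lintop_add continuous_map_lintop_diff continuous_map_fst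
        continuous_map_snd assms)+
  then have "openin ?P {z \<in> topspace ?P. fst z + snd z \<in> U'}"
    "openin ?P {z \<in> topspace ?P. fst z - snd z \<in> U'}"
    using U' openin_continuous_map_preimage by blast+
  then have "openin ?P ({z \<in> topspace ?P. fst z + snd z \<in> U'} \<inter> {z \<in> topspace ?P. fst z - snd z \<in> U'})"
    (is "openin ?P ?S") by (rule openin_Int)
  moreover have "(0, 0) \<in> ?S"
    using U' lintop_zero[OF assms(1)] by auto
  ultimately obtain A B where AB: "openin \<tau> A" "openin \<tau> B" "0 \<in> A" "0 \<in> B" "A \<times> B \<subseteq> ?S"
    unfolding openin_prod_topology_alt by meson
  have *: "x + y \<in> U" "x - y \<in> U" if "x \<in> A" "y \<in> B" for x y
    using subsetD[OF AB(5), of "(x, y)"] that U' by auto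
  show thesis
  proof
    show "zero_nbhd \<tau> (A \<inter> B)" using AB by (intro zero_nbhd_openin) auto
    show "A \<inter> B \<subseteq> topspace \<tau>" using AB openin_subset by blast
  qed (use * in auto)
qed

text \<open>Continuity of scalar multiplication at the pair \<open>(0, x)\<close>. At a single
  \<open>x\<close> it gives absorption, at \<open>x = 0\<close> balanced neighbourhoods, and over a
  compact set a common radius.\<close>

lemma zero_nbhd_smul_near:
  assumes "lintop \<tau>" "zero_nbhd \<tau> U" "x \<in> topspace \<tau>"
  obtains r V where "r > 0" "openin \<tau> V" "x \<in> V"
        "\<And>(c::'k) y. norm c \<le> r \<Longrightarrow> y \<in> V \<Longrightarrow> smul c y \<in> U"
proof -
  obtain U' where U': "openin \<tau> U'" "0 \<in> U'" "U' \<subseteq> U" using assms by (auto simp: zero_nbhd_def)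
  let ?P = "prod_topology (euclidean :: 'k topology) \<tau>"
  have "continuous_map ?P \<tau> (\<lambda>z. smul (fst z) (snd z))"
    by (intro continuous_map_lintop_smul continuous_map_fst continuous_map_snd assms)
  then have "openin ?P {z \<in> topspace ?P. smul (fst z) (snd z) \<in> U'}" (is "openin ?P ?S")
    using U' openin_continuous_map_preimage by blast
  moreover have "(0, x) \<in> ?S" using U' assms by auto
  ultimately obtain A B where AB: "openin euclidean A" "openin \<tau> B" "0 \<in> A" "x \<in> B" "A \<times> B \<subseteq> ?S"
    unfolding openin_prod_topology_alt by meson
  then obtain e where e: "e > 0" "ball 0 e \<subseteq> A" by (auto simp: open_contains_ball)
  show thesis
  proof
    \<comment> \<open>The radius is halved because the claim allows \<open>norm c \<le> r\<close>,
      whereas the ball is open.\<close>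
    show "e / 2 > 0" using e by simp
    fix c :: 'k and y assume "norm c \<le> e / 2" "y \<in> B"
    then have "c \<in> A" using e by (auto intro!: subsetD[OF e(2)])
    then show "smul c y \<in> U" using subsetD[OF AB(5), of "(c, y)"] \<open>y \<in> B\<close> U' by auto
  qed (use AB in auto)
qed

lemma zero_nbhd_absorbing:
  assumes "lintop \<tau>" "zero_nbhd \<tau> U" "x \<in> topspace \<tau>"
  shows "\<exists>r>0. \<forall>c. norm c \<le> r \<longrightarrow> smul c x \<in> U"
  by (rule zero_nbhd_smul_near[OF assms]) blast

lemma zero_nbhd_scaled_preimage:
  assumes "lintop \<tau>" "zero_nbhd \<tau> U"
  shows "zero_nbhd \<tau> {x \<in> topspace \<tau>. smul c x \<in> U}"
proof -
  obtain V where V: "openin \<tau> V" "0 \<in> V" "V \<subseteq> U" using assms by (auto simp: zero_nbhd_def)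
  have "openin \<tau> {x \<in> topspace \<tau>. smul c x \<in> V}"
    by (rule openin_continuous_map_preimage[OF _ V(1)])
       (use assms in \<open>auto intro!: continuous_map_lintop_smul[where f = "\<lambda>x. x"]\<close>)
  then show ?thesis
    using V lintop_zero[OF assms(1)] by (auto simp: zero_nbhd_def)
qed

lemma zero_nbhd_balanced_core:
  assumes "lintop \<tau>" "zero_nbhd \<tau> U"
  shows "zero_nbhd \<tau> {x \<in> topspace \<tau>. \<forall>c. norm c \<le> 1 \<longrightarrow> smul c x \<in> U}"
proof -
  have 0: "0 \<in> topspace \<tau>" using lintop_zero[OF assms(1)] .
  obtain r V where V: "r > 0" "openin \<tau> V" "0 \<in> V" "\<And>c y. norm c \<le> r \<Longrightarrow> y \<in> V \<Longrightarrow> smul c y \<in> U"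
    by (rule zero_nbhd_smul_near[OF assms 0]) blast
  \<comment> \<open>The core contains \<open>r V\<close>: for \<open>x = r v\<close> and
    \<open>norm c \<le> 1\<close> one has \<open>c x = (c r) v\<close> with
    \<open>norm (c r) \<le> r\<close>.\<close>
  have "zero_nbhd \<tau> {x \<in> topspace \<tau>. smul (inverse (of_real r)) x \<in> V}"
    by (intro zero_nbhd_scaled_preimage zero_nbhd_openin assms V)
  moreover have "smul c x \<in> U" if "smul (inverse (of_real r)) x \<in> V" "norm c \<le> 1" for c x
  proof -
    have "norm (c * of_real r) \<le> r" using that V(1) by (simp add: norm_mult mult_left_le_one_le)
    from V(4)[OF this that(1)] show ?thesis using V(1) by (simp add: mult.assoc)
  qed
  ultimately show ?thesis by (elim zero_nbhd_mono) auto
qed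

text \<open>A point \<open>x\<close> of the closure has some \<open>y\<close> in \<open>W\<close>
  with \<open>y - x\<close> in \<open>W\<close>, so it is itself a difference of two elements of
  \<open>W\<close>.\<close>

lemma closure_of_subset_nbhd:
  assumes "lintop \<tau>" "zero_nbhd \<tau> W" "\<And>x y. x \<in> W \<Longrightarrow> y \<in> W \<Longrightarrow> x - y \<in> U"
  shows "\<tau> closure_of W \<subseteq> U"
proof
  fix x assume x: "x \<in> \<tau> closure_of W"
  then have xt: "x \<in> topspace \<tau>" by (simp add: in_closure_of)
  obtain W' where W': "openin \<tau> W'" "0 \<in> W'" "W' \<subseteq> W" using assms by (auto simp: zero_nbhd_def)
  have "openin \<tau> {y \<in> topspace \<tau>. y - x \<in> W'}" by (rule openin_lintop_preimage_diff[OF assms(1) W'(1) xt])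
  moreover have "x \<in> {y \<in> topspace \<tau>. y - x \<in> W'}" using xt W' by auto
  ultimately obtain y where "y \<in> W" "y - x \<in> W'"
    using x[unfolded in_closure_of, THEN conjunct2, rule_format, of "{y \<in> topspace \<tau>. y - x \<in> W'}"]
    by auto
  then have "y - (y - x) \<in> U" using W' by (intro assms(3)) auto
  then show "x \<in> U" by simp
qed

lemma zero_nbhd_closed:
  assumes "lintop \<tau>" "zero_nbhd \<tau> U"
  obtains V where "zero_nbhd \<tau> V" "closedin \<tau> V" "V \<subseteq> U"
proof -
  obtain W where W: "zero_nbhd \<tau> W" "W \<subseteq> topspace \<tau>" "\<And>x y. x \<in> W \<Longrightarrow> y \<in> W \<Longrightarrow> x - y \<in> U"
    using zero_nbhd_half[OF assms] by metis
  show thesis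
  proof
    show "zero_nbhd \<tau> (\<tau> closure_of W)"
      by (rule zero_nbhd_mono[OF W(1) closure_of_subset[OF W(2)]])
    show "\<tau> closure_of W \<subseteq> U" by (rule closure_of_subset_nbhd[OF assms(1) W(1,3)])
  qed simp
qed

text \<open>Regularity of the target is what allows pointwise limits along a dense set to be
  assembled into a continuous extension; see \<open>continuous_linear_extension\<close>.\<close>

lemma regular_space_lintop:
  assumes "lintop \<tau>"
  shows "regular_space \<tau>"
proof (rule neighbourhood_base_of_closedin[THEN iffD1], unfold neighbourhood_base_of, intro allI impI)
  fix W x assume W: "openin \<tau> W \<and> x \<in> W"
  then have x: "x \<in> topspace \<tau>" using openin_subset by blast
  have "openin \<tau> {y \<in> topspace \<tau>. y + x \<in> W}"
    by (rule openin_continuous_map_preimage[OF _ W[THEN conjunct1]])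
       (intro continuous_map_lintop_add assms, auto simp: x continuous_map_const)
  then have "zero_nbhd \<tau> {y \<in> topspace \<tau>. y + x \<in> W}"
    using W lintop_zero[OF assms] by (auto intro!: zero_nbhd_openin)
  then obtain V where V: "zero_nbhd \<tau> V" "closedin \<tau> V" "V \<subseteq> {y \<in> topspace \<tau>. y + x \<in> W}"
    by (rule zero_nbhd_closed[OF assms])
  then obtain V' where V': "openin \<tau> V'" "0 \<in> V'" "V' \<subseteq> V" by (auto simp: zero_nbhd_def)
  have "openin \<tau> {y \<in> topspace \<tau>. y - x \<in> V'}" by (rule openin_lintop_preimage_diff[OF assms V'(1) x])
  moreover have "closedin \<tau> {y \<in> topspace \<tau>. y - x \<in> V}"
    by (rule closedin_continuous_map_preimage[OF _ V(2)])
       (intro continuous_map_lintop_diff assms, auto simp: x continuous_map_const)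
  moreover have "{y \<in> topspace \<tau>. y - x \<in> V} \<subseteq> W" using V(3) by fastforce
  moreover have "x \<in> {y \<in> topspace \<tau>. y - x \<in> V'}" using x V'(2) by simp
  moreover have "{y \<in> topspace \<tau>. y - x \<in> V'} \<subseteq> {y \<in> topspace \<tau>. y - x \<in> V}" using V'(3) by blast
  ultimately show "\<exists>U V. openin \<tau> U \<and> closedin \<tau> V \<and> x \<in> U \<and> U \<subseteq> V \<and> V \<subseteq> W"
    by (intro exI[of _ "{y \<in> topspace \<tau>. y - x \<in> V'}"] exI[of _ "{y \<in> topspace \<tau>. y - x \<in> V}"] conjI)
qed

lemma continuous_map_linearI:
  assumes "lintop \<tau>" "lintop \<sigma>" "linear_on smul (topspace \<tau>) f"
    "\<And>x. x \<in> topspace \<tau> \<Longrightarrow> f x \<in> topspace \<sigma>"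
    "\<And>U. zero_nbhd \<sigma> U \<Longrightarrow> zero_nbhd \<tau> {x \<in> topspace \<tau>. f x \<in> U}"
  shows "continuous_map \<tau> \<sigma> f"
  unfolding continuous_map_def
proof (intro conjI allI impI)
  show "f \<in> topspace \<tau> \<rightarrow> topspace \<sigma>" using assms(4) by (simp add: Pi_iff)
  fix U assume U: "openin \<sigma> U"
  show "openin \<tau> {x \<in> topspace \<tau>. f x \<in> U}"
  proof (rule openin_lintopI[OF assms(1)])
    fix x assume x: "x \<in> {x \<in> topspace \<tau>. f x \<in> U}"
    then have fx: "f x \<in> topspace \<sigma>" using assms(4) by simp
    have "openin \<sigma> {y \<in> topspace \<sigma>. y + f x \<in> U}"
      by (rule openin_continuous_map_preimage[OF _ U])
         (intro continuous_map_lintop_add assms, auto simp: fx continuous_map_const)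
    then have "zero_nbhd \<sigma> {y \<in> topspace \<sigma>. y + f x \<in> U}"
      using x lintop_zero[OF assms(2)] by (auto intro!: zero_nbhd_openin)
    from assms(5)[OF this]
    have "zero_nbhd \<tau> {z \<in> topspace \<tau>. f z \<in> {y \<in> topspace \<sigma>. y + f x \<in> U}}" .
    moreover have "y \<in> {x \<in> topspace \<tau>. f x \<in> U}"
      if "y \<in> topspace \<tau>" "y - x \<in> {z \<in> topspace \<tau>. f z \<in> {y \<in> topspace \<sigma>. y + f x \<in> U}}" for y
    proof -
      have "f ((y - x) + x) = f (y - x) + f x"
        using that x assms(3) unfolding linear_on_def by blast
      then have "f y = f (y - x) + f x" by simp
      then show ?thesis using that by auto
    qed
    ultimately show "\<exists>V. zero_nbhd \<tau> V \<and> (\<forall>y\<in>topspace \<tau>. y - x \<in> V \<longrightarrow> y \<in> {x \<in> topspace \<tau>. f x \<in> U})"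
      by blast
  qed auto
qed

lemma linear_on_0: "linear_on smul V f \<Longrightarrow> 0 \<in> V \<Longrightarrow> f 0 = 0"
  unfolding linear_on_def by (metis scale_zero_left)

lemma linear_on_diff:
  assumes "linear_on smul V f" "subspace V" "x \<in> V" "y \<in> V"
  shows "f (x - y) = f x - f y"
proof -
  have "f (x + smul (-1) y) = f x + smul (-1) (f y)"
    using assms subspace_scale[OF assms(2,4)] unfolding linear_on_def by metis
  then show ?thesis by simp
qed

lemma zero_nbhd_preimage:
  assumes "continuous_map \<tau> \<sigma> f" "f 0 = 0" "0 \<in> topspace \<tau>" "zero_nbhd \<sigma> U"
  shows "zero_nbhd \<tau> {x \<in> topspace \<tau>. f x \<in> U}"
proof -
  obtain V where V: "openin \<sigma> V" "0 \<in> V" "V \<subseteq> U" using assms by (auto simp: zero_nbhd_def)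
  have "openin \<tau> {x \<in> topspace \<tau>. f x \<in> V}"
    by (rule openin_continuous_map_preimage[OF assms(1) V(1)])
  then show ?thesis using V assms by (auto simp: zero_nbhd_def)
qed

text \<open>Compact sets are bounded: each point has an open neighbourhood with a radius that serves
  all of it, and a finite subcover leaves the minimum of finitely many radii.\<close>

lemma compactin_absorbed:
  assumes "lintop \<tau>" "zero_nbhd \<tau> U" "compactin \<tau> K"
  shows "\<exists>r>0. \<forall>x\<in>K. \<forall>c. norm c \<le> r \<longrightarrow> smul c x \<in> U"
proof -
  define G where "G = {V. openin \<tau> V \<and> (\<exists>r>0. \<forall>c. \<forall>y\<in>V. norm c \<le> r \<longrightarrow> smul c y \<in> U)}"
  have "K \<subseteq> \<Union>G"
  proof
    fix x assume "x \<in> K"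
    then have x: "x \<in> topspace \<tau>" using assms(3) by (auto simp: compactin_def)
    obtain r V where "r > 0" "openin \<tau> V" "x \<in> V"
        "\<And>(c::'k) y. norm c \<le> r \<Longrightarrow> y \<in> V \<Longrightarrow> smul c y \<in> U"
      by (rule zero_nbhd_smul_near[OF assms(1,2) x]) blast
    then show "x \<in> \<Union>G" unfolding G_def by (intro UnionI[of V]) auto
  qed
  then obtain F where F: "finite F" "F \<subseteq> G" "K \<subseteq> \<Union>F"
    using assms(3) unfolding compactin_def G_def by (metis (no_types, lifting) mem_Collect_eq)
  have "\<exists>r>0. \<forall>c. \<forall>y\<in>\<Union>F. norm c \<le> r \<longrightarrow> smul c y \<in> U"
    using F(1,2)
  proof (induction rule: finite_induct)
    case empty show ?case by (auto intro: exI[of _ 1])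
  next
    case (insert V F)
    obtain r where r: "r > 0" "\<forall>c. \<forall>y\<in>\<Union>F. norm c \<le> r \<longrightarrow> smul c y \<in> U" using insert by auto
    obtain s where s: "s > 0" "\<forall>c. \<forall>y\<in>V. norm c \<le> s \<longrightarrow> smul c y \<in> U"
      using insert unfolding G_def by auto
    show ?case using r s by (intro exI[of _ "min r s"]) auto
  qed
  then show ?thesis using F(3) by (meson subsetD)
qed

lemma subtopology_lintop:
  assumes "lintop \<rho>" "subspace S" "S \<subseteq> topspace \<rho>"
  shows "lintop (subtopology \<rho> S)"
  unfolding linear_topology_def
proof (intro conjI)
  let ?s = "subtopology \<rho> S"
  have ts: "topspace ?s = S" using assms by auto
  show "subspace (topspace ?s)" using assms(2) ts by simp
  have i: "continuous_map ?s \<rho> (\<lambda>x. x)" by (simp add: continuous_map_from_subtopology)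
  note c = continuous_map_compose[OF continuous_map_fst i, unfolded o_def]
    continuous_map_compose[OF continuous_map_snd i, unfolded o_def]
  have "continuous_map (prod_topology ?s ?s) \<rho> (\<lambda>x. fst x + snd x)"
    by (rule continuous_map_lintop_add[OF assms(1) c])
  then show "continuous_map (prod_topology ?s ?s) ?s (\<lambda>(x, y). x + y)"
    using subspace_add[OF assms(2)] ts
    by (simp add: continuous_map_in_subtopology case_prod_unfold Pi_iff)
  have "continuous_map (prod_topology euclidean ?s) \<rho> (\<lambda>x. smul (fst x) (snd x))"
    by (rule continuous_map_lintop_smul[OF assms(1) continuous_map_fst c(2)])
  then show "continuous_map (prod_topology euclidean ?s) ?s (\<lambda>(x, y). smul x y)"
    using subspace_scale[OF assms(2)] ts
    by (simp add: continuous_map_in_subtopology case_prod_unfold Pi_iff)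
qed

section \<open>Extension from dense subspaces\<close>

lemma continuous_map_eq_dense:
  assumes "Hausdorff_space \<sigma>" "continuous_map \<rho> \<sigma> f" "continuous_map \<rho> \<sigma> g"
    "\<rho> closure_of S = topspace \<rho>" "\<And>x. x \<in> S \<Longrightarrow> f x = g x" "x \<in> topspace \<rho>"
  shows "f x = g x"
  by (rule forall_in_closure_of_eq[of x \<rho> S \<sigma>]) (use assms in auto)

lemma continuous_map_translate:
  assumes "lintop \<tau>" "a \<in> topspace \<tau>"
  shows "continuous_map \<tau> \<tau> (\<lambda>x. x + a)"
  by (intro continuous_map_lintop_add assms) (auto simp: assms continuous_map_const)

lemma continuous_map_scale:
  assumes "lintop \<tau>"
  shows "continuous_map \<tau> \<tau> (\<lambda>x. smul c x)"
  by (intro continuous_map_lintop_smul assms) auto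

text \<open>Each identity is continuous in one variable at a time, so for additivity density is
  invoked once per variable: fact \<open>1\<close> still has one summand in \<open>S\<close>, and
  fact \<open>2\<close> frees it.\<close>

lemma linear_on_dense:
  assumes "lintop \<rho>" "lintop \<sigma>" "Hausdorff_space \<sigma>" "continuous_map \<rho> \<sigma> g"
    "S \<subseteq> topspace \<rho>" "\<rho> closure_of S = topspace \<rho>" "linear_on smul S g" "subspace S"
  shows "linear_on smul (topspace \<rho>) g"
proof -
  have g: "g x \<in> topspace \<sigma>" if "x \<in> topspace \<rho>" for x
    using assms(4) that by (auto simp: continuous_map_def)
  have tr: "continuous_map \<rho> \<sigma> (\<lambda>x. g (x + a))" "continuous_map \<rho> \<sigma> (\<lambda>x. g x + g a)"
    if a: "a \<in> topspace \<rho>" for a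
  proof -
    show "continuous_map \<rho> \<sigma> (\<lambda>x. g (x + a))"
      using continuous_map_compose[OF continuous_map_translate[OF assms(1) a] assms(4)]
      by (simp add: o_def)
    show "continuous_map \<rho> \<sigma> (\<lambda>x. g x + g a)"
      by (rule continuous_map_lintop_add[OF assms(2,4)]) (simp add: g a)
  qed
  have 1: "g (x + y) = g x + g y" if "x \<in> topspace \<rho>" "y \<in> S" for x y
  proof (rule continuous_map_eq_dense[OF assms(3) tr assms(6) _ that(1)])
    show "g (x + y) = g x + g y" if "x \<in> S" for x
      using assms(7) that \<open>y \<in> S\<close> by (auto simp: linear_on_def)
  qed (use assms that in auto)
  have 2: "g (y + x) = g y + g x" if "x \<in> topspace \<rho>" "y \<in> topspace \<rho>" for x y
  proof (rule continuous_map_eq_dense[OF assms(3) tr assms(6) _ that(2)])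
    show "g (y + x) = g y + g x" if "y \<in> S" for y
      using 1[OF \<open>x \<in> topspace \<rho>\<close> that] by (simp add: add.commute)
  qed (use that in auto)
  have 3: "g (smul c x) = smul c (g x)" if "x \<in> topspace \<rho>" for c x
  proof (rule continuous_map_eq_dense[OF assms(3) _ _ assms(6) _ that])
    show "continuous_map \<rho> \<sigma> (\<lambda>x. g (smul c x))"
      using continuous_map_compose[OF continuous_map_scale[OF assms(1)] assms(4)] by (simp add: o_def)
    show "continuous_map \<rho> \<sigma> (\<lambda>x. smul c (g x))"
      using continuous_map_compose[OF assms(4) continuous_map_scale[OF assms(2)]] by (simp add: o_def)
    show "g (smul c x) = smul c (g x)" if "x \<in> S" for x
      using assms(7) that by (auto simp: linear_on_def)
  qed
  show ?thesis using 2 3 by (simp add: linear_on_def)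
qed

text \<open>For \<open>x\<close> and \<open>y\<close> in \<open>S\<close> near \<open>t\<close>,
  \<open>f x - f y = f (x - y)\<close> is small, so the values of \<open>f\<close> near
  \<open>t\<close> form a Cauchy filter although \<open>t\<close> has no image yet. Completeness
  supplies the pointwise limits, and linearity survives by density.\<close>

theorem continuous_linear_extension:
  assumes "lintop \<rho>" "lintop \<sigma>" "Hausdorff_space \<sigma>" "complete_tvs \<sigma>"
    and S: "subspace S" "S \<subseteq> topspace \<rho>" "\<rho> closure_of S = topspace \<rho>"
    and f: "continuous_map (subtopology \<rho> S) \<sigma> f" "linear_on smul S f"
  obtains g where "continuous_map \<rho> \<sigma> g" "linear_on smul (topspace \<rho>) g" "\<And>x. x \<in> S \<Longrightarrow> g x = f x"
proof -
  have f0: "f 0 = 0" using linear_on_0[OF f(2)] subspace_0[OF S(1)] .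
  have fS: "f x \<in> topspace \<sigma>" if "x \<in> S" for x
    using f(1) that S(2) by (auto simp: continuous_map_def)
  \<comment> \<open>Only points outside \<open>S\<close> need a limit. There the filter
    \<open>atin_within\<close>, which omits \<open>t\<close> itself, loses no point of
    \<open>S\<close>, and it is proper because \<open>t\<close> lies in the closure of
    \<open>S\<close>.\<close>
  have lim: "\<exists>l. limitin \<sigma> f l (atin_within \<rho> t S)" if t: "t \<in> topspace \<rho> - S" for t
  proof -
    let ?F = "atin_within \<rho> t S"
    have near: "eventually (\<lambda>x. x \<in> S \<and> x \<in> U) ?F" if "openin \<rho> U" "t \<in> U" for U
      unfolding eventually_atin_within using that t by blast
    have "cauchy_filter_in \<sigma> (filtermap f ?F)"
      unfolding cauchy_filter_in_def
    proof (intro conjI allI impI)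
      have "?F \<noteq> bot"
      proof
        assume "?F = bot"
        then have "eventually (\<lambda>x. False) ?F" by simp
        then obtain T where "openin \<rho> T" "t \<in> T" "\<forall>x\<in>T. x \<in> S \<and> x \<noteq> t \<longrightarrow> False"
          using t by (auto simp: eventually_atin_within)
        moreover have "t \<in> \<rho> closure_of S" using t S by simp
        ultimately show False using t unfolding in_closure_of by blast
      qed
      then show "filtermap f ?F \<noteq> bot" by (simp add: filtermap_bot_iff)
      show "eventually (\<lambda>x. x \<in> topspace \<sigma>) (filtermap f ?F)"
        unfolding eventually_filtermap
        by (rule eventually_mono[OF near[OF openin_topspace]]) (use t fS in auto)
      fix U assume U: "openin \<sigma> U \<and> 0 \<in> U"
      have "zero_nbhd (subtopology \<rho> S) {x \<in> topspace (subtopology \<rho> S). f x \<in> U}"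
        by (rule zero_nbhd_preimage[OF f(1)])
           (use f0 S lintop_zero[OF assms(1)] subspace_0[OF S(1)] U zero_nbhd_openin in auto)
      then obtain W where W: "openin \<rho> W" "0 \<in> W" "\<And>x. x \<in> W \<Longrightarrow> x \<in> S \<Longrightarrow> f x \<in> U"
        unfolding zero_nbhd_def openin_subtopology by auto
      \<comment> \<open>\<open>x - y\<close> is the difference of \<open>x - t\<close> and
        \<open>y - t\<close>, so \<open>V - V \<subseteq> W\<close> lets two points of
        \<open>S\<close> be compared through \<open>t\<close>, which is not in
        \<open>S\<close>.\<close>
      obtain V where V: "zero_nbhd \<rho> V" "V \<subseteq> topspace \<rho>" "\<And>x y. x \<in> V \<Longrightarrow> y \<in> V \<Longrightarrow> x - y \<in> W"
        by (rule zero_nbhd_half[OF assms(1) zero_nbhd_openin[OF W(1,2)]]) blast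
      obtain V' where V': "openin \<rho> V'" "0 \<in> V'" "V' \<subseteq> V" using V(1) by (auto simp: zero_nbhd_def)
      have o: "openin \<rho> {x \<in> topspace \<rho>. x - t \<in> V'}"
        using openin_lintop_preimage_diff[OF assms(1) V'(1)] t by blast
      let ?P = "\<lambda>z. z \<in> f ` {x \<in> S. x - t \<in> V'}"
      have "eventually ?P (filtermap f ?F)"
        unfolding eventually_filtermap
        by (rule eventually_mono[OF near[OF o]]) (use t V' in auto)
      moreover have "a - b \<in> U" if ab: "?P a" "?P b" for a b
      proof -
        obtain x y where xy: "a = f x" "b = f y" "x \<in> S" "y \<in> S" "x - t \<in> V'" "y - t \<in> V'"
          using ab by auto
        have "(x - t) - (y - t) \<in> W" by (rule V(3)) (use xy V' in auto)
        then have "f (x - y) \<in> U" using W(3)[of "x - y"] subspace_diff[OF S(1) xy(3,4)] by simp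
        then show ?thesis using linear_on_diff[OF f(2) S(1) xy(3,4)] xy by simp
      qed
      ultimately show "eventually (\<lambda>(x, y). x - y \<in> U) (filtermap f ?F \<times>\<^sub>F filtermap f ?F)"
        unfolding eventually_prod_same by blast
    qed
    then obtain l where "limitin \<sigma> (\<lambda>y. y) l (filtermap f ?F)"
      using assms(4) by (auto simp: complete_tvs_def)
    then show ?thesis by (auto simp: limitin_def eventually_filtermap)
  qed
  obtain g where g: "continuous_map (subtopology \<rho> (topspace \<rho>)) \<sigma> g" "\<And>x. x \<in> S \<Longrightarrow> g x = f x"
    by (rule continuous_map_extension_pointwise_alt[OF regular_space_lintop[OF assms(2)] S(2) _ f(1) lim])
       (use S in auto)
  then have g': "continuous_map \<rho> \<sigma> g" by simp
  have "linear_on smul S g"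
    using f(2) g(2) subspace_add[OF S(1)] subspace_scale[OF S(1)] by (simp add: linear_on_def)
  then have "linear_on smul (topspace \<rho>) g"
    by (rule linear_on_dense[OF assms(1-3) g' S(2,3) _ S(1)])
  then show thesis using that g' g(2) by blast
qed

section \<open>Local convexity and barrels\<close>

lemma convex_setD:
  "convex_set smul S \<Longrightarrow> x \<in> S \<Longrightarrow> y \<in> S \<Longrightarrow> 0 \<le> u \<Longrightarrow> 0 \<le> v \<Longrightarrow> u + v = 1 \<Longrightarrow>
      smul (of_real u) x + smul (of_real v) y \<in> S"
  by (auto simp: convex_set_def)

text \<open>The points are moved one at a time. With one point in \<open>S\<close> the combination
  maps \<open>S\<close> into \<open>S\<close>, hence closure into closure; with one point in the
  closure it maps \<open>S\<close> into the closure, which is closed.\<close>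

lemma convex_set_closure_of:
  assumes "lintop \<tau>" "convex_set smul S" "S \<subseteq> topspace \<tau>"
  shows "convex_set smul (\<tau> closure_of S)"
  unfolding convex_set_def
proof (intro ballI allI impI)
  fix x y and u v :: real
  assume x: "x \<in> \<tau> closure_of S" and y: "y \<in> \<tau> closure_of S" and uv: "0 \<le> u \<and> 0 \<le> v \<and> u + v = 1"
  let ?f = "\<lambda>x y. smul (of_real u) x + smul (of_real v) y"
  have cont: "continuous_map \<tau> \<tau> (\<lambda>x. ?f x b)" "continuous_map \<tau> \<tau> (\<lambda>x. ?f b x)"
    if "b \<in> topspace \<tau>" for b
    using that subspace_scale[OF lintop_subspace[OF assms(1)]]
    by (intro continuous_map_lintop_add continuous_map_scale assms; auto)+
  have 1: "?f x b \<in> \<tau> closure_of S" if b: "b \<in> S" for b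
  proof -
    have "(\<lambda>x. ?f x b) ` S \<subseteq> S" using convex_setD[OF assms(2)] b uv by auto
    then have "(\<lambda>x. ?f x b) ` (\<tau> closure_of S) \<subseteq> \<tau> closure_of S"
      by (intro subset_trans[OF continuous_map_image_closure_subset[OF cont(1)] closure_of_mono])
         (use b assms(3) in auto)
    then show ?thesis using x by auto
  qed
  have xt: "x \<in> topspace \<tau>" using x by (simp add: in_closure_of)
  have "(\<lambda>y. ?f x y) ` S \<subseteq> \<tau> closure_of S" using 1 by auto
  then have "(\<lambda>y. ?f x y) ` (\<tau> closure_of S) \<subseteq> \<tau> closure_of S"
    by (intro subset_trans[OF continuous_map_image_closure_subset[OF cont(2)[OF xt]]] closure_of_minimal) auto
  then show "?f x y \<in> \<tau> closure_of S" using y by auto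
qed

lemma absconvex_closure_of:
  assumes "lintop \<tau>" "absconvex S" "S \<subseteq> topspace \<tau>"
  shows "absconvex (\<tau> closure_of S)"
  unfolding absconvex_def
proof (intro conjI allI ballI impI)
  show "convex_set smul (\<tau> closure_of S)"
    using assms convex_set_closure_of by (auto simp: absconvex_def)
  fix c :: 'k and x assume x: "x \<in> \<tau> closure_of S" and c: "norm c \<le> 1"
  have "smul c ` S \<subseteq> S" using assms(2) c by (auto simp: absconvex_def)
  then have "smul c ` (\<tau> closure_of S) \<subseteq> \<tau> closure_of S"
    by (intro subset_trans[OF continuous_map_image_closure_subset[OF continuous_map_scale[OF assms(1)]]]
        closure_of_mono)
  then show "smul c x \<in> \<tau> closure_of S" using x by auto
qed

lemma locally_convex_zero_nbhd:
  "locally_convex_space smul \<tau> \<longleftrightarrow> lintop \<tau> \<and>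
     (\<forall>U. zero_nbhd \<tau> U \<longrightarrow> (\<exists>C. zero_nbhd \<tau> C \<and> C \<subseteq> U \<and> convex_set smul C))"
  unfolding locally_convex_space_def zero_nbhd_def by (meson subset_trans order_refl)

text \<open>The closed neighbourhood \<open>U'\<close> is taken before the convex \<open>C\<close>
  and its balanced core \<open>B\<close>, so that the final closure, which restores closedness,
  still stays inside \<open>U\<close>. The core remains convex because scalars commute with convex
  combinations.\<close>

lemma locally_convex_absconvex_base:
  assumes "locally_convex_space smul \<tau>" "zero_nbhd \<tau> U"
  obtains C where "zero_nbhd \<tau> C" "closedin \<tau> C" "C \<subseteq> U" "absconvex C"
proof -
  have lt: "lintop \<tau>" using assms by (simp add: locally_convex_zero_nbhd)
  obtain U' where U': "zero_nbhd \<tau> U'" "closedin \<tau> U'" "U' \<subseteq> U"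
    by (rule zero_nbhd_closed[OF lt assms(2)]) blast
  obtain C where C: "zero_nbhd \<tau> C" "C \<subseteq> U'" "convex_set smul C"
    using assms(1) U' by (auto simp: locally_convex_zero_nbhd)
  define B where "B = {x \<in> topspace \<tau>. \<forall>c. norm c \<le> 1 \<longrightarrow> smul c x \<in> C}"
  have Bn: "zero_nbhd \<tau> B" unfolding B_def by (rule zero_nbhd_balanced_core[OF lt C(1)])
  have BC: "B \<subseteq> C"
  proof
    fix x assume "x \<in> B"
    then have "smul 1 x \<in> C" unfolding B_def by (auto simp del: scale_one)
    then show "x \<in> C" by simp
  qed
  have "absconvex B"
    unfolding absconvex_def convex_set_def
  proof (intro conjI ballI allI impI)
    fix x y and u v :: real
    assume xy: "x \<in> B" "y \<in> B" and uv: "0 \<le> u \<and> 0 \<le> v \<and> u + v = 1"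
    have "smul c (smul (of_real u) x + smul (of_real v) y) \<in> C" if c: "norm c \<le> 1" for c
    proof -
      have "smul (of_real u) (smul c x) + smul (of_real v) (smul c y) \<in> C"
        by (rule convex_setD[OF C(3)]) (use xy uv c in \<open>auto simp: B_def\<close>)
      then show ?thesis by (simp add: scale_right_distrib mult.commute)
    qed
    then show "smul (of_real u) x + smul (of_real v) y \<in> B"
      using xy lintop_subspace[OF lt] by (simp add: B_def subspace_add subspace_scale)
  next
    fix c :: 'k and x assume "x \<in> B" "norm c \<le> 1"
    then show "smul c x \<in> B"
      using lintop_subspace[OF lt] by (auto simp: B_def subspace_scale norm_mult mult_le_one)
  qed
  moreover have Bt: "B \<subseteq> topspace \<tau>" by (auto simp: B_def)
  ultimately have "absconvex (\<tau> closure_of B)" by (rule absconvex_closure_of[OF lt])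
  moreover have "\<tau> closure_of B \<subseteq> U"
    using closure_of_minimal[OF subset_trans[OF BC C(2)] U'(2)] U'(3) by blast
  moreover have "zero_nbhd \<tau> (\<tau> closure_of B)"
    by (rule zero_nbhd_mono[OF Bn closure_of_subset[OF Bt]])
  ultimately show thesis using that[of "\<tau> closure_of B"] by simp
qed

text \<open>An open set \<open>W\<close> is contained in the closure of \<open>W \<inter> S\<close>
  when \<open>S\<close> is dense. This is why local convexity and barrelledness pass from a dense
  subspace to the whole space.\<close>

lemma zero_nbhd_closure_dense:
  assumes "\<rho> closure_of S = topspace \<rho>" "zero_nbhd (subtopology \<rho> S) U" "0 \<in> topspace \<rho>"
  shows "zero_nbhd \<rho> (\<rho> closure_of U)"
proof -
  obtain W where W: "openin \<rho> W" "0 \<in> W" "W \<inter> S \<subseteq> U"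
    using assms(2) by (auto simp: zero_nbhd_def openin_subtopology)
  have "W \<subseteq> \<rho> closure_of (W \<inter> S)"
    using openin_Int_closure_of_subset[OF W(1), of S] openin_subset[OF W(1)] assms(1) by (simp add: Int_absorb2)
  then have "W \<subseteq> \<rho> closure_of U" using closure_of_mono[OF W(3)] by blast
  then show ?thesis using W by (auto simp: zero_nbhd_def)
qed

lemma locally_convex_completion:
  assumes "lintop \<rho>" "subspace S" "S \<subseteq> topspace \<rho>" "\<rho> closure_of S = topspace \<rho>"
    "locally_convex_space smul (subtopology \<rho> S)"
  shows "locally_convex_space smul \<rho>"
  unfolding locally_convex_zero_nbhd
proof (intro conjI allI impI)
  fix U assume "zero_nbhd \<rho> U"
  then obtain V where V: "zero_nbhd \<rho> V" "closedin \<rho> V" "V \<subseteq> U"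
    by (rule zero_nbhd_closed[OF assms(1)])
  have "zero_nbhd (subtopology \<rho> S) (V \<inter> S)"
    by (rule zero_nbhd_subtopology[OF V(1) subspace_0[OF assms(2)]])
  then obtain C where C: "zero_nbhd (subtopology \<rho> S) C" "C \<subseteq> V \<inter> S" "convex_set smul C"
    using assms(5) unfolding locally_convex_zero_nbhd by blast
  have "zero_nbhd \<rho> (\<rho> closure_of C)"
    by (rule zero_nbhd_closure_dense[OF assms(4) C(1) lintop_zero[OF assms(1)]])
  moreover have "\<rho> closure_of C \<subseteq> U" using closure_of_minimal[OF _ V(2), of C] C(2) V(3) by blast
  moreover have "convex_set smul (\<rho> closure_of C)"
    by (rule convex_set_closure_of[OF assms(1) C(3)]) (use C(2) assms(3) in blast)
  ultimately show "\<exists>C. zero_nbhd \<rho> C \<and> C \<subseteq> U \<and> convex_set smul C" by blast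
qed (rule assms(1))

text \<open>The trace of a barrel on \<open>S\<close> is a barrel of \<open>S\<close>, hence a
  neighbourhood of zero there; its closure is one in the whole space and stays inside the closed set
  \<open>B\<close>.\<close>

lemma barrelled_completion:
  assumes "lintop \<rho>" "subspace S" "S \<subseteq> topspace \<rho>" "\<rho> closure_of S = topspace \<rho>"
    "barrelled_space smul (subtopology \<rho> S)"
  shows "barrelled_space smul \<rho>"
  unfolding barrelled_space_def
proof (intro conjI allI impI)
  show "locally_convex_space smul \<rho>"
    by (rule locally_convex_completion[OF assms(1-4)]) (use assms(5) in \<open>simp add: barrelled_space_def\<close>)
  fix B assume B: "barrel smul \<rho> B"
  have ts: "topspace (subtopology \<rho> S) = S" using assms(3) by auto
  have "absconvex (B \<inter> S)"
    using B assms(2)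
    by (auto simp: barrel_absconvex absconvex_def convex_set_def subspace_add subspace_scale)
  moreover have "\<exists>r>0. \<forall>c. norm c \<le> r \<longrightarrow> smul c x \<in> B \<inter> S" if "x \<in> S" for x
  proof -
    have "x \<in> topspace \<rho>" using that assms(3) by auto
    then obtain r where "r > 0" "\<forall>c. norm c \<le> r \<longrightarrow> smul c x \<in> B"
      using B unfolding barrel_def by meson
    then show ?thesis using subspace_scale[OF assms(2) that] by (intro exI[of _ r]) simp
  qed
  moreover have "closedin (subtopology \<rho> S) (B \<inter> S)"
    using B by (auto simp: closedin_subtopology barrel_def)
  ultimately have "barrel smul (subtopology \<rho> S) (B \<inter> S)"
    unfolding barrel_absconvex ts by blast
  then have "zero_nbhd (subtopology \<rho> S) (B \<inter> S)"
    using assms(5) unfolding barrelled_space_def zero_nbhd_def by blast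
  then have "zero_nbhd \<rho> (\<rho> closure_of (B \<inter> S))"
    by (rule zero_nbhd_closure_dense[OF assms(4) _ lintop_zero[OF assms(1)]])
  moreover have "\<rho> closure_of (B \<inter> S) \<subseteq> B"
    by (rule closure_of_minimal) (use B in \<open>auto simp: barrel_def\<close>)
  ultimately show "\<exists>V. openin \<rho> V \<and> 0 \<in> V \<and> V \<subseteq> B"
    using zero_nbhd_mono unfolding zero_nbhd_def by (meson subset_trans)
qed

text \<open>The uniform boundedness principle: the common preimage of a closed absolutely convex
  neighbourhood \<open>C\<close> is a barrel. Continuity makes it closed, and the pointwise bound,
  stated as a common absorption radius, makes it absorbing.\<close>

lemma barrelled_equicontinuous:
  assumes bar: "barrelled_space smul \<tau>" and lc: "locally_convex_space smul \<sigma>"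
    and lin: "\<And>i. i \<in> I \<Longrightarrow> linear_on smul (topspace \<tau>) (S i)"
    and cont: "\<And>i. i \<in> I \<Longrightarrow> continuous_map \<tau> \<sigma> (S i)"
    and bdd: "\<And>x U. x \<in> topspace \<tau> \<Longrightarrow> zero_nbhd \<sigma> U \<Longrightarrow>
      \<exists>r>0. \<forall>i\<in>I. \<forall>c. norm c \<le> r \<longrightarrow> smul c (S i x) \<in> U"
    and U: "zero_nbhd \<sigma> U"
  shows "\<exists>V. zero_nbhd \<tau> V \<and> V \<subseteq> topspace \<tau> \<and> (\<forall>i\<in>I. \<forall>x\<in>V. S i x \<in> U)"
proof -
  have "lintop \<tau>" using bar by (simp add: barrelled_space_def locally_convex_space_def)
  note sub = lintop_subspace[OF this]
  obtain C where C: "zero_nbhd \<sigma> C" "closedin \<sigma> C" "C \<subseteq> U" "absconvex C"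
    by (rule locally_convex_absconvex_base[OF lc U])
  define B where "B = {x \<in> topspace \<tau>. \<forall>i\<in>I. S i x \<in> C}"
  have "closedin \<tau> B"
  \<comment> \<open>For empty \<open>I\<close> the intersection of the preimages would be the whole
    type, while \<open>B\<close> is the carrier.\<close>
  proof (cases "I = {}")
    case False
    have "B = (\<Inter>i\<in>I. {x \<in> topspace \<tau>. S i x \<in> C})" using False by (auto simp: B_def)
    also have "closedin \<tau> \<dots>"
      using False closedin_continuous_map_preimage[OF cont C(2)] by (intro closedin_Inter) auto
    finally show ?thesis .
  qed (simp add: B_def)
  moreover have "absconvex B"
    unfolding absconvex_def convex_set_def
  proof (intro conjI ballI allI impI)
    fix x y and u v :: real
    assume xy: "x \<in> B" "y \<in> B" and uv: "0 \<le> u \<and> 0 \<le> v \<and> u + v = 1"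
    let ?z = "smul (of_real u) x + smul (of_real v) y"
    have "S i ?z \<in> C" if i: "i \<in> I" for i
    proof -
      have "S i ?z = smul (of_real u) (S i x) + smul (of_real v) (S i y)"
        using lin[OF i] xy sub by (simp add: linear_on_def B_def subspace_scale)
      then show ?thesis using absconvexD(1)[OF C(4)] xy uv i by (simp add: B_def)
    qed
    then show "?z \<in> B" using xy sub by (simp add: B_def subspace_add subspace_scale)
  next
    fix c :: 'k and x assume "x \<in> B" "norm c \<le> 1"
    then show "smul c x \<in> B"
      using lin absconvexD(2)[OF C(4)] sub by (simp add: B_def subspace_scale linear_on_def)
  qed
  moreover have "\<exists>r>0. \<forall>c. norm c \<le> r \<longrightarrow> smul c x \<in> B" if x: "x \<in> topspace \<tau>" for x
  proof -
    obtain r where "r > 0" "\<forall>i\<in>I. \<forall>c. norm c \<le> r \<longrightarrow> smul c (S i x) \<in> C"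
      using bdd[OF x C(1)] by blast
    then show ?thesis using lin x sub by (intro exI[of _ r]) (simp add: B_def subspace_scale linear_on_def)
  qed
  ultimately have "barrel smul \<tau> B" by (simp add: barrel_absconvex)
  then have "zero_nbhd \<tau> B" using bar by (simp add: barrelled_space_def zero_nbhd_def)
  then show ?thesis using C(3) by (intro exI[of _ B]) (auto simp: B_def)
qed

text \<open>A Banach-Steinhaus argument: only pointwise convergence on a barrelled dense subspace is
  assumed, the barrels make the operators equicontinuous.\<close>

lemma limitin_dense_barrelled:
  assumes lt: "lintop \<rho>" and lc: "locally_convex_space smul \<sigma>"
    and S: "subspace S" "S \<subseteq> topspace \<rho>" "\<rho> closure_of S = topspace \<rho>"
    and bar: "barrelled_space smul (subtopology \<rho> S)"
    and lin: "\<And>i. i \<in> I \<Longrightarrow> linear_on smul (topspace \<rho>) (T i)"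
    and cont: "\<And>i. i \<in> I \<Longrightarrow> continuous_map \<rho> \<sigma> (T i)"
    and lin0: "linear_on smul (topspace \<rho>) T0" and cont0: "continuous_map \<rho> \<sigma> T0"
    and bdd: "\<And>x U. x \<in> S \<Longrightarrow> zero_nbhd \<sigma> U \<Longrightarrow>
      \<exists>r>0. \<forall>i\<in>I. \<forall>c. norm c \<le> r \<longrightarrow> smul c (T i x) \<in> U"
    and ev: "eventually (\<lambda>i. i \<in> I) F"
    and lim: "\<And>x. x \<in> S \<Longrightarrow> limitin \<sigma> (\<lambda>i. T i x) (T0 x) F"
    and x: "x \<in> topspace \<rho>"
  shows "limitin \<sigma> (\<lambda>i. T i x) (T0 x) F"
proof -
  have lts: "lintop \<sigma>" using lc by (simp add: locally_convex_space_def)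
  have ts: "topspace (subtopology \<rho> S) = S" using S by auto
  note sub = lintop_subspace[OF lt]
  have T0x: "T0 x \<in> topspace \<sigma>" using cont0 x by (auto simp: continuous_map_def)
  show ?thesis
    unfolding limitin_lintop_iff[OF lts]
  proof (intro conjI allI impI)
    fix U assume U: "zero_nbhd \<sigma> U"
    \<comment> \<open>\<open>T i x - T0 x\<close> will be split at a nearby \<open>a\<close> in
      \<open>S\<close> into \<open>((T i a - T0 a) - T i (a - x)) + T0 (a - x)\<close>: the inner
      difference goes from \<open>U2\<close> to \<open>U1\<close>, the sum from \<open>U1\<close> to
      \<open>U\<close>.\<close>
    obtain U1 where U1: "zero_nbhd \<sigma> U1" "\<And>x y. x \<in> U1 \<Longrightarrow> y \<in> U1 \<Longrightarrow> x + y \<in> U"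
      by (rule zero_nbhd_half[OF lts U]) blast
    obtain U2 where U2: "zero_nbhd \<sigma> U2" "\<And>x y. x \<in> U2 \<Longrightarrow> y \<in> U2 \<Longrightarrow> x - y \<in> U1"
      by (rule zero_nbhd_half[OF lts U1(1)]) blast
    have U21: "x \<in> U1" if "x \<in> U2" for x
      using U2(2)[OF that zero_nbhd_zero[OF U2(1)]] by simp
    \<comment> \<open>Equicontinuity is available only on a neighbourhood \<open>V\<close> in
      \<open>S\<close>, while \<open>a - x\<close> need not lie in \<open>S\<close>. A closed
      \<open>U3\<close> carries the bound from \<open>V\<close> to its closure in \<rho>.\<close>
    obtain U3 where U3: "zero_nbhd \<sigma> U3" "closedin \<sigma> U3" "U3 \<subseteq> U2"
      by (rule zero_nbhd_closed[OF lts U2(1)])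
    have "\<exists>V. zero_nbhd (subtopology \<rho> S) V \<and> V \<subseteq> topspace (subtopology \<rho> S) \<and> (\<forall>i\<in>I. \<forall>x\<in>V. T i x \<in> U3)"
    proof (rule barrelled_equicontinuous[OF bar lc])
      show "linear_on smul (topspace (subtopology \<rho> S)) (T i)" if "i \<in> I" for i
        using lin[OF that] S(2) by (auto simp: linear_on_def)
      show "continuous_map (subtopology \<rho> S) \<sigma> (T i)" if "i \<in> I" for i
        using cont[OF that] by (rule continuous_map_from_subtopology)
    qed (use bdd ts U3 in auto)
    then obtain V where V: "zero_nbhd (subtopology \<rho> S) V" "V \<subseteq> S" "\<forall>i\<in>I. \<forall>x\<in>V. T i x \<in> U3"
      unfolding ts by blast
    have W: "T i y \<in> U2" if "i \<in> I" "y \<in> \<rho> closure_of V" for i y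
    proof -
      have "T i ` (\<rho> closure_of V) \<subseteq> \<sigma> closure_of (T i ` V)"
        by (rule continuous_map_image_closure_subset[OF cont[OF that(1)]])
      also have "\<dots> \<subseteq> U3" by (rule closure_of_minimal[OF _ U3(2)]) (use V(3) that in auto)
      finally show ?thesis using U3(3) that by blast
    qed
    have "zero_nbhd \<rho> (\<rho> closure_of V)"
      by (rule zero_nbhd_closure_dense[OF S(3) V(1) lintop_zero[OF lt]])
    moreover have "zero_nbhd \<rho> {x \<in> topspace \<rho>. T0 x \<in> U2}"
      by (rule zero_nbhd_preimage[OF cont0 linear_on_0[OF lin0] _ U2(1)]) (rule lintop_zero[OF lt])+
    ultimately have "zero_nbhd \<rho> (\<rho> closure_of V \<inter> {x \<in> topspace \<rho>. T0 x \<in> U2})"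
      by (rule zero_nbhd_Int)
    then obtain W' where W': "openin \<rho> W'" "0 \<in> W'" "W' \<subseteq> \<rho> closure_of V \<inter> {x \<in> topspace \<rho>. T0 x \<in> U2}"
      unfolding zero_nbhd_def by blast
    have "openin \<rho> {y \<in> topspace \<rho>. y - x \<in> W'}" by (rule openin_lintop_preimage_diff[OF lt W'(1) x])
    moreover have "x \<in> {y \<in> topspace \<rho>. y - x \<in> W'}" using x W'(2) by simp
    moreover have "x \<in> \<rho> closure_of S" using x S by simp
    ultimately have "\<exists>a. a \<in> S \<and> a \<in> {y \<in> topspace \<rho>. y - x \<in> W'}"
      unfolding in_closure_of by metis
    then obtain a where a: "a \<in> S" "a - x \<in> W'" by blast
    have aX: "a \<in> topspace \<rho>" using a S by auto
    have "eventually (\<lambda>i. T i a \<in> topspace \<sigma> \<and> T i a - T0 a \<in> U2) F"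
      using lim[OF a(1)] U2(1) unfolding limitin_lintop_iff[OF lts] by blast
    with ev show "eventually (\<lambda>i. T i x \<in> topspace \<sigma> \<and> T i x - T0 x \<in> U) F"
    proof eventually_elim
      case (elim i)
      have "T i x \<in> topspace \<sigma>" using cont[OF elim(1)] x by (auto simp: continuous_map_def)
      moreover have "T i (a - x) = T i a - T i x" "T0 (a - x) = T0 a - T0 x"
        using linear_on_diff[OF _ sub aX x] lin[OF elim(1)] lin0 by blast+
      then have "T i x - T0 x = ((T i a - T0 a) - T i (a - x)) + T0 (a - x)" by simp
      moreover have "\<dots> \<in> U"
      proof (rule U1(2)[OF U2(2) U21])
        show "T i (a - x) \<in> U2" using W[OF elim(1)] a W'(3) by blast
        show "T0 (a - x) \<in> U2" using a W'(3) by blast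
      qed (use elim in auto)
      ultimately show ?case by simp
    qed
  qed (rule T0x)
qed

section \<open>Generators\<close>

lemma generator_limit_unique:
  "Hausdorff_space \<tau> \<Longrightarrow> generator_limit smul \<tau> T x y \<Longrightarrow> generator_limit smul \<tau> T x z \<Longrightarrow> y = z"
  unfolding generator_limit_def by (rule limitin_Hausdorff_unique) auto

lemma generator_eq:
  "Hausdorff_space \<tau> \<Longrightarrow> generator_limit smul \<tau> T x y \<Longrightarrow> generator smul \<tau> T x = y"
  unfolding generator_def by (rule the_equality) (auto intro: generator_limit_unique)

lemma generator_limit_generator:
  "Hausdorff_space \<tau> \<Longrightarrow> x \<in> generator_domain smul \<tau> T \<Longrightarrow>
     generator_limit smul \<tau> T x (generator smul \<tau> T x)"
  using generator_eq by (fastforce simp: generator_domain_def)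

lemma generator_domain_subset: "generator_domain smul \<tau> T \<subseteq> topspace \<tau>"
  by (auto simp: generator_domain_def)

lemma generator_domainI:
  "x \<in> topspace \<tau> \<Longrightarrow> generator_limit smul \<tau> T x y \<Longrightarrow> x \<in> generator_domain smul \<tau> T"
  by (auto simp: generator_domain_def)

lemma limitin_at_right_0_cong:
  assumes "limitin \<tau> f l (at_right (0::real))" "\<And>t. t > 0 \<Longrightarrow> f t = g t"
  shows "limitin \<tau> g l (at_right 0)"
  by (rule limitin_transform_eventually[OF _ assms(1)])
     (use assms(2) in \<open>auto simp: eventually_at_filter\<close>)

lemma semigroup_mapsto:
  "strongly_continuous_semigroup smul \<tau> T \<Longrightarrow> t \<ge> 0 \<Longrightarrow> x \<in> topspace \<tau> \<Longrightarrow> T t x \<in> topspace \<tau>"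
  by (auto simp: strongly_continuous_semigroup_def continuous_linear_operator_def continuous_map_def)

lemma semigroup_linear:
  "strongly_continuous_semigroup smul \<tau> T \<Longrightarrow> t \<ge> 0 \<Longrightarrow> linear_on smul (topspace \<tau>) (T t)"
  by (auto simp: strongly_continuous_semigroup_def continuous_linear_operator_def)

lemma semigroup_continuous:
  "strongly_continuous_semigroup smul \<tau> T \<Longrightarrow> t \<ge> 0 \<Longrightarrow> continuous_map \<tau> \<tau> (T t)"
  by (auto simp: strongly_continuous_semigroup_def continuous_linear_operator_def)

lemma semigroup_commute:
  "strongly_continuous_semigroup smul \<tau> T \<Longrightarrow> t \<ge> 0 \<Longrightarrow> s \<ge> 0 \<Longrightarrow> x \<in> topspace \<tau> \<Longrightarrow>
     T t (T s x) = T s (T t x)"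
  unfolding strongly_continuous_semigroup_def by (metis add.commute)

text \<open>A continuous linear map that intertwines two semigroups along one orbit carries
  difference quotients to difference quotients. It is applied to scalar multiples, to
  \<open>T t\<close> itself, to the inclusion of a step in the limit, and to the isomorphism
  \<open>K\<close> and its inverse \<open>J\<close>.\<close>

lemma generator_limit_linear_image:
  assumes "lintop \<tau>" "lintop \<sigma>" "continuous_map \<tau> \<sigma> K" "linear_on smul (topspace \<tau>) K"
    and "generator_limit smul \<tau> T x y" "x \<in> topspace \<tau>"
    and "\<And>t. t > 0 \<Longrightarrow> T t x \<in> topspace \<tau>"
    and "\<And>t. t > 0 \<Longrightarrow> T' t (K x) = K (T t x)"
  shows "generator_limit smul \<sigma> T' (K x) (K y)"
proof -
  note sub = lintop_subspace[OF assms(1)]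
  have "limitin \<sigma> (K \<circ> (\<lambda>t. smul (of_real (1 / t)) (T t x - x))) (K y) (at_right 0)"
    using assms(5) unfolding generator_limit_def by (rule continuous_map_limit[OF assms(3)])
  moreover have "(K \<circ> (\<lambda>t. smul (of_real (1 / t)) (T t x - x))) t =
      smul (of_real (1 / t)) (T' t (K x) - K x)" if "t > 0" for t
  proof -
    have "K (T t x - x) = T' t (K x) - K x"
      using linear_on_diff[OF assms(4) sub assms(7)[OF that] assms(6)] assms(8)[OF that] by simp
    then show ?thesis
      using assms(4) subspace_diff[OF sub assms(7)[OF that] assms(6)] by (simp add: linear_on_def)
  qed
  ultimately show ?thesis unfolding generator_limit_def by (rule limitin_at_right_0_cong)
qed

lemma generator_limit_add:
  assumes "lintop \<tau>" "strongly_continuous_semigroup smul \<tau> T" "x \<in> topspace \<tau>" "x' \<in> topspace \<tau>"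
    "generator_limit smul \<tau> T x y" "generator_limit smul \<tau> T x' y'"
  shows "generator_limit smul \<tau> T (x + x') (y + y')"
proof -
  have "limitin \<tau> (\<lambda>t. smul (of_real (1 / t)) (T t x - x) + smul (of_real (1 / t)) (T t x' - x'))
      (y + y') (at_right 0)"
    using assms(5,6) unfolding generator_limit_def by (rule limitin_lintop_add[OF assms(1)])
  moreover have "smul (of_real (1 / t)) (T t x - x) + smul (of_real (1 / t)) (T t x' - x') =
      smul (of_real (1 / t)) (T t (x + x') - (x + x'))" if "t > 0" for t
    using semigroup_linear[OF assms(2), of t] that assms(3,4)
    by (simp add: linear_on_def add_diff_add flip: scale_right_distrib)
  ultimately show ?thesis unfolding generator_limit_def by (rule limitin_at_right_0_cong)
qed

lemma generator_limit_scale: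
  assumes "lintop \<tau>" "strongly_continuous_semigroup smul \<tau> T" "x \<in> topspace \<tau>"
    "generator_limit smul \<tau> T x y"
  shows "generator_limit smul \<tau> T (smul c x) (smul c y)"
  by (rule generator_limit_linear_image[OF assms(1,1) continuous_map_scale[OF assms(1)] _ assms(4,3)])
     (use semigroup_mapsto[OF assms(2)] semigroup_linear[OF assms(2)] assms(3) in
       \<open>auto simp: linear_on_def scale_right_distrib mult.commute\<close>)

lemma generator_domain_linear:
  assumes "lintop \<tau>" "Hausdorff_space \<tau>" "strongly_continuous_semigroup smul \<tau> T"
  shows "subspace (generator_domain smul \<tau> T)"
    and "linear_on smul (generator_domain smul \<tau> T) (generator smul \<tau> T)"
proof -
  let ?D = "generator_domain smul \<tau> T" and ?A = "generator smul \<tau> T"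
  note sub = lintop_subspace[OF assms(1)]
  have D: "x \<in> topspace \<tau>" "generator_limit smul \<tau> T x (?A x)" if "x \<in> ?D" for x
    using that generator_domain_subset generator_limit_generator[OF assms(2)] by blast+
  have add: "generator_limit smul \<tau> T (x + y) (?A x + ?A y)" if "x \<in> ?D" "y \<in> ?D" for x y
    by (rule generator_limit_add[OF assms(1,3)]) (use D that in auto)
  have scale: "generator_limit smul \<tau> T (smul c x) (smul c (?A x))" if "x \<in> ?D" for c x
    by (rule generator_limit_scale[OF assms(1,3)]) (use D that in auto)
  have zero: "generator_limit smul \<tau> T 0 0"
    unfolding generator_limit_def
    by (rule limitin_at_right_0_cong[of _ "\<lambda>t. 0"])
       (use linear_on_0[OF semigroup_linear[OF assms(3)]] lintop_zero[OF assms(1)] in auto)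
  show "subspace ?D"
  proof (rule subspaceI)
    show "0 \<in> ?D" using zero lintop_zero[OF assms(1)] by (rule generator_domainI[rotated])
    show "x + y \<in> ?D" if "x \<in> ?D" "y \<in> ?D" for x y
      by (rule generator_domainI[OF _ add[OF that]]) (use D that sub in \<open>auto simp: subspace_add\<close>)
    show "smul c x \<in> ?D" if "x \<in> ?D" for c x
      by (rule generator_domainI[OF _ scale[OF that]]) (use D that sub in \<open>auto simp: subspace_scale\<close>)
  qed
  show "linear_on smul ?D ?A"
    unfolding linear_on_def
    using generator_eq[OF assms(2) add] generator_eq[OF assms(2) scale] by blast
qed

lemma generator_commute:
  assumes "lintop \<tau>" "Hausdorff_space \<tau>" "strongly_continuous_semigroup smul \<tau> T"
    "t \<ge> 0" "x \<in> generator_domain smul \<tau> T"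
  shows "T t x \<in> generator_domain smul \<tau> T"
    and "generator smul \<tau> T (T t x) = T t (generator smul \<tau> T x)"
proof -
  have x: "x \<in> topspace \<tau>" using assms(5) generator_domain_subset by blast
  have *: "generator_limit smul \<tau> T (T t x) (T t (generator smul \<tau> T x))"
    by (rule generator_limit_linear_image[OF assms(1,1) _ _ generator_limit_generator[OF assms(2,5)] x])
       (use assms x semigroup_mapsto semigroup_continuous semigroup_linear semigroup_commute in \<open>auto intro: less_imp_le\<close>)
  show "T t x \<in> generator_domain smul \<tau> T"
    by (rule generator_domainI[OF semigroup_mapsto[OF assms(3,4) x] *])
  show "generator smul \<tau> T (T t x) = T t (generator smul \<tau> T x)"
    by (rule generator_eq[OF assms(2) *])
qed

text \<open>With a continuous inverse \<open>R\<close> of the generator, \<open>x\<close> is the limit of the difference quotients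
  of the orbit of \<open>R x\<close>; no integral is needed.\<close>

lemma generator_domain_dense:
  assumes "lintop \<tau>" "Hausdorff_space \<tau>" "strongly_continuous_semigroup smul \<tau> T"
    and surj: "topspace \<tau> \<subseteq> generator smul \<tau> T ` generator_domain smul \<tau> T"
  shows "\<tau> closure_of generator_domain smul \<tau> T = topspace \<tau>"
proof
  let ?D = "generator_domain smul \<tau> T"
  have subD: "subspace ?D" by (rule generator_domain_linear[OF assms(1-3)])
  show "topspace \<tau> \<subseteq> \<tau> closure_of ?D"
  proof
    fix x assume "x \<in> topspace \<tau>"
    then obtain y where y: "y \<in> ?D" "x = generator smul \<tau> T y" using surj by auto
    have "limitin \<tau> (\<lambda>t. smul (of_real (1 / t)) (T t y - y)) x (at_right 0)"
      using generator_limit_generator[OF assms(2) y(1)] y(2) by (simp add: generator_limit_def)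
    moreover have "smul (of_real (1 / t)) (T t y - y) \<in> \<tau> closure_of ?D" if "t > 0" for t
      using generator_commute(1)[OF assms(1-3) _ y(1), of t] y(1) that
      by (intro subsetD[OF closure_of_subset[OF generator_domain_subset]] subspace_scale[OF subD]
          subspace_diff[OF subD]) auto
    then have "eventually (\<lambda>t. smul (of_real (1 / t)) (T t y - y) \<in> \<tau> closure_of ?D) (at_right 0)"
      by (auto simp: eventually_at_filter)
    ultimately show "x \<in> \<tau> closure_of ?D" by (rule limitin_closedin[OF _ closedin_closure_of]) auto
  qed
qed (rule closure_of_subset_topspace)

lemma linear_on_the_inv_into:
  assumes "subspace D" "linear_on smul D A" "bij_betw A D V"
  shows "linear_on smul V (the_inv_into D A)"
proof -
  let ?R = "the_inv_into D A"
  have R: "?R y \<in> D" "A (?R y) = y" if "y \<in> V" for y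
    using assms(3) that by (auto simp: bij_betw_def the_inv_into_into f_the_inv_into_f)
  have RA: "?R (A x) = x" if "x \<in> D" for x
    using assms(3) that by (simp add: bij_betw_def the_inv_into_f_f)
  have "?R (x + y) = ?R x + ?R y" if "x \<in> V" "y \<in> V" for x y
    using RA[of "?R x + ?R y"] R[OF that(1)] R[OF that(2)] assms(1,2)
    by (simp add: linear_on_def subspace_add)
  moreover have "?R (smul c x) = smul c (?R x)" if "x \<in> V" for c x
    using RA[of "smul c (?R x)"] R[OF that] assms(1,2) by (simp add: linear_on_def subspace_scale)
  ultimately show ?thesis by (simp add: linear_on_def)
qed

text \<open>The closure \<open>K\<close> of the generator is an isomorphism onto the larger space and conjugates \<open>T\<close> into
  \<open>T'\<close>, so that all properties of \<open>T'\<close> are transported from \<open>T\<close>.\<close>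

lemma extrapolated_semigroup:
  assumes lt: "lintop \<tau>" and lt': "lintop \<tau>'"
    and H: "Hausdorff_space \<tau>" and H': "Hausdorff_space \<tau>'"
    and C: "complete_tvs \<tau>" and C': "complete_tvs \<tau>'"
    and T: "strongly_continuous_semigroup smul \<tau> T"
    and D: "D = generator_domain smul \<tau> T" and A: "A = generator smul \<tau> T"
    and bij: "bij_betw A D (topspace \<tau>)"
    and X: "topspace \<tau> \<subseteq> topspace \<tau>'" "\<tau>' closure_of topspace \<tau> = topspace \<tau>'"
    and Ac: "continuous_map (subtopology \<tau> D) \<tau>' A"
    and Rc: "continuous_map (subtopology \<tau>' (topspace \<tau>)) \<tau> (the_inv_into D A)"
    and T'c: "\<And>t. t \<ge> 0 \<Longrightarrow> continuous_map \<tau>' \<tau>' (T' t)"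
    and T'e: "\<And>t x. t \<ge> 0 \<Longrightarrow> x \<in> topspace \<tau> \<Longrightarrow> T' t x = T t x"
  shows "strongly_continuous_semigroup smul \<tau>' T'"
    and "generator_domain smul \<tau>' T' = topspace \<tau>"
    and "\<exists>J. homeomorphic_maps \<tau> \<tau>' (generator smul \<tau>' T') J"
proof -
  let ?X = "topspace \<tau>" and ?X' = "topspace \<tau>'" and ?R = "the_inv_into D A"
  note subX = lintop_subspace[OF lt]
  have subD: "subspace D" and linA: "linear_on smul D A"
    using generator_domain_linear[OF lt H T] D A by auto
  have R: "?R y \<in> D" "A (?R y) = y" if "y \<in> ?X" for y
    using bij that by (auto simp: bij_betw_def the_inv_into_into f_the_inv_into_f)
  have RA: "?R (A x) = x" if "x \<in> D" for x
    using bij that by (simp add: bij_betw_def the_inv_into_f_f)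
  have AX: "A x \<in> ?X" if "x \<in> D" for x
    using bij that by (auto simp: bij_betw_def)
  have DX: "D \<subseteq> ?X" using generator_domain_subset D by auto
  have dD: "\<tau> closure_of D = ?X"
    using generator_domain_dense[OF lt H T] bij unfolding D A bij_betw_def by blast
  \<comment> \<open>The extension from \<open>D\<close> to all of \<open>?X\<close> is possible
    because \<open>A\<close> is continuous into \<tau>' even when \<open>D\<close> carries only the
    topology of \<tau>.\<close>
  obtain K where K: "continuous_map \<tau> \<tau>' K" "linear_on smul ?X K" "\<And>x. x \<in> D \<Longrightarrow> K x = A x"
    by (rule continuous_linear_extension[OF lt lt' H' C' subD DX dD Ac linA]) blast
  obtain J where J: "continuous_map \<tau>' \<tau> J" "linear_on smul ?X' J" "\<And>x. x \<in> ?X \<Longrightarrow> J x = ?R x"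
    by (rule continuous_linear_extension[OF lt' lt H C subX X Rc linear_on_the_inv_into[OF subD linA bij]])
       blast
  have Kt: "K x \<in> ?X'" if "x \<in> ?X" for x using K(1) that by (auto simp: continuous_map_def)
  have Jt: "J x \<in> ?X" if "x \<in> ?X'" for x using J(1) that by (auto simp: continuous_map_def)
  \<comment> \<open>On \<open>D\<close> the composite is \<open>?R (A x)\<close>, and for the
    reverse law it is \<open>A (?R x)\<close> on \<open>?X\<close>; density does the rest.\<close>
  have JK: "J (K x) = x" if "x \<in> ?X" for x
  proof (rule continuous_map_eq_dense[OF H _ _ dD _ that])
    show "continuous_map \<tau> \<tau> (\<lambda>x. J (K x))"
      using continuous_map_compose[OF K(1) J(1)] by (simp add: o_def)
  qed (auto simp: K J AX RA)
  have KJ: "K (J x) = x" if "x \<in> ?X'" for x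
  proof (rule continuous_map_eq_dense[OF H' _ _ X(2) _ that])
    show "continuous_map \<tau>' \<tau>' (\<lambda>x. K (J x))"
      using continuous_map_compose[OF J(1) K(1)] by (simp add: o_def)
  qed (auto simp: K J R)
  \<comment> \<open>On \<open>D\<close> this is the commutation of \<open>T\<close> with its
    generator, since \<open>K\<close> is \<open>A\<close> there and \<open>T'\<close> agrees with
    \<open>T\<close> on the values of \<open>A\<close>.\<close>
  have TK: "T' t (K x) = K (T t x)" if "t \<ge> 0" "x \<in> ?X" for t x
  proof (rule continuous_map_eq_dense[OF H' _ _ dD _ that(2)])
    show "continuous_map \<tau> \<tau>' (\<lambda>x. T' t (K x))"
      using continuous_map_compose[OF K(1) T'c[OF that(1)]] by (simp add: o_def)
    show "continuous_map \<tau> \<tau>' (\<lambda>x. K (T t x))"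
      using continuous_map_compose[OF semigroup_continuous[OF T that(1)] K(1)] by (simp add: o_def)
    show "T' t (K x) = K (T t x)" if "x \<in> D" for x
      using generator_commute[OF lt H T \<open>t \<ge> 0\<close>, of x] that T'e[OF \<open>t \<ge> 0\<close> AX[OF that]] K(3)
      by (simp add: D A)
  qed
  have T'J: "T' t y = K (T t (J y))" if "t \<ge> 0" "y \<in> ?X'" for t y
    using TK[OF that(1) Jt[OF that(2)]] KJ[OF that(2)] by simp
  show T': "strongly_continuous_semigroup smul \<tau>' T'"
    unfolding strongly_continuous_semigroup_def
  proof (intro conjI ballI allI impI)
    fix t :: real assume t: "t \<ge> 0"
    have "linear_on smul ?X (T' t)"
      using semigroup_linear[OF T t] T'e[OF t] subX by (simp add: linear_on_def subspace_add subspace_scale)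
    then have "linear_on smul ?X' (T' t)" by (rule linear_on_dense[OF lt' lt' H' T'c[OF t] X _ subX])
    then show "continuous_linear_operator smul \<tau>' (T' t)"
      using T'c[OF t] by (simp add: continuous_linear_operator_def)
  next
    fix y assume y: "y \<in> ?X'"
    show "T' 0 y = y"
      using T'J[OF order_refl y] T Jt[OF y] KJ[OF y] by (simp add: strongly_continuous_semigroup_def)
  next
    fix t s :: real and y assume ts: "t \<ge> 0" "s \<ge> 0" and y: "y \<in> ?X'"
    have "T (t + s) (J y) = T t (T s (J y))"
      using T Jt[OF y] ts by (simp add: strongly_continuous_semigroup_def)
    then show "T' (t + s) y = T' t (T' s y)"
      using T'J[OF _ y] TK semigroup_mapsto[OF T] Jt[OF y] ts by simp
  next
    fix y assume y: "y \<in> ?X'"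
    have "continuous_map (top_of_set {0..}) \<tau>' (K \<circ> (\<lambda>t. T t (J y)))"
      by (rule continuous_map_compose[OF _ K(1)])
         (use T Jt[OF y] in \<open>simp add: strongly_continuous_semigroup_def\<close>)
    then show "continuous_map (top_of_set {0..}) \<tau>' (\<lambda>t. T' t y)"
      by (rule continuous_map_eq) (use T'J[OF _ y] in auto)
  qed
  have lim: "generator_limit smul \<tau>' T' y (K y)" if y: "y \<in> ?X" for y
  proof -
    \<comment> \<open>\<open>y = A (?R y)\<close> is a generator value for \<open>T\<close>;
      \<open>K\<close> maps \<open>?R y\<close> to \<open>y\<close> and turns this limit into one
      for \<open>T'\<close> at \<open>y\<close>.\<close>
    have "generator_limit smul \<tau> T (?R y) y"
      using generator_limit_generator[OF H, of "?R y" T] R[OF y] by (simp add: D A)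
    then have "generator_limit smul \<tau>' T' (K (?R y)) (K y)"
      by (rule generator_limit_linear_image[OF lt lt' K(1,2)])
         (use R[OF y] DX TK semigroup_mapsto[OF T] in auto)
    then show ?thesis using K(3) R[OF y] by simp
  qed
  show dom: "generator_domain smul \<tau>' T' = ?X"
  proof
    show "?X \<subseteq> generator_domain smul \<tau>' T'"
      using lim X(1) by (auto intro: generator_domainI)
    \<comment> \<open>The converse conjugates back with \<open>J\<close>: \<open>J y\<close> falls
      into \<open>D\<close>, and \<open>K\<close> sends \<open>D\<close> into \<open>?X\<close>
      because it equals \<open>A\<close> there.\<close>
    show "generator_domain smul \<tau>' T' \<subseteq> ?X"
    proof
      fix y assume "y \<in> generator_domain smul \<tau>' T'"
      then obtain z where y: "y \<in> ?X'" and z: "generator_limit smul \<tau>' T' y z"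
        by (auto simp: generator_domain_def)
      have "generator_limit smul \<tau> T (J y) (J z)"
        by (rule generator_limit_linear_image[OF lt' lt J(1,2) z y])
           (use semigroup_mapsto[OF T' _ y] semigroup_mapsto[OF T] T'J[OF _ y] JK Jt[OF y] in auto)
      then have "J y \<in> D" using Jt[OF y] by (auto simp: D intro: generator_domainI)
      then have "K (J y) \<in> ?X" using K(3) AX by simp
      then show "y \<in> ?X" using KJ[OF y] by simp
    qed
  qed
  have "homeomorphic_maps \<tau> \<tau>' K J" using K J JK KJ by (simp add: homeomorphic_maps_def)
  then have "homeomorphic_maps \<tau> \<tau>' (generator smul \<tau>' T') J"
    by (rule homeomorphic_maps_eq) (use generator_eq[OF H' lim] in auto)
  then show "\<exists>J. homeomorphic_maps \<tau> \<tau>' (generator smul \<tau>' T') J" by blast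
qed

section \<open>Normed spaces\<close>

lemma normed_space_onD:
  assumes "normed_space_on smul X N"
  shows "subspace X" "\<And>x. x \<in> X \<Longrightarrow> 0 \<le> N x" "\<And>x. x \<in> X \<Longrightarrow> N x = 0 \<longleftrightarrow> x = 0"
    "\<And>x y. x \<in> X \<Longrightarrow> y \<in> X \<Longrightarrow> N (x + y) \<le> N x + N y"
    "\<And>c x. x \<in> X \<Longrightarrow> N (smul c x) = norm c * N x"
    "\<And>x y. x \<in> X \<Longrightarrow> y \<in> X \<Longrightarrow> N (x - y) = N (y - x)"
    "\<And>x y. x \<in> X \<Longrightarrow> y \<in> X \<Longrightarrow> N (x - y) \<le> N x + N y"
proof -
  show sub: "subspace X" and tri: "\<And>x y. x \<in> X \<Longrightarrow> y \<in> X \<Longrightarrow> N (x + y) \<le> N x + N y"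
    and scal: "\<And>c x. x \<in> X \<Longrightarrow> N (smul c x) = norm c * N x"
    and "\<And>x. x \<in> X \<Longrightarrow> 0 \<le> N x" "\<And>x. x \<in> X \<Longrightarrow> N x = 0 \<longleftrightarrow> x = 0"
    using assms by (auto simp: normed_space_on_def)
  have neg: "N (- x) = N x" if "x \<in> X" for x using scal[OF that, of "-1"] by simp
  show "N (x - y) = N (y - x)" if "x \<in> X" "y \<in> X" for x y
    using neg[OF subspace_diff[OF sub that]] by simp
  show "N (x - y) \<le> N x + N y" if "x \<in> X" "y \<in> X" for x y
    using tri[OF that(1) subspace_neg[OF sub that(2)]] neg[OF that(2)] by simp
qed

lemma Metric_space_norm_dist:
  assumes "normed_space_on smul X N"
  shows "Metric_space X (norm_dist X N)"
proof
  note N = normed_space_onD[OF assms]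
  show "0 \<le> norm_dist X N x y" for x y by (auto simp: norm_dist_def N subspace_diff[OF N(1)])
  show "norm_dist X N x y = norm_dist X N y x" for x y by (auto simp: norm_dist_def N)
  show "norm_dist X N x y = 0 \<longleftrightarrow> x = y" if "x \<in> X" "y \<in> X" for x y
    using that N(3)[OF subspace_diff[OF N(1) that]] by (simp add: norm_dist_def)
  show "norm_dist X N x z \<le> norm_dist X N x y + norm_dist X N y z"
    if "x \<in> X" "y \<in> X" "z \<in> X" for x y z
    using that N(4)[OF subspace_diff[OF N(1) that(1,2)] subspace_diff[OF N(1) that(2,3)]]
    by (simp add: norm_dist_def)
qed

lemma topspace_norm_topology:
  "normed_space_on smul X N \<Longrightarrow> topspace (norm_topology X N) = X"
  unfolding norm_topology_def by (rule Metric_space.topspace_mtopology[OF Metric_space_norm_dist])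

lemma Hausdorff_norm_topology:
  "normed_space_on smul X N \<Longrightarrow> Hausdorff_space (norm_topology X N)"
  unfolding norm_topology_def by (rule Metric_space.Hausdorff_space_mtopology[OF Metric_space_norm_dist])

lemma continuous_map_norm_topology:
  assumes "normed_space_on smul X N"
  shows "continuous_map \<sigma> (norm_topology X N) f \<longleftrightarrow>
    (\<forall>x\<in>topspace \<sigma>. f x \<in> X \<and> (\<forall>e>0. \<exists>U. openin \<sigma> U \<and> x \<in> U \<and> (\<forall>y\<in>U. f y \<in> X \<and> N (f y - f x) < e)))"
proof -
  interpret M: Metric_space X "norm_dist X N" by (rule Metric_space_norm_dist[OF assms])
  have b: "z \<in> M.mball w e \<longleftrightarrow> w \<in> X \<and> z \<in> X \<and> N (z - w) < e" for z w e
    using normed_space_onD(6)[OF assms] by (auto simp: norm_dist_def)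
  show ?thesis
    unfolding norm_topology_def M.continuous_map_to_metric b
    by (metis gt_ex)
qed

lemma openin_norm_ball:
  assumes "normed_space_on smul X N" "x \<in> X"
  shows "openin (norm_topology X N) {y \<in> X. N (y - x) < e}"
proof -
  interpret M: Metric_space X "norm_dist X N" by (rule Metric_space_norm_dist[OF assms(1)])
  have "{y \<in> X. N (y - x) < e} = M.mball x e"
    using normed_space_onD(6)[OF assms(1)] assms(2) by (auto simp: norm_dist_def)
  then show ?thesis by (simp add: norm_topology_def)
qed

lemma zero_nbhd_norm_topology:
  assumes "normed_space_on smul X N"
  shows "zero_nbhd (norm_topology X N) U \<longleftrightarrow> (\<exists>e>0. \<forall>x\<in>X. N x < e \<longrightarrow> x \<in> U)"
proof
  interpret M: Metric_space X "norm_dist X N" by (rule Metric_space_norm_dist[OF assms])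
  note N = normed_space_onD[OF assms]
  have b: "z \<in> M.mball 0 e \<longleftrightarrow> z \<in> X \<and> N z < e" for z e
    using N(6)[OF _ subspace_0[OF N(1)], of z] subspace_0[OF N(1)] by (auto simp: norm_dist_def)
  assume "zero_nbhd (norm_topology X N) U"
  then obtain V where V: "openin M.mtopology V" "0 \<in> V" "V \<subseteq> U"
    by (auto simp: zero_nbhd_def norm_topology_def)
  then obtain e where "e > 0" "M.mball 0 e \<subseteq> V" unfolding M.openin_mtopology by blast
  then show "\<exists>e>0. \<forall>x\<in>X. N x < e \<longrightarrow> x \<in> U" using V(3) b by blast
next
  note N = normed_space_onD[OF assms]
  assume "\<exists>e>0. \<forall>x\<in>X. N x < e \<longrightarrow> x \<in> U"
  then obtain e where e: "e > 0" "\<forall>x\<in>X. N x < e \<longrightarrow> x \<in> U" by blast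
  have "0 \<in> X" "N 0 = 0" using subspace_0[OF N(1)] N(3) by auto
  then show "zero_nbhd (norm_topology X N) U"
    using e openin_norm_ball[OF assms \<open>0 \<in> X\<close>, of e]
    by (intro zero_nbhd_mono[OF zero_nbhd_openin, of "norm_topology X N" "{y \<in> X. N (y - 0) < e}"]) auto
qed

lemma lintop_norm_topology:
  assumes "normed_space_on smul X N"
  shows "lintop (norm_topology X N)"
  unfolding linear_topology_def
proof (intro conjI)
  let ?t = "norm_topology X N"
  note N = normed_space_onD[OF assms] and ts = topspace_norm_topology[OF assms]
  show "subspace (topspace ?t)" using N ts by simp
  show "continuous_map (prod_topology ?t ?t) ?t (\<lambda>(x, y). x + y)"
    unfolding continuous_map_norm_topology[OF assms]
  proof (intro ballI conjI allI impI)
    fix z assume "z \<in> topspace (prod_topology ?t ?t)"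
    then obtain x y where z: "z = (x, y)" and xy: "x \<in> X" "y \<in> X" using ts by auto
    show "(case z of (x, y) \<Rightarrow> x + y) \<in> X" using subspace_add[OF N(1) xy] z by simp
    fix e :: real assume e: "e > 0"
    define h where "h = e / 2"
    have h: "h > 0" "h + h = e" using e by (auto simp: h_def)
    let ?U = "{z \<in> X. N (z - x) < h} \<times> {z \<in> X. N (z - y) < h}"
    have 0: "N 0 = 0" using subspace_0[OF N(1)] N(3) by auto
    have "N (x' + y' - (x + y)) < e" if "x' \<in> X" "y' \<in> X" "N (x' - x) < h" "N (y' - y) < h" for x' y'
      using N(4)[OF subspace_diff[OF N(1) that(1) xy(1)] subspace_diff[OF N(1) that(2) xy(2)]] that h
      by (simp add: algebra_simps)
    then show "\<exists>U. openin (prod_topology ?t ?t) U \<and> z \<in> U \<and> (\<forall>w\<in>U. (case w of (x, y) \<Rightarrow> x + y) \<in> X \<and>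
        N ((case w of (x, y) \<Rightarrow> x + y) - (case z of (x, y) \<Rightarrow> x + y)) < e)"
      using z xy h(1) openin_norm_ball[OF assms] 0
      by (intro exI[of _ ?U]) (auto simp: openin_prod_Times_iff subspace_add[OF N(1)])
  qed
  show "continuous_map (prod_topology euclidean ?t) ?t (\<lambda>(c, x). smul c x)"
    unfolding continuous_map_norm_topology[OF assms]
  proof (intro ballI conjI allI impI)
    fix z assume "z \<in> topspace (prod_topology (euclidean :: 'k topology) ?t)"
    then obtain c x where z: "z = (c, x)" and x: "x \<in> X" using ts by auto
    show "(case z of (c, x) \<Rightarrow> smul c x) \<in> X" using subspace_scale[OF N(1) x] z by simp
    fix e :: real assume e: "e > 0"
    \<comment> \<open>The quantity to bound is
      \<open>norm (b - c) * N y + norm c * N (y - x)\<close>, where \<open>d \<le> 1\<close> gives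
      \<open>N y \<le> N x + 1\<close>; both terms together are less than
      \<open>d * M\<close>.\<close>
    define M where "M = N x + 1 + norm c"
    have M: "M > 0" using N(2)[OF x] by (simp add: M_def add_nonneg_pos add_pos_nonneg)
    define d where "d = min 1 (e / M)"
    have d: "d > 0" "d \<le> 1" "d * M \<le> e" using e M by (auto simp: d_def min_def field_simps)
    let ?U = "ball c d \<times> {z \<in> X. N (z - x) < d}"
    have 0: "N 0 = 0" using subspace_0[OF N(1)] N(3) by auto
    have "N (smul b y - smul c x) < e" if "b \<in> ball c d" "y \<in> X" "N (y - x) < d" for b y
    proof -
      have yx: "y - x \<in> X" using subspace_diff[OF N(1) that(2) x] .
      have bc: "norm (b - c) < d" using that(1) by (simp add: dist_norm norm_minus_commute)
      have Ny: "N y \<le> N x + 1" using N(4)[OF yx x] that(3) d by simp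
      have "smul b y - smul c x = smul (b - c) y + smul c (y - x)"
        by (simp add: scale_left_diff_distrib scale_right_diff_distrib)
      then have "N (smul b y - smul c x) \<le> norm (b - c) * N y + norm c * N (y - x)"
        using N(4)[OF subspace_scale[OF N(1) that(2)] subspace_scale[OF N(1) yx], of "b - c" c]
          N(5) that(2) yx by simp
      also have "norm (b - c) * N y \<le> norm (b - c) * (N x + 1)"
        using Ny by (rule mult_left_mono) simp
      also have "norm (b - c) * (N x + 1) + norm c * N (y - x) < d * (N x + 1) + norm c * d"
        using bc N(2)[OF x] that(3)
        by (intro add_less_le_mono mult_strict_right_mono mult_left_mono) auto
      also have "\<dots> = d * M" by (simp add: M_def algebra_simps)
      finally show ?thesis using d by simp
    qed
    then show "\<exists>U. openin (prod_topology euclidean ?t) U \<and> z \<in> U \<and> (\<forall>w\<in>U. (case w of (c, x) \<Rightarrow> smul c x) \<in> X \<and>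
        N ((case w of (c, x) \<Rightarrow> smul c x) - (case z of (c, x) \<Rightarrow> smul c x)) < e)"
      using z x d openin_norm_ball[OF assms] 0
      by (intro exI[of _ ?U]) (auto simp: openin_prod_Times_iff subspace_scale[OF N(1)] dist_commute)
  qed
qed

lemma limitin_norm_topology:
  assumes "normed_space_on smul X N"
  shows "limitin (norm_topology X N) f l F \<longleftrightarrow>
    l \<in> X \<and> (\<forall>e>0. eventually (\<lambda>x. f x \<in> X \<and> N (f x - l) < e) F)"
proof -
  interpret M: Metric_space X "norm_dist X N" by (rule Metric_space_norm_dist[OF assms])
  show ?thesis
    unfolding norm_topology_def M.limitin_metric
    by (auto simp: norm_dist_def cong: conj_cong)
qed

text \<open>Cauchy filters reduce to Cauchy sequences because the balls of radius
  \<open>inverse (Suc n)\<close> form a countable base. The limit of the sequence is that of the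
  filter, since a set \<open>Q m\<close> of small diameter contains the late terms.\<close>

lemma complete_tvs_norm_topology:
  assumes "banach_space_on smul X N"
  shows "complete_tvs (norm_topology X N)"
  unfolding complete_tvs_def
proof (intro allI impI)
  fix F :: "'e filter" assume F: "cauchy_filter_in (norm_topology X N) F"
  have nrm: "normed_space_on smul X N" and mc: "Metric_space.mcomplete X (norm_dist X N)"
    using assms by (auto simp: banach_space_on_def)
  interpret M: Metric_space X "norm_dist X N" by (rule Metric_space_norm_dist[OF nrm])
  note N = normed_space_onD[OF nrm] and ts = topspace_norm_topology[OF nrm]
  have N0: "N 0 = 0" and X0: "0 \<in> X" using subspace_0[OF N(1)] N(3) by auto
  have FX: "eventually (\<lambda>x. x \<in> X) F" and Fb: "F \<noteq> bot" using F ts by (auto simp: cauchy_filter_in_def)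
  have "\<exists>Q. eventually Q F \<and> (\<forall>x y. Q x \<longrightarrow> Q y \<longrightarrow> x \<in> X \<and> N (x - y) < inverse (Suc n))" for n
  proof -
    let ?b = "{z \<in> X. N (z - 0) < inverse (Suc n)}"
    have "openin (norm_topology X N) ?b" "0 \<in> ?b" using openin_norm_ball[OF nrm X0] N0 X0 by auto
    then have "eventually (\<lambda>(x, y). x - y \<in> ?b) (F \<times>\<^sub>F F)"
      using F unfolding cauchy_filter_in_def by blast
    then obtain Q where "eventually Q F" "\<forall>x y. Q x \<longrightarrow> Q y \<longrightarrow> N (x - y) < inverse (Suc n)"
      unfolding eventually_prod_same by auto
    then show ?thesis using eventually_conj[OF _ FX, of Q] by (intro exI[of _ "\<lambda>x. Q x \<and> x \<in> X"]) auto
  qed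
  then obtain Q where Q: "\<And>n. eventually (Q n) F"
    "\<And>n x y. Q n x \<Longrightarrow> Q n y \<Longrightarrow> x \<in> X \<and> N (x - y) < inverse (Suc n)" by metis
  \<comment> \<open>The sets \<open>Q k\<close> need not be nested, so \<open>s n\<close> is chosen
    in all of them up to \<open>k = n\<close> at once; late terms then share \<open>Q m\<close> with
    each other and with the points of the filter.\<close>
  have "\<exists>x. \<forall>k\<le>n. Q k x" for n
  proof -
    have "eventually (\<lambda>x. \<forall>k\<in>{..n}. Q k x) F" using Q(1) by (intro eventually_ball_finite) auto
    then show ?thesis using eventually_happens'[OF Fb] by fastforce
  qed
  then obtain s where s: "\<And>n k. k \<le> n \<Longrightarrow> Q k (s n)" by metis
  have sX: "s n \<in> X" for n using s[of n n] Q(2) by blast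
  have "M.MCauchy s"
    unfolding M.MCauchy_def
  proof (intro conjI allI impI)
    show "range s \<subseteq> X" using sX by auto
    fix e :: real assume "e > 0"
    then obtain m where m: "inverse (Suc m) < e" using reals_Archimedean by blast
    have "norm_dist X N (s n) (s n') < e" if "m \<le> n" "m \<le> n'" for n n'
      using Q(2)[OF s[OF that(1)] s[OF that(2)]] m sX by (simp add: norm_dist_def)
    then show "\<exists>m. \<forall>n n'. m \<le> n \<longrightarrow> m \<le> n' \<longrightarrow> norm_dist X N (s n) (s n') < e" by blast
  qed
  then obtain l where l: "limitin (norm_topology X N) s l sequentially"
    using mc unfolding M.mcomplete_def norm_topology_def by blast
  then have lX: "l \<in> X" by (simp add: limitin_norm_topology[OF nrm])
  have "eventually (\<lambda>x. x \<in> X \<and> N (x - l) < e) F" if e: "e > 0" for e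
  proof -
    obtain m where m: "inverse (Suc m) < e / 2" using reals_Archimedean e half_gt_zero by blast
    have "eventually (\<lambda>n. s n \<in> X \<and> N (s n - l) < e / 2) sequentially"
      using l half_gt_zero[OF e] unfolding limitin_norm_topology[OF nrm] by blast
    then obtain k where "\<forall>n\<ge>k. N (s n - l) < e / 2" unfolding eventually_sequentially by blast
    then obtain n where n: "n \<ge> m" "N (s n - l) < e / 2" using that[of "max k m"] by auto
    show ?thesis
    proof (rule eventually_mono[OF Q(1)[of m]])
      fix x assume "Q m x"
      then have x: "x \<in> X" "N (x - s n) < inverse (Suc m)" using Q(2) s[OF n(1)] by auto
      then show "x \<in> X \<and> N (x - l) < e"
        using N(4)[OF subspace_diff[OF N(1) x(1) sX[of n]] subspace_diff[OF N(1) sX[of n] lX]] m n by simp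
    qed
  qed
  then show "\<exists>x. limitin (norm_topology X N) (\<lambda>y. y) x F"
    using lX limitin_norm_topology[OF nrm] by blast
qed

lemma convex_set_norm_ball:
  assumes "normed_space_on smul X N"
  shows "convex_set smul {x \<in> X. N x < e}"
  unfolding convex_set_def
proof (intro ballI allI impI)
  note N = normed_space_onD[OF assms]
  fix x y and u v :: real
  assume x: "x \<in> {x \<in> X. N x < e}" and y: "y \<in> {x \<in> X. N x < e}" and uv: "0 \<le> u \<and> 0 \<le> v \<and> u + v = 1"
  have "N (smul (of_real u) x + smul (of_real v) y) \<le> u * N x + v * N y"
    using N(4)[of "smul (of_real u) x" "smul (of_real v) y"] x y uv N(5) subspace_scale[OF N(1)] by simp
  also have "\<dots> < e"
  \<comment> \<open>Strictness must come from a summand with positive weight; for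
    \<open>u = 0\<close> it comes from \<open>y\<close>.\<close>
  proof (cases "u = 0")
    case False
    then have "u * N x < u * e" "v * N y \<le> v * e" using x y uv by (auto intro!: mult_left_mono)
    then have "u * N x + v * N y < (u + v) * e" by (simp add: distrib_right)
    then show ?thesis using uv by simp
  qed (use y uv in auto)
  finally show "smul (of_real u) x + smul (of_real v) y \<in> {x \<in> X. N x < e}"
    using x y N(1) by (simp add: subspace_add subspace_scale)
qed

lemma locally_convex_norm_topology:
  assumes "normed_space_on smul X N"
  shows "locally_convex_space smul (norm_topology X N)"
  unfolding locally_convex_zero_nbhd
proof (intro conjI allI impI)
  fix U assume "zero_nbhd (norm_topology X N) U"
  then obtain e where e: "e > 0" "\<forall>x\<in>X. N x < e \<longrightarrow> x \<in> U"
    unfolding zero_nbhd_norm_topology[OF assms] by blast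
  then show "\<exists>C. zero_nbhd (norm_topology X N) C \<and> C \<subseteq> U \<and> convex_set smul C"
    using convex_set_norm_ball[OF assms]
    by (intro exI[of _ "{x \<in> X. N x < e}"]) (auto simp: zero_nbhd_norm_topology[OF assms])
qed (rule lintop_norm_topology[OF assms])

text \<open>Baire's theorem: the closed multiples \<open>E n\<close> of the barrel cover the
  complete space, so one of them has an interior point \<open>x\<close>. Absolute convexity then
  moves a ball around \<open>x\<close> to one around zero.\<close>

lemma barrelled_norm_topology:
  assumes "banach_space_on smul X N"
  shows "barrelled_space smul (norm_topology X N)"
  unfolding barrelled_space_def
proof (intro conjI allI impI)
  have nrm: "normed_space_on smul X N" and mc: "Metric_space.mcomplete X (norm_dist X N)"
    using assms by (auto simp: banach_space_on_def)
  show "locally_convex_space smul (norm_topology X N)" by (rule locally_convex_norm_topology[OF nrm])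
  let ?t = "norm_topology X N"
  interpret M: Metric_space X "norm_dist X N" by (rule Metric_space_norm_dist[OF nrm])
  note N = normed_space_onD[OF nrm] and ts = topspace_norm_topology[OF nrm]
  have N0: "N 0 = 0" and X0: "0 \<in> X" using subspace_0[OF N(1)] N(3) by auto
  fix B assume B: "barrel smul ?t B"
  then have cl: "closedin ?t B" and ac: "absconvex B" by (auto simp: barrel_absconvex)
  have BX: "B \<subseteq> X" using closedin_subset[OF cl] ts by simp
  \<comment> \<open>\<open>E n\<close> is \<open>Suc n\<close> times \<open>B\<close>, written as a
    preimage so that closedness is immediate.\<close>
  define E where "E n = {x \<in> X. smul (inverse (of_nat (Suc n))) x \<in> B}" for n
  have clE: "closedin M.mtopology (E n)" for n
    using closedin_continuous_map_preimage[OF continuous_map_scale[OF lintop_norm_topology[OF nrm]] cl]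
    unfolding E_def ts by (simp add: norm_topology_def)
  have cover: "X \<subseteq> \<Union>(range E)"
  proof
    fix x assume x: "x \<in> X"
    then obtain r where r: "r > 0" "\<forall>c. norm c \<le> r \<longrightarrow> smul c x \<in> B"
      using B ts unfolding barrel_def by metis
    then obtain n where "inverse (real (Suc n)) < r" using reals_Archimedean by blast
    then have "norm (inverse (of_nat (Suc n)) :: 'k) \<le> r" by (simp only: norm_inverse norm_of_nat)
    then show "x \<in> \<Union>(range E)" using r(2) x unfolding E_def by blast
  qed
  have "\<exists>n. M.mtopology interior_of E n \<noteq> {}"
  proof (rule ccontr)
    assume "\<nexists>n. M.mtopology interior_of E n \<noteq> {}"
    then have "M.mtopology interior_of \<Union>(range E) = {}"
      using clE by (intro M.metric_Baire_category_alt[OF mc]) auto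
    moreover have "\<Union>(range E) = topspace M.mtopology" using cover by (auto simp: E_def)
    ultimately show False using X0 interior_of_topspace[of M.mtopology] by auto
  qed
  then obtain n x where "x \<in> M.mtopology interior_of E n" by blast
  then obtain V where V: "openin ?t V" "x \<in> V" "V \<subseteq> E n"
    unfolding interior_of_def norm_topology_def by blast
  have x: "x \<in> X" using V openin_subset ts by blast
  have "openin ?t {y \<in> X. y + x \<in> V}"
    using openin_continuous_map_preimage[OF continuous_map_translate[OF lintop_norm_topology[OF nrm]] V(1), of x]
      x ts by simp
  then have "zero_nbhd ?t {y \<in> X. y + x \<in> V}" using V(2) X0 by (intro zero_nbhd_openin) auto
  then obtain e where e: "e > 0" "\<forall>y\<in>X. N y < e \<longrightarrow> y + x \<in> V"
    unfolding zero_nbhd_norm_topology[OF nrm] by blast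
  let ?k = "inverse (of_nat (Suc n)) :: 'k"
  \<comment> \<open>With \<open>y + x\<close> and \<open>- y + x\<close> both in \<open>V\<close>,
    the point \<open>y\<close> is the midpoint of \<open>y + x\<close> and
    \<open>- (- y + x)\<close>; this removes the centre \<open>x\<close>.\<close>
  have half: "smul (of_real (1/2)) a + smul (of_real (1/2)) b \<in> B" if "a \<in> B" "b \<in> B" for a b
    by (rule absconvexD(1)[OF ac that]) auto
  have "smul ?k y \<in> B" if y: "y \<in> X" "N y < e" for y
  proof -
    have "N (- y) = N y" using N(5)[OF y(1), of "-1"] by simp
    then have "y + x \<in> V" "- y + x \<in> V"
      using e(2) y subspace_neg[OF N(1) y(1)] by (simp_all del: add_uminus_conv_diff uminus_add_conv_diff)
    then have "smul ?k (y + x) \<in> B" "smul ?k (- y + x) \<in> B" using V(3) unfolding E_def by blast+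
    then have "smul ?k (y + x) \<in> B" "smul (-1) (smul ?k (- y + x)) \<in> B"
      using absconvexD(2)[OF ac, of _ "-1"] by auto
    then have "smul (of_real (1/2)) (smul ?k (y + x)) + smul (of_real (1/2)) (smul (-1) (smul ?k (- y + x))) \<in> B"
      by (rule half)
    moreover have "smul (of_real (1/2)) (smul ?k (y + x)) + smul (of_real (1/2)) (smul (-1) (smul ?k (- y + x)))
        = smul ?k y"
    proof -
      define h where "h = of_real (1/2) * ?k"
      have "smul h (y + x) - smul h (- y + x) = smul h y + smul h y"
        by (simp add: scale_right_distrib scale_right_diff_distrib)
      then have "smul h (y + x) - smul h (- y + x) = smul (h + h) y" by (simp only: scale_left_distrib)
      moreover have "h + h = ?k" by (simp add: h_def del: of_nat_Suc)
      ultimately show ?thesis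
        unfolding h_def by (simp only: scale_scale mult_minus1 mult_minus_right scale_minus_left scale_minus_right scale_one add_uminus_conv_diff)
    qed
    ultimately show ?thesis by simp
  qed
  then have "zero_nbhd ?t {y \<in> X. smul ?k y \<in> B}"
    unfolding zero_nbhd_norm_topology[OF nrm] using e(1) by blast
  \<comment> \<open>Rescaling by \<open>Suc n\<close> undoes the factor \<open>?k\<close>.\<close>
  from zero_nbhd_scaled_preimage[OF lintop_norm_topology[OF nrm] this, of "of_nat (Suc n)"]
  have "zero_nbhd ?t B" by (rule zero_nbhd_mono) (auto simp: ts simp del: of_nat_Suc)
  then show "\<exists>V. openin ?t V \<and> 0 \<in> V \<and> V \<subseteq> B" by (simp add: zero_nbhd_def)
qed

section \<open>Inductive limits\<close>

lemma absconvex_vimage: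
  assumes "subspace V" "linear_on smul V f" "absconvex C"
  shows "absconvex {x \<in> V. f x \<in> C}"
  unfolding absconvex_def convex_set_def
  using assms absconvexD[OF assms(3)]
  by (simp add: linear_on_def subspace_add subspace_scale)

lemma absconvex_sum:
  assumes A: "absconvex A" and B: "absconvex B"
  shows "absconvex {a + b |a b. a \<in> A \<and> b \<in> B}"
  unfolding absconvex_def convex_set_def
proof (intro conjI ballI allI impI)
  fix x y and u v :: real
  assume xy: "x \<in> {a + b |a b. a \<in> A \<and> b \<in> B}" "y \<in> {a + b |a b. a \<in> A \<and> b \<in> B}"
    and uv: "0 \<le> u \<and> 0 \<le> v \<and> u + v = 1"
  obtain a b a' b' where ab: "x = a + b" "y = a' + b'" "a \<in> A" "a' \<in> A" "b \<in> B" "b' \<in> B"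
    using xy by blast
  have "smul (of_real u) x + smul (of_real v) y =
      (smul (of_real u) a + smul (of_real v) a') + (smul (of_real u) b + smul (of_real v) b')"
    by (simp add: ab scale_right_distrib)
  then show "smul (of_real u) x + smul (of_real v) y \<in> {a + b |a b. a \<in> A \<and> b \<in> B}"
    using absconvexD(1)[OF A ab(3,4)] absconvexD(1)[OF B ab(5,6)] uv by blast
next
  fix c :: 'k and x assume x: "x \<in> {a + b |a b. a \<in> A \<and> b \<in> B}" and c: "norm c \<le> 1"
  then obtain a b where ab: "x = a + b" "a \<in> A" "b \<in> B" by blast
  have "smul c x = smul c a + smul c b" by (simp add: ab scale_right_distrib)
  then show "smul c x \<in> {a + b |a b. a \<in> A \<and> b \<in> B}"
    using absconvexD(2)[OF A ab(2) c] absconvexD(2)[OF B ab(3) c] by blast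
qed

lemma absconvex_UN_chain:
  assumes "\<And>m. absconvex (C m)" "\<And>m. C m \<subseteq> C (Suc m)"
  shows "absconvex (\<Union>m::nat. C m)"
  unfolding absconvex_def convex_set_def
proof (intro conjI ballI allI impI)
  have mono: "C m \<subseteq> C n" if "m \<le> n" for m n using lift_Suc_mono_le[of C, OF assms(2) that] .
  fix x y and u v :: real
  assume "x \<in> (\<Union>m. C m)" "y \<in> (\<Union>m. C m)" and uv: "0 \<le> u \<and> 0 \<le> v \<and> u + v = 1"
  then obtain m n where "x \<in> C m" "y \<in> C n" by blast
  then have "x \<in> C (max m n)" "y \<in> C (max m n)" using mono[of m "max m n"] mono[of n "max m n"] by auto
  then show "smul (of_real u) x + smul (of_real v) y \<in> (\<Union>m. C m)"
    using absconvexD(1)[OF assms(1)] uv by blast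
next
  fix c :: 'k and x assume "x \<in> (\<Union>m. C m)" "norm c \<le> 1"
  then show "smul c x \<in> (\<Union>m. C m)" using absconvexD(2)[OF assms(1)] by blast
qed

lemma absconvex_norm_ball:
  assumes "normed_space_on smul X N"
  shows "absconvex {x \<in> X. N x < e}"
  unfolding absconvex_def
proof (intro conjI ballI allI impI)
  note N = normed_space_onD[OF assms]
  show "convex_set smul {x \<in> X. N x < e}" by (rule convex_set_norm_ball[OF assms])
  fix c :: 'k and x assume x: "x \<in> {x \<in> X. N x < e}" and c: "norm c \<le> 1"
  have "norm c * N x \<le> 1 * N x" using c N(2) x by (intro mult_right_mono) auto
  then show "smul c x \<in> {x \<in> X. N x < e}" using x N(5) subspace_scale[OF N(1)] by simp
qed

text \<open>The usual construction of a topology from a neighbourhood base at zero and its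
  translates; it produces a competitor for the finest linear topology in
  \<open>zero_nbhd_limit_base\<close>. The hypothesis \<open>scaled\<close> serves twice: with
  factor \<open>2\<close> for addition, and with a bound on the scalars for multiplication.\<close>

lemma lintop_of_absconvex_base:
  assumes V: "subspace V" and ne: "\<C> \<noteq> {}"
    and sub: "\<And>C. C \<in> \<C> \<Longrightarrow> C \<subseteq> V" and zero: "\<And>C. C \<in> \<C> \<Longrightarrow> 0 \<in> C"
    and ac: "\<And>C. C \<in> \<C> \<Longrightarrow> absconvex C"
    and int: "\<And>B C. B \<in> \<C> \<Longrightarrow> C \<in> \<C> \<Longrightarrow> B \<inter> C \<in> \<C>"
    and scaled: "\<And>C c. C \<in> \<C> \<Longrightarrow> {x \<in> V. smul c x \<in> C} \<in> \<C>"
    and absorbing: "\<And>C x. C \<in> \<C> \<Longrightarrow> x \<in> V \<Longrightarrow> \<exists>r>0. \<forall>c. norm c \<le> r \<longrightarrow> smul c x \<in> C"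
  obtains \<sigma> where "lintop \<sigma>" "topspace \<sigma> = V"
    "\<And>W. zero_nbhd \<sigma> W \<longleftrightarrow> (\<exists>C\<in>\<C>. C \<subseteq> W)"
proof -
  define opn where "opn W \<longleftrightarrow> W \<subseteq> V \<and> (\<forall>x\<in>W. \<exists>C\<in>\<C>. \<forall>c\<in>C. x + c \<in> W)" for W
  have "istopology opn"
    unfolding istopology_def
  proof (intro conjI allI impI)
    fix S T assume S: "opn S" and T: "opn T"
    have "\<exists>C\<in>\<C>. \<forall>c\<in>C. x + c \<in> S \<inter> T" if x: "x \<in> S \<inter> T" for x
    proof -
      obtain B where "B \<in> \<C>" "\<forall>c\<in>B. x + c \<in> S" using S x unfolding opn_def by blast
      moreover obtain C where "C \<in> \<C>" "\<forall>c\<in>C. x + c \<in> T" using T x unfolding opn_def by blast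
      ultimately show ?thesis using int by (intro bexI[of _ "B \<inter> C"]) auto
    qed
    then show "opn (S \<inter> T)" using S T unfolding opn_def by blast
  next
    fix K assume K: "\<forall>S\<in>K. opn S"
    have "\<exists>C\<in>\<C>. \<forall>c\<in>C. x + c \<in> \<Union>K" if x: "x \<in> \<Union>K" for x
    proof -
      obtain S where S: "S \<in> K" "x \<in> S" using x by blast
      then obtain C where "C \<in> \<C>" "\<forall>c\<in>C. x + c \<in> S" using K unfolding opn_def by blast
      then show ?thesis using S(1) by blast
    qed
    then show "opn (\<Union>K)" using K unfolding opn_def by blast
  qed
  define \<sigma> where "\<sigma> = topology opn"
  have op: "openin \<sigma> W \<longleftrightarrow> opn W" for W
    unfolding \<sigma>_def using topology_inverse'[OF \<open>istopology opn\<close>] by simp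
  have "opn V"
    unfolding opn_def using ne sub subspace_add[OF V] by blast
  then have ts: "topspace \<sigma> = V" unfolding topspace_def op using opn_def by auto
  have half: "\<exists>B\<in>\<C>. \<forall>x\<in>B. \<forall>y\<in>B. x + y \<in> C" if C: "C \<in> \<C>" for C
  \<comment> \<open>By convexity \<open>x + y\<close>, the midpoint of \<open>2 x\<close> and
    \<open>2 y\<close>, stays in \<open>C\<close>.\<close>
  proof (intro bexI[OF _ scaled[OF C, of 2]] ballI)
    fix x y assume "x \<in> {x \<in> V. smul 2 x \<in> C}" "y \<in> {x \<in> V. smul 2 x \<in> C}"
    then have "smul (of_real (1/2)) (smul 2 x) + smul (of_real (1/2)) (smul 2 y) \<in> C"
      by (intro absconvexD(1)[OF ac[OF C]]) auto
    then show "x + y \<in> C" by simp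
  qed
  have nbhd: "\<exists>W. openin \<sigma> W \<and> x \<in> W \<and> (\<forall>y\<in>W. y - x \<in> C)" if C: "C \<in> \<C>" and x: "x \<in> V" for C x
  proof -
    \<comment> \<open>Members of the base need not be open. \<open>W\<close> is the interior of
      \<open>x + C\<close>: the points around which some base set still fits.\<close>
    define W where "W = {y \<in> V. \<exists>B\<in>\<C>. \<forall>b\<in>B. y - x + b \<in> C}"
    have "opn W"
      unfolding opn_def
    proof (intro conjI ballI)
      fix y assume "y \<in> W"
      then obtain B where B: "y \<in> V" "B \<in> \<C>" "\<forall>b\<in>B. y - x + b \<in> C" by (auto simp: W_def)
      obtain B' where B': "B' \<in> \<C>" "\<forall>x\<in>B'. \<forall>y\<in>B'. x + y \<in> B" using half[OF B(2)] by blast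
      have "y + c \<in> W" if c: "c \<in> B'" for c
      proof -
        have "\<forall>b\<in>B'. y + c - x + b \<in> C"
        proof
          fix b assume "b \<in> B'"
          then have "y - x + (c + b) \<in> C" using B(3) B'(2) c by blast
          then show "y + c - x + b \<in> C" by (simp add: algebra_simps)
        qed
        moreover have "y + c \<in> V" using B(1) c sub[OF B'(1)] by (intro subspace_add[OF V]) auto
        ultimately show ?thesis using B'(1) unfolding W_def by blast
      qed
      then show "\<exists>C\<in>\<C>. \<forall>c\<in>C. y + c \<in> W" using B'(1) by blast
    qed (auto simp: W_def)
    moreover have "x \<in> W" unfolding W_def using x C by force
    moreover have "y - x \<in> C" if y: "y \<in> W" for y
    proof -
      obtain B where B: "B \<in> \<C>" "\<forall>b\<in>B. y - x + b \<in> C" using y unfolding W_def by blast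
      then have "y - x + 0 \<in> C" using zero by blast
      then show ?thesis by simp
    qed
    ultimately show ?thesis using op by blast
  qed
  have "lintop \<sigma>"
    unfolding linear_topology_def
  proof (intro conjI)
    show "subspace (topspace \<sigma>)" using V ts by simp
    show "continuous_map (prod_topology \<sigma> \<sigma>) \<sigma> (\<lambda>(x, y). x + y)"
      unfolding continuous_map_eq_topcontinuous_at topcontinuous_at_def
    proof (intro ballI conjI allI impI)
      fix z assume z: "z \<in> topspace (prod_topology \<sigma> \<sigma>)"
      show "(\<lambda>(x, y). x + y) \<in> topspace (prod_topology \<sigma> \<sigma>) \<rightarrow> topspace \<sigma>"
        using subspace_add[OF V] ts by auto
      fix W assume W: "openin \<sigma> W \<and> (case z of (x, y) \<Rightarrow> x + y) \<in> W"
      obtain x y where xy: "z = (x, y)" "x \<in> V" "y \<in> V" using z ts by auto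
      obtain C where C: "C \<in> \<C>" "\<forall>c\<in>C. (x + y) + c \<in> W" using W xy op unfolding opn_def by auto
      obtain B where B: "B \<in> \<C>" "\<forall>x\<in>B. \<forall>y\<in>B. x + y \<in> C" using half[OF C(1)] by blast
      obtain P where P: "openin \<sigma> P" "x \<in> P" "\<forall>p\<in>P. p - x \<in> B" using nbhd[OF B(1) xy(2)] by blast
      obtain Q where Q: "openin \<sigma> Q" "y \<in> Q" "\<forall>q\<in>Q. q - y \<in> B" using nbhd[OF B(1) xy(3)] by blast
      have "p + q \<in> W" if "p \<in> P" "q \<in> Q" for p q
      proof -
        have "(x + y) + ((p - x) + (q - y)) \<in> W" using that P Q B C by blast
        then show ?thesis by (simp add: algebra_simps)
      qed
      then show "\<exists>U. openin (prod_topology \<sigma> \<sigma>) U \<and> z \<in> U \<and> (\<forall>w\<in>U. (case w of (x, y) \<Rightarrow> x + y) \<in> W)"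
        using P Q xy by (intro exI[of _ "P \<times> Q"]) (auto simp: openin_prod_Times_iff)
    qed (use V in auto)
    show "continuous_map (prod_topology euclidean \<sigma>) \<sigma> (\<lambda>(c, x). smul c x)"
      unfolding continuous_map_eq_topcontinuous_at topcontinuous_at_def
    proof (intro ballI conjI allI impI)
      fix z assume z: "z \<in> topspace (prod_topology (euclidean :: 'k topology) \<sigma>)"
      show "(\<lambda>(c, x). smul c x) \<in> topspace (prod_topology euclidean \<sigma>) \<rightarrow> topspace \<sigma>"
        using subspace_scale[OF V] ts by auto
      fix W assume W: "openin \<sigma> W \<and> (case z of (c, x) \<Rightarrow> smul c x) \<in> W"
      obtain c x where xy: "z = (c, x)" "x \<in> V" using z ts by auto
      obtain C where C: "C \<in> \<C>" "\<forall>b\<in>C. smul c x + b \<in> W" using W xy op unfolding opn_def by auto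
      obtain B where B: "B \<in> \<C>" "\<forall>x\<in>B. \<forall>y\<in>B. x + y \<in> C" using half[OF C(1)] by blast
      obtain r where r: "r > 0" "\<forall>c. norm c \<le> r \<longrightarrow> smul c x \<in> B" using absorbing[OF B(1) xy(2)] by blast
      \<comment> \<open>\<open>smul d p\<close> will be written as
        \<open>smul c x + (smul d (p - x) + smul (d - c) x)\<close>. For \<open>d\<close> within
        \<open>r\<close> of \<open>c\<close> one has \<open>norm d \<le> m\<close>, so
        \<open>p - x\<close> must still lie in \<open>B\<close> after scaling by
        \<open>m\<close>.\<close>
      define m where "m = norm c + r"
      have m: "m > 0" using r by (simp add: m_def add_nonneg_pos)
      obtain P where P: "openin \<sigma> P" "x \<in> P" "\<forall>p\<in>P. p - x \<in> {y \<in> V. smul (of_real m) y \<in> B}"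
        using nbhd[OF scaled[OF B(1)] xy(2)] by blast
      have "smul d p \<in> W" if d: "d \<in> ball c r" and p: "p \<in> P" for d p
      proof -
        have dc: "norm (d - c) \<le> r" using d by (simp add: dist_norm norm_minus_commute)
        then have "norm d \<le> m" unfolding m_def using norm_triangle_sub[of d c] by simp
        then have "norm (d / of_real m) \<le> 1" using m by (simp add: norm_divide)
        moreover have "smul (of_real m) (p - x) \<in> B" using P(3) p by blast
        ultimately have "smul (d / of_real m) (smul (of_real m) (p - x)) \<in> B"
          by (rule absconvexD(2)[OF ac[OF B(1)], rotated])
        then have "smul d (p - x) \<in> B" using m by simp
        moreover have "smul (d - c) x \<in> B" using r dc by blast
        ultimately have "smul c x + (smul d (p - x) + smul (d - c) x) \<in> W" using B C by blast
        then show ?thesis by (simp add: scale_right_diff_distrib scale_left_diff_distrib)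
      qed
      then show "\<exists>U. openin (prod_topology euclidean \<sigma>) U \<and> z \<in> U \<and> (\<forall>w\<in>U. (case w of (c, x) \<Rightarrow> smul c x) \<in> W)"
        using P xy r(1) by (intro exI[of _ "ball c r \<times> P"]) (auto simp: openin_prod_Times_iff)
    qed (use V in auto)
  qed
  moreover have "zero_nbhd \<sigma> W \<longleftrightarrow> (\<exists>C\<in>\<C>. C \<subseteq> W)" for W
  proof
    assume "zero_nbhd \<sigma> W"
    then obtain W' where "opn W'" "0 \<in> W'" "W' \<subseteq> W" unfolding zero_nbhd_def op by blast
    then obtain C where "C \<in> \<C>" "\<forall>c\<in>C. 0 + c \<in> W'" unfolding opn_def by blast
    then show "\<exists>C\<in>\<C>. C \<subseteq> W" using \<open>W' \<subseteq> W\<close> by (auto intro!: bexI[of _ C])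
  next
    assume "\<exists>C\<in>\<C>. C \<subseteq> W"
    then obtain C where C: "C \<in> \<C>" "C \<subseteq> W" by blast
    obtain P where P: "openin \<sigma> P" "0 \<in> P" "\<forall>p\<in>P. p - 0 \<in> C"
      using nbhd[OF C(1) subspace_0[OF V]] by blast
    then show "zero_nbhd \<sigma> W" unfolding zero_nbhd_def using C(2) by (intro exI[of _ P]) auto
  qed
  ultimately show thesis using that ts by blast
qed

end

section \<open>Countable inductive limits of normed spaces\<close>

locale inductive_limit = normed_scalar_space smul
  for smul :: "'k::real_normed_field \<Rightarrow> 'e::ab_group_add \<Rightarrow> 'e" +
  fixes X :: "nat \<Rightarrow> 'e set" and N :: "nat \<Rightarrow> 'e \<Rightarrow> real" and \<tau> :: "'e topology"
  assumes nrm: "\<And>n. normed_space_on smul (X n) (N n)"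
    and ind: "inductive_limit_topology smul X N \<tau>"
begin

abbreviation "ntop n \<equiv> norm_topology (X n) (N n)"

lemma limit_lintop: "lintop \<tau>" and topspace_limit: "topspace \<tau> = (\<Union>n. X n)"
  and continuous_map_inclusion: "continuous_map (ntop n) \<tau> (\<lambda>x. x)"
  using ind by (auto simp: inductive_limit_topology_def)

lemma limit_finest:
  assumes "lintop \<sigma>" "topspace \<sigma> = (\<Union>n. X n)" "\<And>n. continuous_map (ntop n) \<sigma> (\<lambda>x. x)" "openin \<sigma> U"
  shows "openin \<tau> U"
  using ind assms by (auto simp: inductive_limit_topology_def)

text \<open>The neighbourhood base at zero of the finest locally convex topology on the union;
  \<open>zero_nbhd_limit_base\<close> and \<open>zero_nbhd_limitD\<close> show that it is one for
  \<tau> as well. The condition for \<open>ntop n\<close> concerns the trace on \<open>X n\<close>,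
  since \<open>zero_nbhd\<close> only asks for an open subset.\<close>

definition base :: "'e set set" where
  "base = {C. C \<subseteq> (\<Union>n. X n) \<and> absconvex C \<and> (\<forall>n. zero_nbhd (ntop n) C)}"

lemma zero_nbhd_inclusion:
  assumes "zero_nbhd \<tau> V"
  shows "zero_nbhd (ntop n) V"
proof (rule zero_nbhd_mono)
  show "zero_nbhd (ntop n) {x \<in> topspace (ntop n). x \<in> V}"
    by (rule zero_nbhd_preimage[OF continuous_map_inclusion refl lintop_zero[OF lintop_norm_topology[OF nrm]] assms])
qed auto

text \<open>By \<open>lintop_of_absconvex_base\<close> the family \<open>base\<close> generates a
  linear topology \<sigma>. Every inclusion into it is continuous, so it competes in the definition
  of \<tau> and is coarser.\<close>

lemma zero_nbhd_limit_base:
  assumes "C \<in> base"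
  shows "zero_nbhd \<tau> C"
proof -
  let ?V = "\<Union>n. X n"
  have V: "subspace ?V" using lintop_subspace[OF limit_lintop] topspace_limit by simp
  have tn: "topspace (ntop n) = X n" for n by (rule topspace_norm_topology[OF nrm])
  obtain \<sigma> where \<sigma>: "lintop \<sigma>" "topspace \<sigma> = ?V" "\<And>W. zero_nbhd \<sigma> W \<longleftrightarrow> (\<exists>C\<in>base. C \<subseteq> W)"
  proof (rule lintop_of_absconvex_base[OF V, of base])
    show "{x \<in> ?V. smul c x \<in> C} \<in> base" if "C \<in> base" for C and c :: 'k
    proof -
      have "linear_on smul ?V (smul c)" by (simp add: linear_on_def scale_right_distrib mult.commute)
      then have "absconvex {x \<in> ?V. smul c x \<in> C}"
        using that by (intro absconvex_vimage[OF V]) (auto simp: base_def)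
      moreover have "zero_nbhd (ntop n) {x \<in> ?V. smul c x \<in> C}" for n
      proof (rule zero_nbhd_mono)
        show "zero_nbhd (ntop n) {x \<in> topspace (ntop n). smul c x \<in> C}"
          using that by (intro zero_nbhd_scaled_preimage lintop_norm_topology nrm) (auto simp: base_def)
      qed (auto simp: tn)
      ultimately show ?thesis by (auto simp: base_def)
    qed
    show "\<exists>r>0. \<forall>c. norm c \<le> r \<longrightarrow> smul c x \<in> C" if "C \<in> base" "x \<in> ?V" for C x
    proof -
      obtain n where "x \<in> X n" using \<open>x \<in> ?V\<close> by blast
      then show ?thesis
        using that(1) zero_nbhd_absorbing[OF lintop_norm_topology[OF nrm], of n C x]
        by (auto simp: base_def tn)
    qed
    show "B \<inter> C \<in> base" if "B \<in> base" "C \<in> base" for B C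
      using that by (auto simp: base_def absconvex_def convex_set_def intro!: zero_nbhd_Int)
    show "0 \<in> C" if "C \<in> base" for C using that zero_nbhd_zero by (auto simp: base_def)
  qed (use assms in \<open>auto simp: base_def\<close>)
  have "continuous_map (ntop n) \<sigma> (\<lambda>x. x)" for n
  proof (rule continuous_map_linearI[OF lintop_norm_topology[OF nrm] \<sigma>(1)])
    fix U assume "zero_nbhd \<sigma> U"
    then obtain C where C: "C \<in> base" "C \<subseteq> U" using \<sigma>(3) by blast
    then have "zero_nbhd (ntop n) C" by (simp add: base_def)
    then have "zero_nbhd (ntop n) (C \<inter> topspace (ntop n))"
      by (rule zero_nbhd_Int[OF _ zero_nbhd_openin[OF openin_topspace lintop_zero[OF lintop_norm_topology[OF nrm]]]])
    then show "zero_nbhd (ntop n) {x \<in> topspace (ntop n). x \<in> U}"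
      by (rule zero_nbhd_mono) (use C(2) in auto)
  qed (auto simp: linear_on_def tn \<sigma>(2))
  then have "openin \<sigma> W \<Longrightarrow> openin \<tau> W" for W by (rule limit_finest[OF \<sigma>(1,2)])
  moreover have "zero_nbhd \<sigma> C" using \<sigma>(3) assms by blast
  ultimately show ?thesis unfolding zero_nbhd_def by blast
qed

text \<open>The linear inductive limit topology is locally convex because the system is countable: balls
  \<open>B k\<close> of \<open>X k\<close> are fitted into a sequence \<open>W\<close> of neighbourhoods with
  \<open>W (Suc k) + W (Suc k) \<subseteq> W k\<close>, and the sums \<open>B 0 + \<dots> + B m\<close> exhaust the required convex set.\<close>

lemma zero_nbhd_limitD:
  assumes "zero_nbhd \<tau> V"
  obtains C where "C \<in> base" "C \<subseteq> V"
proof -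
  let ?Q = "\<lambda>W U. \<forall>x\<in>W. \<forall>y\<in>W. x + y \<in> (U::'e set)"
  have step: "\<exists>W. zero_nbhd \<tau> W \<and> ?Q W U" if "zero_nbhd \<tau> U" for U
    by (rule zero_nbhd_half[OF limit_lintop that]) blast
  obtain W0 where W0: "zero_nbhd \<tau> W0" "?Q W0 V" using step[OF assms] by blast
  \<comment> \<open>The clause for \<open>n = 0\<close> fixes the start at \<open>W0\<close>, for
    which \<open>W0 + W0 \<subseteq> V\<close>: one summand is used by \<open>B 0\<close>, the other
    is the remainder carried along in \<open>CV\<close>.\<close>
  have "\<exists>W. \<forall>n. (zero_nbhd \<tau> (W n) \<and> (n = 0 \<longrightarrow> W n = W0)) \<and> ?Q (W (Suc n)) (W n)"
    by (rule dependent_nat_choice) (use W0 step in auto)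
  then obtain W where W: "\<And>n. zero_nbhd \<tau> (W n)" "W 0 = W0" "\<And>n. ?Q (W (Suc n)) (W n)" by blast
  have "\<exists>e>0. \<forall>x\<in>X k. N k x < e \<longrightarrow> x \<in> W k" for k
    using zero_nbhd_inclusion[OF W(1)] unfolding zero_nbhd_norm_topology[OF nrm] .
  then obtain e where e: "\<And>k. e k > 0" "\<And>k x. x \<in> X k \<Longrightarrow> N k x < e k \<Longrightarrow> x \<in> W k" by metis
  define B where "B k = {x \<in> X k. N k x < e k}" for k
  define C where "C = rec_nat (B 0) (\<lambda>m S. {a + b |a b. a \<in> S \<and> b \<in> B (Suc m)})"
  have C0: "C 0 = B 0" and CS: "C (Suc m) = {a + b |a b. a \<in> C m \<and> b \<in> B (Suc m)}" for m
    by (simp_all add: C_def)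
  have B0: "0 \<in> B k" for k
    using normed_space_onD(3)[OF nrm[of k], of 0] e(1)[of k]
      subspace_0[OF normed_space_onD(1)[OF nrm[of k]]] by (simp add: B_def)
  have acB: "absconvex (B k)" for k unfolding B_def by (rule absconvex_norm_ball[OF nrm])
  have acC: "absconvex (C m)" for m
  proof (induction m)
    case (Suc m)
    show ?case unfolding CS by (rule absconvex_sum[OF Suc acB])
  qed (simp add: C0 acB)
  have C0m: "0 \<in> C m" for m
  proof (induction m)
    case (Suc m)
    have "0 + 0 \<in> C (Suc m)" unfolding CS using Suc B0 by blast
    then show ?case by simp
  qed (simp add: C0 B0)
  have chain: "C m \<subseteq> C (Suc m)" for m
  proof
    fix x assume "x \<in> C m"
    then have "x + 0 \<in> C (Suc m)" unfolding CS using B0 by blast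
    then show "x \<in> C (Suc m)" by simp
  qed
  have BC: "B m \<subseteq> C m" for m
  proof (cases m)
    case (Suc k)
    show ?thesis
    proof
      fix x assume "x \<in> B m"
      then have "0 + x \<in> C (Suc k)" unfolding CS using C0m Suc by blast
      then show "x \<in> C m" using Suc by simp
    qed
  qed (simp add: C0)
  \<comment> \<open>The invariant \<open>C m + W m \<subseteq> V\<close> keeps room for all later
    summands: an element of \<open>B (Suc m)\<close> and the next remainder both lie in
    \<open>W (Suc m)\<close>, so their sum lies in \<open>W m\<close>. The remainder
    \<open>0\<close> gives \<open>C m \<subseteq> V\<close>.\<close>
  have CV: "\<forall>a\<in>C m. \<forall>w\<in>W m. a + w \<in> V" for m
  proof (induction m)
    case 0
    then show ?case using W0(2) W(2) e(2)[of _ 0] by (auto simp: C0 B_def)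
  next
    case (Suc m)
    show ?case
    proof (intro ballI)
      fix x w assume "x \<in> C (Suc m)" and w: "w \<in> W (Suc m)"
      then obtain a b where ab: "x = a + b" "a \<in> C m" "b \<in> B (Suc m)" unfolding CS by blast
      then have "b \<in> W (Suc m)" using e(2) by (simp add: B_def)
      then have "b + w \<in> W m" using W(3) w by blast
      then have "a + (b + w) \<in> V" using Suc ab by blast
      then show "x + w \<in> V" using ab by (simp add: add.assoc)
    qed
  qed
  have CX: "C m \<subseteq> (\<Union>n. X n)" for m
  proof (induction m)
    case (Suc m)
    have "subspace (\<Union>n. X n)" using lintop_subspace[OF limit_lintop] topspace_limit by simp
    note add = subspace_add[OF this]
    show ?case
    proof
      fix x assume "x \<in> C (Suc m)"
      then obtain a b where "x = a + b" "a \<in> C m" "b \<in> X (Suc m)" unfolding CS B_def by blast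
      then show "x \<in> (\<Union>n. X n)" using add[of a b] Suc by auto
    qed
  qed (auto simp: C0 B_def)
  show thesis
  proof (rule that[of "\<Union>m. C m"])
    have "zero_nbhd (ntop n) (\<Union>m. C m)" for n
      unfolding zero_nbhd_norm_topology[OF nrm] using BC[of n] e(1)[of n] by (auto simp: B_def)
    then show "(\<Union>m. C m) \<in> base"
      using absconvex_UN_chain[of C, OF acC chain] CX by (auto simp: base_def)
    have "x \<in> V" if "x \<in> C m" for x m
      using CV[of m] that zero_nbhd_zero[OF W(1)[of m]] by fastforce
    then show "(\<Union>m. C m) \<subseteq> V" by blast
  qed
qed

lemma locally_convex_limit: "locally_convex_space smul \<tau>"
  unfolding locally_convex_zero_nbhd
proof (intro conjI allI impI)
  fix U assume "zero_nbhd \<tau> U"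
  then obtain C where "C \<in> base" "C \<subseteq> U" by (rule zero_nbhd_limitD)
  then show "\<exists>C. zero_nbhd \<tau> C \<and> C \<subseteq> U \<and> convex_set smul C"
    using zero_nbhd_limit_base by (auto simp: base_def absconvex_def)
qed (rule limit_lintop)

text \<open>The trace of a barrel on a step is a barrel of the step, hence a neighbourhood of zero
  there; together with absolute convexity this is membership in \<open>base\<close>.\<close>

lemma barrelled_limit:
  assumes "\<And>n. barrelled_space smul (ntop n)"
  shows "barrelled_space smul \<tau>"
  unfolding barrelled_space_def
proof (intro conjI allI impI locally_convex_limit)
  fix B assume B: "barrel smul \<tau> B"
  have "zero_nbhd (ntop n) B" for n
  proof -
    have tn: "topspace (ntop n) = X n" by (rule topspace_norm_topology[OF nrm])
    have sub: "subspace (X n)" by (rule normed_space_onD(1)[OF nrm])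
    have "closedin (ntop n) {x \<in> topspace (ntop n). x \<in> B}"
      using B by (intro closedin_continuous_map_preimage[OF continuous_map_inclusion]) (simp add: barrel_def)
    moreover have "absconvex {x \<in> X n. x \<in> B}"
      by (rule absconvex_vimage[OF sub]) (use B in \<open>auto simp: linear_on_def barrel_absconvex\<close>)
    moreover have "\<exists>r>0. \<forall>c. norm c \<le> r \<longrightarrow> smul c x \<in> {x \<in> X n. x \<in> B}" if x: "x \<in> X n" for x
    proof -
      have "x \<in> topspace \<tau>" using x topspace_limit by auto
      then obtain r where "r > 0" "\<forall>c. norm c \<le> r \<longrightarrow> smul c x \<in> B" using B unfolding barrel_def by meson
      then show ?thesis using subspace_scale[OF sub x] by (intro exI[of _ r]) auto
    qed
    ultimately have "barrel smul (ntop n) {x \<in> X n. x \<in> B}" unfolding barrel_absconvex tn by blast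
    then have "zero_nbhd (ntop n) {x \<in> X n. x \<in> B}"
      using assms unfolding barrelled_space_def zero_nbhd_def by blast
    then show ?thesis by (rule zero_nbhd_mono) auto
  qed
  moreover have "B \<subseteq> (\<Union>n. X n)" using B closedin_subset topspace_limit by (force simp: barrel_def)
  ultimately have "B \<in> base" using B by (auto simp: base_def barrel_absconvex)
  from zero_nbhd_limit_base[OF this] show "\<exists>V. openin \<tau> V \<and> 0 \<in> V \<and> V \<subseteq> B" by (simp add: zero_nbhd_def)
qed

text \<open>The universal property of the limit for linear maps: it suffices that preimages of sets
  of \<open>base\<close> are again in \<open>base\<close>, and that is decided on the steps.\<close>

lemma continuous_map_limit_linear:
  assumes lin: "linear_on smul (topspace \<tau>) Q" and cont: "\<And>n. continuous_map (ntop n) \<tau> Q"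
  shows "continuous_map \<tau> \<tau> Q"
proof (rule continuous_map_linearI[OF limit_lintop limit_lintop lin])
  have tn: "topspace (ntop n) = X n" for n by (rule topspace_norm_topology[OF nrm])
  show "Q x \<in> topspace \<tau>" if "x \<in> topspace \<tau>" for x
    using cont that topspace_limit tn by (force simp: continuous_map_def Pi_iff)
  fix U assume "zero_nbhd \<tau> U"
  then obtain C where C: "C \<in> base" "C \<subseteq> U" by (rule zero_nbhd_limitD)
  have "zero_nbhd (ntop n) {x \<in> topspace \<tau>. Q x \<in> C}" for n
  proof (rule zero_nbhd_mono)
    show "zero_nbhd (ntop n) {x \<in> topspace (ntop n). Q x \<in> C}"
      by (rule zero_nbhd_preimage[OF cont linear_on_0[OF lin lintop_zero[OF limit_lintop]]
            lintop_zero[OF lintop_norm_topology[OF nrm]] zero_nbhd_limit_base[OF C(1)]])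
  qed (auto simp: tn topspace_limit)
  moreover have "absconvex {x \<in> topspace \<tau>. Q x \<in> C}"
    by (rule absconvex_vimage[OF lintop_subspace[OF limit_lintop] lin]) (use C in \<open>simp add: base_def\<close>)
  ultimately have "{x \<in> topspace \<tau>. Q x \<in> C} \<in> base"
    by (auto simp: base_def topspace_limit)
  from zero_nbhd_limit_base[OF this] show "zero_nbhd \<tau> {x \<in> topspace \<tau>. Q x \<in> U}"
    by (rule zero_nbhd_mono) (use C(2) in auto)
qed

end

context normed_scalar_space
begin

section \<open>The scale of extrapolation spaces\<close>

text \<open>The resolvent at \<open>0\<close> is formed with \<open>0 - A\<close>, hence with
  \<open>- A\<close>. Applied to \<open>A\<close> and to \<open>- A\<close>, the lemma gives both
  directions of \<open>zero_in_resolvent_set\<close>.\<close>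

lemma bij_betw_uminus:
  assumes "lintop \<tau>" "bij_betw A D (topspace \<tau>)" "continuous_map \<tau> \<tau> (the_inv_into D A)"
  shows "bij_betw (\<lambda>x. - A x) D (topspace \<tau>)" "continuous_map \<tau> \<tau> (the_inv_into D (\<lambda>x. - A x))"
proof -
  note sub = lintop_subspace[OF assms(1)]
  have "bij_betw uminus (topspace \<tau>) (topspace \<tau>)"
    by (rule bij_betwI[of _ _ _ uminus]) (auto simp: subspace_neg[OF sub])
  from bij_betw_trans[OF assms(2) this] show bij: "bij_betw (\<lambda>x. - A x) D (topspace \<tau>)"
    by (simp add: o_def)
  have neg: "continuous_map \<tau> \<tau> uminus"
    using continuous_map_scale[OF assms(1), of "-1"] by (simp add: scale_minus_left[of 1])
  have "continuous_map \<tau> \<tau> (the_inv_into D A \<circ> uminus)"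
    by (rule continuous_map_compose[OF neg assms(3)])
  then show "continuous_map \<tau> \<tau> (the_inv_into D (\<lambda>x. - A x))"
  proof (rule continuous_map_eq)
    fix y assume "y \<in> topspace \<tau>"
    then have y: "- y \<in> A ` D" using assms(2) subspace_neg[OF sub] by (auto simp: bij_betw_def)
    have inj: "inj_on A D" "inj_on (\<lambda>x. - A x) D" using assms(2) bij by (auto simp: bij_betw_def)
    show "(the_inv_into D A \<circ> uminus) y = the_inv_into D (\<lambda>x. - A x) y"
      by (rule sym, rule the_inv_into_f_eq[OF inj(2)])
         (use y inj in \<open>auto simp: f_the_inv_into_f the_inv_into_into\<close>)
  qed
qed

lemma zero_in_resolvent_set:
  assumes "lintop \<tau>"
  shows "0 \<in> resolvent_set smul \<tau> D A \<longleftrightarrow>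
    bij_betw A D (topspace \<tau>) \<and> continuous_map \<tau> \<tau> (the_inv_into D A)"
  using bij_betw_uminus[OF assms, of A D] bij_betw_uminus[OF assms, of "\<lambda>x. - A x" D]
  unfolding resolvent_set_def by auto

text \<open>The induction step along the scale: the first three conclusions are the hypotheses
  again, for the primed data. The two continuity assumptions of
  \<open>extrapolated_semigroup\<close> hold because \<open>N' (A x) = N x\<close> on
  \<open>D\<close> and \<open>N' x = N (?R x)\<close> on \<open>X\<close>.\<close>

lemma extrapolation_space_step:
  assumes ban: "banach_space_on smul X N"
    and T: "strongly_continuous_semigroup smul (norm_topology X N) T"
    and res: "0 \<in> resolvent_set smul (norm_topology X N)
      (generator_domain smul (norm_topology X N) T) (generator smul (norm_topology X N) T)"
    and ext: "extrapolation_space smul X N T X' N' T'"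
  shows "banach_space_on smul X' N'"
    and "strongly_continuous_semigroup smul (norm_topology X' N') T'"
    and "0 \<in> resolvent_set smul (norm_topology X' N')
      (generator_domain smul (norm_topology X' N') T') (generator smul (norm_topology X' N') T')"
    and "X \<subseteq> X'" and "continuous_map (norm_topology X N) (norm_topology X' N') (\<lambda>x. x)"
    and "\<And>t x. t \<ge> 0 \<Longrightarrow> x \<in> X \<Longrightarrow> T' t x = T t x"
    and "generator_domain smul (norm_topology X' N') T' = X"
    and "\<exists>J. homeomorphic_maps (norm_topology X N) (norm_topology X' N')
      (generator smul (norm_topology X' N') T') J"
proof -
  let ?t = "norm_topology X N" and ?t' = "norm_topology X' N'"
  define D where D: "D = generator_domain smul ?t T"
  define A where A: "A = generator smul ?t T"
  let ?R = "the_inv_into D A"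
  show ban': "banach_space_on smul X' N'" and XX': "X \<subseteq> X'"
    and T'e: "\<And>t x. t \<ge> 0 \<Longrightarrow> x \<in> X \<Longrightarrow> T' t x = T t x"
    using ext unfolding extrapolation_space_def Let_def by blast+
  have dense: "?t' closure_of X = X'" and N': "\<And>x. x \<in> X \<Longrightarrow> N' x = N (?R x)"
    and T'c: "\<And>t. t \<ge> 0 \<Longrightarrow> continuous_map ?t' ?t' (T' t)"
    using ext unfolding extrapolation_space_def Let_def D A by blast+
  have nrm: "normed_space_on smul X N" and nrm': "normed_space_on smul X' N'"
    using ban ban' by (auto simp: banach_space_on_def)
  note lt = lintop_norm_topology[OF nrm] and lt' = lintop_norm_topology[OF nrm']
  note ts = topspace_norm_topology[OF nrm] and ts' = topspace_norm_topology[OF nrm']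
  have bij: "bij_betw A D X" and Rc: "continuous_map ?t ?t ?R"
    using res ts unfolding zero_in_resolvent_set[OF lt] D A by auto
  have sub: "subspace X" by (rule normed_space_onD(1)[OF nrm])
  have subD: "subspace D" and linA: "linear_on smul D A"
    using generator_domain_linear[OF lt Hausdorff_norm_topology[OF nrm] T] D A by auto
  have linR: "linear_on smul X ?R" by (rule linear_on_the_inv_into[OF subD linA bij])
  have DX: "D \<subseteq> X" using generator_domain_subset ts D by blast
  have RX: "?R x \<in> D" if "x \<in> X" for x
    using bij that by (auto simp: bij_betw_def the_inv_into_into)
  have AX: "A x \<in> X" "N' (A x) = N x" if "x \<in> D" for x
  proof -
    show "A x \<in> X" using bij that by (auto simp: bij_betw_def)
    then show "N' (A x) = N x" using N' bij that by (simp add: bij_betw_def the_inv_into_f_f)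
  qed
  have AX': "A x \<in> X'" if "x \<in> D" for x using AX(1)[OF that] XX' by blast
  have tsD: "topspace (subtopology ?t D) = D" and tsX: "topspace (subtopology ?t' X) = X"
    using DX XX' ts ts' by auto
  \<comment> \<open>\<open>N' x\<close> is \<open>N (?R x)\<close>, and \<open>?R\<close> is
    continuous on \<open>X\<close> by the resolvent hypothesis.\<close>
  show incl: "continuous_map ?t ?t' (\<lambda>x. x)"
  proof (rule continuous_map_linearI[OF lt lt'])
    fix U assume "zero_nbhd ?t' U"
    then obtain e where e: "e > 0" "\<And>x. x \<in> X' \<Longrightarrow> N' x < e \<Longrightarrow> x \<in> U"
      unfolding zero_nbhd_norm_topology[OF nrm'] by blast
    have "zero_nbhd ?t {x \<in> X. N x < e}" using e(1) by (auto simp: zero_nbhd_norm_topology[OF nrm])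
    from zero_nbhd_preimage[OF Rc linear_on_0[OF linR subspace_0[OF sub]] lintop_zero[OF lt] this]
    show "zero_nbhd ?t {x \<in> topspace ?t. x \<in> U}"
      by (rule zero_nbhd_mono) (use e(2) N' XX' ts in auto)
  qed (use XX' ts ts' in \<open>auto simp: linear_on_def\<close>)
  have Ac: "continuous_map (subtopology ?t D) ?t' A"
  proof (rule continuous_map_linearI[OF subtopology_lintop[OF lt subD] lt'])
    fix U assume "zero_nbhd ?t' U"
    then obtain e where e: "e > 0" "\<And>x. x \<in> X' \<Longrightarrow> N' x < e \<Longrightarrow> x \<in> U"
      unfolding zero_nbhd_norm_topology[OF nrm'] by blast
    have "zero_nbhd ?t {x \<in> X. N x < e}" using e(1) by (auto simp: zero_nbhd_norm_topology[OF nrm])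
    from zero_nbhd_subtopology[OF this subspace_0[OF subD]]
    show "zero_nbhd (subtopology ?t D) {x \<in> topspace (subtopology ?t D). A x \<in> U}"
      unfolding tsD by (rule zero_nbhd_mono) (use e(2) AX(2) AX' in auto)
  qed (use DX ts ts' tsD linA AX XX' in auto)
  have Rc': "continuous_map (subtopology ?t' X) ?t ?R"
  proof (rule continuous_map_linearI[OF subtopology_lintop[OF lt' sub] lt])
    fix U assume "zero_nbhd ?t U"
    then obtain e where e: "e > 0" "\<And>x. x \<in> X \<Longrightarrow> N x < e \<Longrightarrow> x \<in> U"
      unfolding zero_nbhd_norm_topology[OF nrm] by blast
    have "zero_nbhd ?t' {x \<in> X'. N' x < e}" using e(1) by (auto simp: zero_nbhd_norm_topology[OF nrm'])
    from zero_nbhd_subtopology[OF this subspace_0[OF sub]]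
    show "zero_nbhd (subtopology ?t' X) {x \<in> topspace (subtopology ?t' X). ?R x \<in> U}"
      unfolding tsX by (rule zero_nbhd_mono) (use e(2)[OF subsetD[OF DX RX]] N' in auto)
  qed (use DX ts ts' tsX linR RX XX' in auto)
  have *: "strongly_continuous_semigroup smul ?t' T'" "generator_domain smul ?t' T' = topspace ?t"
    "\<exists>J. homeomorphic_maps ?t ?t' (generator smul ?t' T') J"
    by (rule extrapolated_semigroup[OF lt lt' Hausdorff_norm_topology[OF nrm]
          Hausdorff_norm_topology[OF nrm'] complete_tvs_norm_topology[OF ban]
          complete_tvs_norm_topology[OF ban'] T D A _ _ _ Ac _ T'c];
        use bij XX' dense Rc' T'e ts ts' in auto)+
  show "strongly_continuous_semigroup smul ?t' T'" by (rule *)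
  show dom: "generator_domain smul ?t' T' = X" using * ts by simp
  show "\<exists>J. homeomorphic_maps ?t ?t' (generator smul ?t' T') J" by (rule *)
  then obtain J where J: "homeomorphic_maps ?t ?t' (generator smul ?t' T') J" by blast
  let ?A' = "generator smul ?t' T'"
  have bij': "bij_betw ?A' X (topspace ?t')"
    by (rule bij_betwI[of _ _ _ J])
       (use J ts ts' in \<open>auto simp: homeomorphic_maps_def continuous_map_def Pi_iff\<close>)
  \<comment> \<open>The inverse generator at the new level is \<open>J\<close> followed by the
    inclusion of \<open>X\<close> in \<open>X'\<close>; this is how invertibility is passed
    on.\<close>
  have "continuous_map ?t' ?t' J"
    using continuous_map_compose[OF _ incl, of ?t' J] J by (simp add: homeomorphic_maps_def o_def)
  then have "continuous_map ?t' ?t' (the_inv_into X ?A')"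
  proof (rule continuous_map_eq)
    fix y assume "y \<in> topspace ?t'"
    then have "J y \<in> X" "?A' (J y) = y"
      using J ts by (auto simp: homeomorphic_maps_def continuous_map_def)
    then show "J y = the_inv_into X ?A' y"
      using bij' by (metis bij_betw_def the_inv_into_f_eq)
  qed
  then show "0 \<in> resolvent_set smul ?t' (generator_domain smul ?t' T') ?A'"
    unfolding zero_in_resolvent_set[OF lt'] dom using bij' by blast
qed

end

text \<open>Orbits are continuous maps on \<open>top_of_set\<close>, whose pointwise limits use
  \<open>atin\<close>; limits of real functions use \<open>at a within S\<close>.\<close>

lemma atin_top_of_set: "a \<in> S \<Longrightarrow> atin (top_of_set S) a = at a within S"
  unfolding atin_subtopology_within
  by (auto simp: filter_eq_iff eventually_atin_within eventually_at_topological)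

text \<open>Up to \<open>iso_Suc\<close> the assumptions record what
  \<open>extrapolation_space_step\<close> yields at every level, so the passage to the limit never
  returns to the formula for the extrapolated norm. The index shift in \<open>domain_Suc\<close> and
  \<open>iso_Suc\<close> matters: a step is the full domain of the generator one level up.\<close>

locale extrapolation_limit = inductive_limit smul X N \<tau>
  for smul :: "'k::real_normed_field \<Rightarrow> 'e::ab_group_add \<Rightarrow> 'e"
    and X :: "nat \<Rightarrow> 'e set" and N :: "nat \<Rightarrow> 'e \<Rightarrow> real" and \<tau> :: "'e topology" +
  fixes T :: "nat \<Rightarrow> real \<Rightarrow> 'e \<Rightarrow> 'e" and \<rho> :: "'e topology"
  assumes banach: "\<And>n. banach_space_on smul (X n) (N n)"
    and semigroup: "\<And>n. strongly_continuous_semigroup smul (norm_topology (X n) (N n)) (T n)"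
    and X_Suc: "\<And>n. X n \<subseteq> X (Suc n)"
    and inclusion_Suc: "\<And>n. continuous_map (norm_topology (X n) (N n))
      (norm_topology (X (Suc n)) (N (Suc n))) (\<lambda>x. x)"
    and T_Suc: "\<And>n t x. t \<ge> 0 \<Longrightarrow> x \<in> X n \<Longrightarrow> T (Suc n) t x = T n t x"
    and domain_Suc: "\<And>n. generator_domain smul (norm_topology (X (Suc n)) (N (Suc n))) (T (Suc n)) = X n"
    and iso_Suc: "\<And>n. \<exists>J. homeomorphic_maps (norm_topology (X n) (N n))
      (norm_topology (X (Suc n)) (N (Suc n)))
      (generator smul (norm_topology (X (Suc n)) (N (Suc n))) (T (Suc n))) J"
    and Hausdorff: "Hausdorff_space \<tau>"
    and completion: "tvs_completion smul \<tau> \<rho>"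
begin

section \<open>The semigroup and its generator on the inductive limit\<close>

abbreviation "G n \<equiv> generator smul (ntop n) (T n)"

lemma topspace_ntop: "topspace (ntop n) = X n"
  by (rule topspace_norm_topology[OF nrm])

lemma X_mono: "m \<le> n \<Longrightarrow> X m \<subseteq> X n"
  by (rule lift_Suc_mono_le[of X, OF X_Suc])

lemma X_limit: "x \<in> X n \<Longrightarrow> x \<in> topspace \<tau>"
  by (auto simp: topspace_limit)

lemma limit_directed:
  assumes "x \<in> topspace \<tau>" "y \<in> topspace \<tau>"
  obtains n where "x \<in> X n" "y \<in> X n"
proof -
  obtain m n where "x \<in> X m" "y \<in> X n" using assms by (auto simp: topspace_limit)
  then show thesis using that[of "max m n"] X_mono[of m "max m n"] X_mono[of n "max m n"] by auto
qed

text \<open>The least index is only a choice of representative; by \<open>T_Suc\<close> every step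
  containing \<open>x\<close> gives the same value for \<open>t \<ge> 0\<close>, see
  \<open>Q_eq\<close>.\<close>

definition Q :: "real \<Rightarrow> 'e \<Rightarrow> 'e" where
  "Q t x = T (LEAST n. x \<in> X n) t x"

lemma T_mono: "m \<le> n \<Longrightarrow> t \<ge> 0 \<Longrightarrow> x \<in> X m \<Longrightarrow> T n t x = T m t x"
proof (induction n rule: dec_induct)
  case (step n)
  then show ?case using T_Suc[of t x n] X_mono[of m n] by auto
qed simp

lemma Q_eq: "t \<ge> 0 \<Longrightarrow> x \<in> X n \<Longrightarrow> Q t x = T n t x"
  unfolding Q_def by (rule T_mono[symmetric]) (auto intro: Least_le LeastI)

lemma continuous_map_limit_eq:
  assumes "continuous_map \<sigma> (ntop n) f" "\<And>x. x \<in> topspace \<sigma> \<Longrightarrow> f x = g x"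
  shows "continuous_map \<sigma> \<tau> g"
  by (rule continuous_map_eq[OF continuous_map_compose[OF assms(1) continuous_map_inclusion]])
     (simp add: assms(2))

lemma Q_mapsto: "t \<ge> 0 \<Longrightarrow> x \<in> X n \<Longrightarrow> Q t x \<in> X n"
  using semigroup_mapsto[OF semigroup, of t x n] by (simp add: Q_eq topspace_ntop)

lemma Q_semigroup: "strongly_continuous_semigroup smul \<tau> Q"
  unfolding strongly_continuous_semigroup_def
proof (intro conjI ballI allI impI)
  fix t :: real assume t: "t \<ge> 0"
  have lin: "linear_on smul (topspace \<tau>) (Q t)"
    unfolding linear_on_def
  proof (intro conjI ballI allI)
    fix x y assume "x \<in> topspace \<tau>" "y \<in> topspace \<tau>"
    then obtain n where "x \<in> X n" "y \<in> X n" by (rule limit_directed)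
    then show "Q t (x + y) = Q t x + Q t y"
      using semigroup_linear[OF semigroup t, of n] subspace_add[OF normed_space_onD(1)[OF nrm]] t
      by (simp add: Q_eq[OF t, of _ n] linear_on_def topspace_ntop)
  next
    fix c x assume "x \<in> topspace \<tau>"
    then obtain n where "x \<in> X n" by (auto simp: topspace_limit)
    then show "Q t (smul c x) = smul c (Q t x)"
      using semigroup_linear[OF semigroup t, of n] subspace_scale[OF normed_space_onD(1)[OF nrm]] t
      by (simp add: Q_eq[OF t, of _ n] linear_on_def topspace_ntop)
  qed
  moreover have "continuous_map (ntop n) \<tau> (Q t)" for n
    by (rule continuous_map_limit_eq[OF semigroup_continuous[OF semigroup t]]) (simp add: Q_eq t topspace_ntop)
  ultimately show "continuous_linear_operator smul \<tau> (Q t)"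
    using continuous_map_limit_linear[OF lin] by (simp add: continuous_linear_operator_def)
next
  fix x assume "x \<in> topspace \<tau>"
  then obtain n where n: "x \<in> X n" by (auto simp: topspace_limit)
  then show "Q 0 x = x"
    using semigroup[of n] by (simp add: Q_eq strongly_continuous_semigroup_def topspace_ntop)
  have "continuous_map (top_of_set {0..}) (ntop n) (\<lambda>t. T n t x)"
    using semigroup[of n] n by (simp add: strongly_continuous_semigroup_def topspace_ntop)
  then show "continuous_map (top_of_set {0..}) \<tau> (\<lambda>t. Q t x)"
    by (rule continuous_map_limit_eq) (simp add: Q_eq[OF _ n])
next
  fix t s :: real and x assume ts: "t \<ge> 0" "s \<ge> 0" and "x \<in> topspace \<tau>"
  then obtain n where n: "x \<in> X n" by (auto simp: topspace_limit)
  have "T n (t + s) x = T n t (T n s x)"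
    using semigroup[of n] n ts by (simp add: strongly_continuous_semigroup_def topspace_ntop)
  then show "Q (t + s) x = Q t (Q s x)"
    using Q_mapsto[OF ts(2) n] ts n by (simp add: Q_eq[of _ _ n])
qed

abbreviation "A \<equiv> generator smul \<tau> Q"

lemma A_limit: "x \<in> generator_domain smul (ntop n) (T n) \<Longrightarrow> generator_limit smul \<tau> Q x (G n x)"
  by (rule generator_limit_linear_image[OF lintop_norm_topology[OF nrm] limit_lintop
        continuous_map_inclusion _ generator_limit_generator[OF Hausdorff_norm_topology[OF nrm]]])
     (use generator_domain_subset[of "ntop n" "T n"] semigroup_mapsto[OF semigroup] Q_eq topspace_ntop
       in \<open>auto simp: linear_on_def\<close>)

lemma A_eq: "x \<in> X n \<Longrightarrow> A x = G (Suc n) x"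
  by (rule generator_eq[OF Hausdorff A_limit]) (simp add: domain_Suc)

lemma A_domain: "generator_domain smul \<tau> Q = topspace \<tau>"
proof
  show "topspace \<tau> \<subseteq> generator_domain smul \<tau> Q"
  proof
    fix x assume x: "x \<in> topspace \<tau>"
    then obtain n where "x \<in> X n" by (auto simp: topspace_limit)
    then show "x \<in> generator_domain smul \<tau> Q"
      by (intro generator_domainI[OF x A_limit[of x "Suc n"]]) (simp add: domain_Suc)
  qed
qed (rule generator_domain_subset)

lemma A_linear: "linear_on smul (topspace \<tau>) A"
  using generator_domain_linear(2)[OF limit_lintop Hausdorff Q_semigroup] by (simp add: A_domain)

text \<open>\<open>A\<close> maps \<open>X n\<close> isomorphically onto \<open>X (Suc n)\<close>,
  so continuity of \<open>A\<close> and of its inverse can be checked on the steps. Linearity of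
  \<open>B\<close> is recorded because \<open>B\<close> has to be extended to the completion as
  well.\<close>

lemma A_homeomorphic: "\<exists>B. linear_on smul (topspace \<tau>) B \<and> homeomorphic_maps \<tau> \<tau> A B"
proof -
  obtain J where J: "\<And>n. homeomorphic_maps (ntop n) (ntop (Suc n)) (G (Suc n)) (J n)"
    using iso_Suc by metis
  have JX: "J n y \<in> X n" "A (J n y) = y" if "y \<in> X (Suc n)" for n y
  proof -
    show "J n y \<in> X n"
      using J[of n] that by (auto simp: homeomorphic_maps_def continuous_map_def topspace_ntop)
    then show "A (J n y) = y" using J[of n] that by (simp add: A_eq homeomorphic_maps_def topspace_ntop)
  qed
  have JA: "J n (A x) = x" "A x \<in> X (Suc n)" if "x \<in> X n" for n x
    using J[of n] that
    by (auto simp: A_eq[OF that] homeomorphic_maps_def continuous_map_def topspace_ntop)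
  have inj: "inj_on A (topspace \<tau>)"
  proof (rule inj_onI)
    fix x y assume xy: "x \<in> topspace \<tau>" "y \<in> topspace \<tau>" and eq: "A x = A y"
    obtain n where "x \<in> X n" "y \<in> X n" by (rule limit_directed[OF xy])
    then show "x = y" using JA(1) eq by metis
  qed
  have "bij_betw A (topspace \<tau>) (topspace \<tau>)"
    unfolding bij_betw_def
  proof (intro conjI inj set_eqI iffI)
    fix y assume "y \<in> A ` topspace \<tau>"
    then obtain x n where "y = A x" "x \<in> X n" by (auto simp: topspace_limit)
    then show "y \<in> topspace \<tau>" using JA(2) X_limit by blast
  next
    fix y assume "y \<in> topspace \<tau>"
    then obtain n where "y \<in> X n" by (auto simp: topspace_limit)
    then have y: "y \<in> X (Suc n)" using X_Suc by blast
    show "y \<in> A ` topspace \<tau>" using JX[OF y] X_limit by (metis imageI)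
  qed
  define B where "B = the_inv_into (topspace \<tau>) A"
  have linB: "linear_on smul (topspace \<tau>) B"
    unfolding B_def by (rule linear_on_the_inv_into[OF lintop_subspace[OF limit_lintop] A_linear]) fact
  have BJ: "B y = J n y" if "y \<in> X (Suc n)" for n y
    unfolding B_def by (rule the_inv_into_f_eq[OF inj JX(2)[OF that] X_limit[OF JX(1)[OF that]]])
  have contA: "continuous_map \<tau> \<tau> A"
  proof (rule continuous_map_limit_linear[OF A_linear])
    fix n
    have "continuous_map (ntop n) (ntop (Suc n)) (G (Suc n))" using J by (simp add: homeomorphic_maps_def)
    then show "continuous_map (ntop n) \<tau> A"
      by (rule continuous_map_limit_eq) (simp add: A_eq topspace_ntop)
  qed
  have contB: "continuous_map \<tau> \<tau> B"
  proof (rule continuous_map_limit_linear[OF linB])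
    fix n
    \<comment> \<open>\<open>B\<close> on \<open>X n\<close> factors through the inclusion into
      \<open>X (Suc n)\<close>, the space on which \<open>J n\<close> is defined.\<close>
    have "continuous_map (ntop n) (ntop n) (J n \<circ> (\<lambda>x. x))"
      by (rule continuous_map_compose[OF inclusion_Suc]) (use J in \<open>simp add: homeomorphic_maps_def\<close>)
    then show "continuous_map (ntop n) \<tau> B"
      by (rule continuous_map_limit_eq) (use BJ[OF subsetD[OF X_Suc]] in \<open>simp add: topspace_ntop\<close>)
  qed
  have "homeomorphic_maps \<tau> \<tau> A B"
    unfolding homeomorphic_maps_def
  proof (intro conjI contA contB ballI)
    show "B (A x) = x" if "x \<in> topspace \<tau>" for x
      unfolding B_def by (rule the_inv_into_f_f[OF inj that])
    show "A (B y) = y" if "y \<in> topspace \<tau>" for y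
      unfolding B_def by (rule f_the_inv_into_f_bij_betw) (use \<open>bij_betw A _ _\<close> that in auto)
  qed
  then show ?thesis using linB by blast
qed

section \<open>Extension to the completion\<close>

lemma rho: "lintop \<rho>" "Hausdorff_space \<rho>" "complete_tvs \<rho>" "topspace \<tau> \<subseteq> topspace \<rho>"
  "subtopology \<rho> (topspace \<tau>) = \<tau>" "\<rho> closure_of topspace \<tau> = topspace \<rho>"
  using completion by (auto simp: tvs_completion_def)

lemma limit_barrelled: "barrelled_space smul \<tau>"
  by (rule barrelled_limit[OF barrelled_norm_topology[OF banach]])

lemma rho_locally_convex: "locally_convex_space smul \<rho>"
  using locally_convex_completion[OF rho(1) lintop_subspace[OF limit_lintop] rho(4,6)]
    locally_convex_limit rho(5) by simp

lemma rho_barrelled: "barrelled_space smul \<rho>"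
  using barrelled_completion[OF rho(1) lintop_subspace[OF limit_lintop] rho(4,6)]
    limit_barrelled rho(5) by simp

lemma continuous_map_into_rho: "continuous_map \<sigma> \<tau> f \<Longrightarrow> continuous_map \<sigma> \<rho> f"
  using rho(5) continuous_map_into_fulltopology by metis

lemma limitin_rho: "limitin \<tau> f l F \<Longrightarrow> limitin \<rho> f l F"
  using rho(5) by (metis limitin_subtopology)

lemma extend:
  assumes "linear_on smul (topspace \<tau>) P" "continuous_map \<tau> \<tau> P"
  shows "\<exists>R. continuous_map \<rho> \<rho> R \<and> linear_on smul (topspace \<rho>) R \<and> (\<forall>x\<in>topspace \<tau>. R x = P x)"
proof -
  have "continuous_map (subtopology \<rho> (topspace \<tau>)) \<rho> P"
    using continuous_map_into_rho[OF assms(2)] rho(5) by simp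
  then show ?thesis
    by (rule continuous_linear_extension[OF rho(1,1,2,3) lintop_subspace[OF limit_lintop] rho(4,6) _ assms(1)])
       blast
qed

text \<open>The choice is meaningful for \<open>t \<ge> 0\<close>, where \<open>extend\<close>
  provides such an \<open>R\<close>; density makes it unique on the carrier.\<close>

definition Tinf :: "real \<Rightarrow> 'e \<Rightarrow> 'e" where
  "Tinf t = (SOME R. continuous_map \<rho> \<rho> R \<and> linear_on smul (topspace \<rho>) R \<and> (\<forall>x\<in>topspace \<tau>. R x = Q t x))"

lemma Tinf:
  assumes "t \<ge> 0"
  shows "continuous_map \<rho> \<rho> (Tinf t)" "linear_on smul (topspace \<rho>) (Tinf t)"
    "\<And>x. x \<in> topspace \<tau> \<Longrightarrow> Tinf t x = Q t x"
  using someI_ex[OF extend[OF semigroup_linear[OF Q_semigroup assms] semigroup_continuous[OF Q_semigroup assms]]]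
  unfolding Tinf_def by auto

lemma rho_eqI:
  assumes "continuous_map \<rho> \<rho> f" "continuous_map \<rho> \<rho> g" "\<And>x. x \<in> topspace \<tau> \<Longrightarrow> f x = g x"
    "x \<in> topspace \<rho>"
  shows "f x = g x"
  by (rule continuous_map_eq_dense[OF rho(2) assms(1,2) rho(6) assms(3,4)])

lemma compact_orbit_bounded:
  assumes "continuous_map (top_of_set S) \<rho> q" "compact K" "K \<subseteq> S" "zero_nbhd \<rho> U"
  shows "\<exists>r>0. \<forall>i\<in>K. \<forall>c. norm c \<le> r \<longrightarrow> smul c (q i) \<in> U"
proof -
  have "compactin (top_of_set S) K" using assms by (simp add: compactin_subtopology)
  from compactin_absorbed[OF rho(1) assms(4) image_compactin[OF this assms(1)]] show ?thesis by simp
qed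

lemma orbit_rho: "x \<in> topspace \<tau> \<Longrightarrow> continuous_map (top_of_set {0..}) \<rho> (\<lambda>t. Tinf t x)"
  by (rule continuous_map_into_rho, rule continuous_map_eq[of _ _ "\<lambda>t. Q t x"])
     (use Q_semigroup Tinf(3) in \<open>auto simp: strongly_continuous_semigroup_def\<close>)

lemma limitin_rho_dense:
  assumes "\<And>i. i \<in> I \<Longrightarrow> linear_on smul (topspace \<rho>) (P i)" "\<And>i. i \<in> I \<Longrightarrow> continuous_map \<rho> \<rho> (P i)"
    "linear_on smul (topspace \<rho>) P0" "continuous_map \<rho> \<rho> P0"
    "\<And>x U. x \<in> topspace \<tau> \<Longrightarrow> zero_nbhd \<rho> U \<Longrightarrow>
      \<exists>r>0. \<forall>i\<in>I. \<forall>c. norm c \<le> r \<longrightarrow> smul c (P i x) \<in> U"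
    "eventually (\<lambda>i. i \<in> I) F" "\<And>x. x \<in> topspace \<tau> \<Longrightarrow> limitin \<rho> (\<lambda>i. P i x) (P0 x) F"
    "x \<in> topspace \<rho>"
  shows "limitin \<rho> (\<lambda>i. P i x) (P0 x) F"
  by (rule limitin_dense_barrelled[OF rho(1) rho_locally_convex lintop_subspace[OF limit_lintop] rho(4,6)
        _ assms]) (simp add: rho(5) limit_barrelled)

lemma Tinf_semigroup: "strongly_continuous_semigroup smul \<rho> Tinf"
  unfolding strongly_continuous_semigroup_def
proof (intro conjI ballI allI impI)
  show "continuous_linear_operator smul \<rho> (Tinf t)" if "t \<ge> 0" for t
    using Tinf[OF that] by (simp add: continuous_linear_operator_def)
next
  fix x assume x: "x \<in> topspace \<rho>"
  show "Tinf 0 x = x"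
    by (rule rho_eqI[OF Tinf(1) _ _ x])
       (use Tinf(3)[OF order_refl] Q_semigroup in \<open>auto simp: strongly_continuous_semigroup_def\<close>)
next
  fix t s :: real and x assume ts: "t \<ge> 0" "s \<ge> 0" and x: "x \<in> topspace \<rho>"
  show "Tinf (t + s) x = Tinf t (Tinf s x)"
  proof (rule rho_eqI[OF Tinf(1) _ _ x])
    show "continuous_map \<rho> \<rho> (\<lambda>x. Tinf t (Tinf s x))"
      using continuous_map_compose[OF Tinf(1)[OF ts(2)] Tinf(1)[OF ts(1)]] by (simp add: o_def)
    show "Tinf (t + s) x = Tinf t (Tinf s x)" if x: "x \<in> topspace \<tau>" for x
      using ts x semigroup_mapsto[OF Q_semigroup ts(2) x] Q_semigroup
      by (simp add: Tinf(3) strongly_continuous_semigroup_def)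
  qed (use ts in auto)
next
  fix x assume x: "x \<in> topspace \<rho>"
  show "continuous_map (top_of_set {0..}) \<rho> (\<lambda>t. Tinf t x)"
    unfolding continuous_map_atin
  proof
    fix t0 :: real assume "t0 \<in> topspace (top_of_set {0..})"
    then have t0: "t0 \<ge> 0" by simp
    show "limitin \<rho> (\<lambda>t. Tinf t x) (Tinf t0 x) (atin (top_of_set {0..}) t0)"
    \<comment> \<open>The interval is compact, so orbits over it are bounded, and it is a
      neighbourhood of \<open>t0\<close> in \<open>{0..}\<close>; the margin \<open>1\<close> is
      arbitrary.\<close>
    proof (rule limitin_rho_dense[of "{0..t0 + 1}", OF _ _ _ _ _ _ _ x])
      show "\<exists>r>0. \<forall>i\<in>{0..t0 + 1}. \<forall>c. norm c \<le> r \<longrightarrow> smul c (Tinf i y) \<in> U"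
        if "y \<in> topspace \<tau>" "zero_nbhd \<rho> U" for y U
        by (rule compact_orbit_bounded[OF orbit_rho[OF that(1)] _ _ that(2)]) auto
      have "eventually (\<lambda>t. t \<in> {0..}) (at t0 within {0..})" by (simp add: eventually_at_filter)
      moreover have "eventually (\<lambda>t. t < t0 + 1) (at t0 within {0..})"
        by (rule order_tendstoD(2)[OF tendsto_ident_at]) simp
      ultimately show "eventually (\<lambda>t. t \<in> {0..t0 + 1}) (atin (top_of_set {0..}) t0)"
        unfolding atin_top_of_set[of t0 "{0..}", simplified, OF t0] by eventually_elim auto
      show "limitin \<rho> (\<lambda>t. Tinf t y) (Tinf t0 y) (atin (top_of_set {0..}) t0)" if "y \<in> topspace \<tau>" for y
        using orbit_rho[OF that] t0 unfolding continuous_map_atin by simp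
    qed (use Tinf t0 in auto)
  qed
qed

definition diff_quotient :: "real \<Rightarrow> 'e \<Rightarrow> 'e" where
  "diff_quotient t x = smul (of_real (1 / t)) (Tinf t x - x)"

lemma diff_quotient_limit:
  assumes "x \<in> topspace \<tau>"
  shows "limitin \<rho> (\<lambda>t. diff_quotient t x) (A x) (at_right 0)"
proof -
  have "limitin \<tau> (\<lambda>t. smul (of_real (1 / t)) (Q t x - x)) (A x) (at_right 0)"
    using generator_limit_generator[OF Hausdorff, of x Q] assms by (simp add: A_domain generator_limit_def)
  then show ?thesis
    unfolding diff_quotient_def
    by (intro limitin_at_right_0_cong[OF limitin_rho]) (simp_all add: Tinf(3)[OF _ assms])
qed

text \<open>Adding the value \<open>A x\<close> at \<open>0\<close> makes the difference quotients
  of a fixed orbit a continuous curve on the compact interval \<open>{0..1}\<close>, so its image is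
  bounded.\<close>

lemma diff_quotient_bounded:
  assumes x: "x \<in> topspace \<tau>" and U: "zero_nbhd \<rho> U"
  shows "\<exists>r>0. \<forall>t\<in>{0<..1}. \<forall>c. norm c \<le> r \<longrightarrow> smul c (diff_quotient t x) \<in> U"
proof -
  define q where "q t = (if t = 0 then A x else diff_quotient t x)" for t
  have "continuous_map (top_of_set {0..1}) \<rho> q"
    unfolding continuous_map_atin
  proof
    fix t0 :: real assume "t0 \<in> topspace (top_of_set {0..1})"
    then have t0: "0 \<le> t0" "t0 \<le> 1" by auto
    then have F: "atin (top_of_set {0..1}) t0 = at t0 within {0..1}" by (simp add: atin_top_of_set)
    show "limitin \<rho> q (q t0) (atin (top_of_set {0..1}) t0)"
    proof (cases "t0 = 0")
      case True
      have "limitin \<rho> q (A x) (at_right 0)"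
        by (rule limitin_at_right_0_cong[OF diff_quotient_limit[OF x]]) (simp add: q_def)
      moreover have "at 0 within {0..1::real} = at_right 0" by (rule at_within_Icc_at_right) simp
      ultimately show ?thesis unfolding F by (simp add: True q_def)
    next
      case False
      have x\<rho>: "x \<in> topspace \<rho>" using x rho(4) by auto
      have "continuous_map (top_of_set {0..1}) \<rho> (\<lambda>t. Tinf t x - x)"
        using continuous_map_from_subtopology_mono[OF orbit_rho[OF x], of "{0..1}"]
        by (intro continuous_map_lintop_diff[OF rho(1)]) (auto simp: x\<rho>)
      then have 1: "limitin \<rho> (\<lambda>t. Tinf t x - x) (Tinf t0 x - x) (at t0 within {0..1})"
        using t0 unfolding continuous_map_atin F[symmetric] by simp
      have "((\<lambda>t. of_real (1 / t)) \<longlongrightarrow> (of_real (1 / t0) :: 'k)) (at t0 within {0..1})"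
        using False by (intro tendsto_intros) auto
      from limitin_lintop_smul[OF rho(1) this 1]
      have "limitin \<rho> (\<lambda>t. diff_quotient t x) (diff_quotient t0 x) (at t0 within {0..1})"
        by (simp add: diff_quotient_def)
      moreover have "eventually (\<lambda>t. t \<noteq> 0) (at t0 within {0..1})"
        using tendsto_imp_eventually_ne[OF tendsto_ident_at False] .
      then have "eventually (\<lambda>t. diff_quotient t x = q t) (at t0 within {0..1})"
        by (rule eventually_mono) (simp add: q_def)
      ultimately show ?thesis unfolding F q_def[of t0] using False
        by (simp add: limitin_transform_eventually)
    qed
  qed
  from compact_orbit_bounded[OF this compact_Icc order_refl U]
  obtain r where "r > 0" "\<forall>t\<in>{0..1}. \<forall>c. norm c \<le> r \<longrightarrow> smul c (q t) \<in> U" by blast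
  moreover have "q t = diff_quotient t x" "t \<in> {0..1}" if "t \<in> {0<..1}" for t using that by (auto simp: q_def)
  ultimately show ?thesis by (intro exI[of _ r]) metis
qed

text \<open>The candidate \<open>A'\<close> is the extension of \<open>A\<close>. That it is an
  isomorphism follows by extending the inverse too; that it is the generator needs equicontinuity of
  the difference quotients, because their limit is known only on the dense subspace.\<close>

lemma generator_rho:
  obtains A' where "continuous_map \<rho> \<rho> A'" "linear_on smul (topspace \<rho>) A'"
    "homeomorphic_map \<rho> \<rho> A'" "\<And>x. x \<in> topspace \<rho> \<Longrightarrow> generator_limit smul \<rho> Tinf x (A' x)"
proof -
  obtain B where B: "linear_on smul (topspace \<tau>) B" "homeomorphic_maps \<tau> \<tau> A B"
    using A_homeomorphic by blast
  then have cont: "continuous_map \<tau> \<tau> A" "continuous_map \<tau> \<tau> B" by (auto simp: homeomorphic_maps_def)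
  obtain A' where A': "continuous_map \<rho> \<rho> A'" "linear_on smul (topspace \<rho>) A'" "\<forall>x\<in>topspace \<tau>. A' x = A x"
    using extend[OF A_linear cont(1)] by blast
  obtain B' where B': "continuous_map \<rho> \<rho> B'" "\<forall>x\<in>topspace \<tau>. B' x = B x"
    using extend[OF B(1) cont(2)] by blast
  have AB: "A x \<in> topspace \<tau>" "B x \<in> topspace \<tau>" "B (A x) = x" "A (B x) = x" if "x \<in> topspace \<tau>" for x
    using B(2) that by (auto simp: homeomorphic_maps_def continuous_map_def)
  have BA': "B' (A' x) = x" if "x \<in> topspace \<rho>" for x
    by (rule rho_eqI[OF continuous_map_compose[OF A'(1) B'(1), unfolded o_def] _ _ that])
       (use A' B' AB in auto)
  have AB': "A' (B' x) = x" if "x \<in> topspace \<rho>" for x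
    by (rule rho_eqI[OF continuous_map_compose[OF B'(1) A'(1), unfolded o_def] _ _ that])
       (use A' B' AB in auto)
  have "homeomorphic_maps \<rho> \<rho> A' B'" using A' B' BA' AB' by (simp add: homeomorphic_maps_def)
  then have "homeomorphic_map \<rho> \<rho> A'" by (simp add: homeomorphic_maps_map)
  moreover have "generator_limit smul \<rho> Tinf x (A' x)" if x: "x \<in> topspace \<rho>" for x
    unfolding generator_limit_def diff_quotient_def[symmetric]
  proof (rule limitin_rho_dense[of "{0<..1}", OF _ _ A'(2,1) diff_quotient_bounded _ _ x])
    fix t :: real assume t: "t \<in> {0<..1}"
    then have t0: "t \<ge> 0" by simp
    show "continuous_map \<rho> \<rho> (diff_quotient t)"
      unfolding diff_quotient_def
      by (intro continuous_map_lintop_smul continuous_map_lintop_diff rho Tinf(1)[OF t0]) auto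
    show "linear_on smul (topspace \<rho>) (diff_quotient t)"
      using Tinf(2)[OF t0] unfolding linear_on_def diff_quotient_def
      by (auto simp: mult.commute algebra_simps)
  next
    show "limitin \<rho> (\<lambda>t. diff_quotient t x) (A' x) (at_right 0)" if "x \<in> topspace \<tau>" for x
      using diff_quotient_limit[OF that] A'(3) that by simp
    show "\<forall>\<^sub>F t in at_right 0. t \<in> {0<..1::real}"
      by (simp add: eventually_at_right_less eventually_at_right_field) (intro exI[of _ 1], auto)
  qed
  ultimately show thesis using that A' by blast
qed

text \<open>The clause over all \<open>R\<close> makes \<open>Tinf t\<close> the only operator on
  the carrier induced by the \<open>T n t\<close>, which justifies speaking of the induced
  semigroup.\<close>

theorem extrapolation_limit:
  shows "(\<forall>t\<ge>0. induces_operator smul X \<tau> \<rho> (\<lambda>n. T n t) (Tinf t) \<and>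
          (\<forall>R. induces_operator smul X \<tau> \<rho> (\<lambda>n. T n t) R \<longrightarrow>
             (\<forall>x\<in>topspace \<rho>. R x = Tinf t x)))"
    and "generator_domain smul \<rho> Tinf = topspace \<rho>"
    and "linear_on smul (topspace \<rho>) (generator smul \<rho> Tinf)"
    and "homeomorphic_map \<rho> \<rho> (generator smul \<rho> Tinf)"
    and "\<And>t n x. t \<ge> 0 \<Longrightarrow> x \<in> X n \<Longrightarrow> Tinf t x = T n t x"
    and "\<And>n x. x \<in> generator_domain smul (ntop n) (T n) \<Longrightarrow> generator smul \<rho> Tinf x = G n x"
proof -
  show ext: "Tinf t x = T n t x" if "t \<ge> 0" "x \<in> X n" for t n x
    using Tinf(3)[OF that(1) X_limit[OF that(2)]] Q_eq[OF that] by simp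
  show "\<forall>t\<ge>0. induces_operator smul X \<tau> \<rho> (\<lambda>n. T n t) (Tinf t) \<and>
          (\<forall>R. induces_operator smul X \<tau> \<rho> (\<lambda>n. T n t) R \<longrightarrow>
             (\<forall>x\<in>topspace \<rho>. R x = Tinf t x))"
  proof (intro allI impI conjI ballI)
    fix t :: real assume t: "t \<ge> 0"
    show "induces_operator smul X \<tau> \<rho> (\<lambda>n. T n t) (Tinf t)"
      unfolding induces_operator_def
      using Q_semigroup Tinf[OF t] Q_eq[OF t] t
      by (intro exI[of _ "Q t"]) (auto simp: strongly_continuous_semigroup_def continuous_linear_operator_def)
    fix R x assume R: "induces_operator smul X \<tau> \<rho> (\<lambda>n. T n t) R" and x: "x \<in> topspace \<rho>"
    show "R x = Tinf t x"
    proof (rule rho_eqI[OF _ Tinf(1)[OF t] _ x])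
      show "continuous_map \<rho> \<rho> R"
        using R by (auto simp: induces_operator_def continuous_linear_operator_def)
      show "R y = Tinf t y" if y: "y \<in> topspace \<tau>" for y
      proof -
        obtain n where n: "y \<in> X n" using y by (auto simp: topspace_limit)
        then have "R y = T n t y" using R y unfolding induces_operator_def by metis
        then show ?thesis using ext[OF t n] by simp
      qed
    qed
  qed
  obtain A' where A': "continuous_map \<rho> \<rho> A'" "linear_on smul (topspace \<rho>) A'"
    "homeomorphic_map \<rho> \<rho> A'" "\<And>x. x \<in> topspace \<rho> \<Longrightarrow> generator_limit smul \<rho> Tinf x (A' x)"
    by (rule generator_rho) blast
  show dom: "generator_domain smul \<rho> Tinf = topspace \<rho>"
    using A'(4) generator_domain_subset by (auto intro: generator_domainI)
  show "linear_on smul (topspace \<rho>) (generator smul \<rho> Tinf)"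
    using generator_domain_linear(2)[OF rho(1,2) Tinf_semigroup] dom by simp
  show "homeomorphic_map \<rho> \<rho> (generator smul \<rho> Tinf)"
    by (rule homeomorphic_map_eq[OF A'(3)]) (simp add: generator_eq[OF rho(2) A'(4)])
  \<comment> \<open>The difference quotients converge already in the Banach topology of
    \<open>X n\<close>; the limit persists in \<tau> and in \<rho>, where limits are unique.\<close>
  show "generator smul \<rho> Tinf x = G n x" if x: "x \<in> generator_domain smul (ntop n) (T n)" for n x
  proof (rule generator_eq[OF rho(2)])
    have xX: "x \<in> X n" using x generator_domain_subset topspace_ntop by blast
    show "generator_limit smul \<rho> Tinf x (G n x)"
      using limitin_rho[OF A_limit[OF x, unfolded generator_limit_def]] unfolding generator_limit_def
      by (rule limitin_at_right_0_cong) (simp add: Tinf(3)[OF _ X_limit[OF xX]])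
  qed
qed

end

theorem theoremA:
  fixes smul :: "'k::real_normed_field \<Rightarrow> 'e::ab_group_add \<Rightarrow> 'e"
    and X :: "nat \<Rightarrow> 'e set" and N :: "nat \<Rightarrow> 'e \<Rightarrow> real" and T :: "nat \<Rightarrow> real \<Rightarrow> 'e \<Rightarrow> 'e"
    and \<tau> \<rho> :: "'e topology"
  assumes "vector_space smul"
    and "banach_space_on smul (X 0) (N 0)"
    and "strongly_continuous_semigroup smul (norm_topology (X 0) (N 0)) (T 0)"
    and "0 \<in> resolvent_set smul (norm_topology (X 0) (N 0))
               (generator_domain smul (norm_topology (X 0) (N 0)) (T 0))
               (generator smul (norm_topology (X 0) (N 0)) (T 0))"
    and "\<And>n. extrapolation_space smul (X n) (N n) (T n) (X (Suc n)) (N (Suc n)) (T (Suc n))"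
    and "inductive_limit_topology smul X N \<tau>"
    and "Hausdorff_space \<tau>"
    and "tvs_completion smul \<tau> \<rho>"
  shows "locally_convex_space smul \<rho> \<and> Hausdorff_space \<rho> \<and> complete_tvs \<rho> \<and>
    barrelled_space smul \<rho> \<and>
    (\<exists>Tinf.
       (\<forall>t\<ge>0. induces_operator smul X \<tau> \<rho> (\<lambda>n. T n t) (Tinf t) \<and>
          (\<forall>R. induces_operator smul X \<tau> \<rho> (\<lambda>n. T n t) R \<longrightarrow>
             (\<forall>x\<in>topspace \<rho>. R x = Tinf t x))) \<and>
       strongly_continuous_semigroup smul \<rho> Tinf \<and>
       generator_domain smul \<rho> Tinf = topspace \<rho> \<and>
       linear_on smul (topspace \<rho>) (generator smul \<rho> Tinf) \<and>
       homeomorphic_map \<rho> \<rho> (generator smul \<rho> Tinf) \<and>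
       (\<forall>t\<ge>0. \<forall>n\<ge>1. \<forall>x\<in>X n. Tinf t x = T n t x) \<and>
       (\<forall>n\<ge>1. \<forall>x\<in>generator_domain smul (norm_topology (X n) (N n)) (T n).
          generator smul \<rho> Tinf x = generator smul (norm_topology (X n) (N n)) (T n) x))"
proof -
  interpret normed_scalar_space smul by (simp add: normed_scalar_space_def assms(1))
  \<comment> \<open>These three properties are what one extrapolation step both needs and
    reproduces, so they hold at all levels.\<close>
  have inv: "banach_space_on smul (X n) (N n) \<and>
    strongly_continuous_semigroup smul (norm_topology (X n) (N n)) (T n) \<and>
    0 \<in> resolvent_set smul (norm_topology (X n) (N n))
               (generator_domain smul (norm_topology (X n) (N n)) (T n))
               (generator smul (norm_topology (X n) (N n)) (T n))" for n
  proof (induction n)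
    case 0
    show ?case using assms(2-4) by blast
  next
    case (Suc n)
    then show ?case using extrapolation_space_step(1-3)[OF _ _ _ assms(5)] by blast
  qed
  then have 1: "banach_space_on smul (X n) (N n)"
    and 2: "strongly_continuous_semigroup smul (norm_topology (X n) (N n)) (T n)"
    and 3: "0 \<in> resolvent_set smul (norm_topology (X n) (N n))
               (generator_domain smul (norm_topology (X n) (N n)) (T n))
               (generator smul (norm_topology (X n) (N n)) (T n))" for n
    by blast+
  interpret extrapolation_limit smul X N \<tau> T \<rho>
    by unfold_locales
       (fact 1 2 assms extrapolation_space_step(4-8)[OF 1 2 3 assms(5)] | use 1 in \<open>simp add: banach_space_on_def\<close>)+
  show ?thesis
    using rho_locally_convex rho(2,3) rho_barrelled Tinf_semigroup extrapolation_limit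
    by (intro conjI exI[of _ Tinf]) auto
qed

end
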